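(* Let $N\ge1$. The algebra $\operatorname{Ext}\bigl(\bigoplus_{j=0}^NM(j),\bigoplus_{j=0}^NM(j)\bigr)$, where $M(0),\dots,M(N)$ are the cell modules of $K_N^1$, is isomorphic to the path algebra over $\mathbb C$ of the quiver with vertices $0,1,\dots,N$ and, for each $1\le j\le N$, two arrows $\mathrm{Id}_j,F_j:j\to j-1$, modulo the relations $$F_j\,F_{j-1}=0,\qquad F_j\,\mathrm{Id}_{j-1}=\mathrm{Id}_j\,F_{j-1}\qquad(2\le j\le N),$$ with paths composed from left to right, vertex $j$ corresponding to $M(j)$.
   Context: The category of finite-dimensional $K_N^1$-modules ($K_N^1$ = Khovanov's diagram algebra) is equivalent to the principal block of the parabolic category $\mathcal O^{\mathfrak p}$ for $\mathfrak g=\mathfrak{gl}_{N+1}(\mathbb C)$ and $\mathfrak p$ the block upper triangular parabolic subalgebra with Levi component $\mathfrak{gl}_N\oplus\mathfrak{gl}_1$, cell modules corresponding to parabolic Verma modules. Under this identification, $M(j)$ for $0\le j\le N$ is the parabolic Verma module of highest weight $\lambda$, where, with $\rho=(N,N-1,\dots,1,0)$, the first $N$ entries of $\lambda+\rho$ are the elements of $\{0,\dots,N\}\setminus\{j\}$ in decreasing order and the last entry is $j$; so $M(0)$ has highest weight $0$. The product on the Ext-algebra is the Yoneda product written from left to right: for $x\in\operatorname{Ext}^i(M(a),M(b))$ and $y\in\operatorname{Ext}^j(M(b),M(c))$, $x\cdot y\in\operatorname{Ext}^{i+j}(M(a),M(c))$. *)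

theory Defs
  imports Complex_Main "HOL-Algebra.QuotRing" "HOL-Algebra.Module" "HOL-Library.FuncSet"
    "Graph_Theory.Arc_Walk"
begin

section \<open>Algebras over the complex numbers and their finite-dimensional modules\<close>

text \<open>
  A complex algebra is a record of type \<open>(complex, 'a) module\<close>: the ring structure together with
  the scalar multiplication.  A left module over it is a record of type \<open>('a, 'b) module\<close>, whose
  (meaningless) fields \<open>mult\<close> and \<open>one\<close> are left \<open>undefined\<close>.  The library's locale \<open>module\<close>
  requires a commutative ring of scalars.
\<close>

locale left_module = R?: ring R + M?: abelian_group M for R (structure) and M (structure) +
  assumes smult_closed: "\<lbrakk>a \<in> carrier R; x \<in> carrier M\<rbrakk> \<Longrightarrow> a \<odot>\<^bsub>M\<^esub> x \<in> carrier M"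
    and smult_l_distr: "\<lbrakk>a \<in> carrier R; b \<in> carrier R; x \<in> carrier M\<rbrakk> \<Longrightarrow>
      (a \<oplus>\<^bsub>R\<^esub> b) \<odot>\<^bsub>M\<^esub> x = a \<odot>\<^bsub>M\<^esub> x \<oplus>\<^bsub>M\<^esub> b \<odot>\<^bsub>M\<^esub> x"
    and smult_r_distr: "\<lbrakk>a \<in> carrier R; x \<in> carrier M; y \<in> carrier M\<rbrakk> \<Longrightarrow>
      a \<odot>\<^bsub>M\<^esub> (x \<oplus>\<^bsub>M\<^esub> y) = a \<odot>\<^bsub>M\<^esub> x \<oplus>\<^bsub>M\<^esub> a \<odot>\<^bsub>M\<^esub> y"
    and smult_assoc: "\<lbrakk>a \<in> carrier R; b \<in> carrier R; x \<in> carrier M\<rbrakk> \<Longrightarrow>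
      (a \<otimes>\<^bsub>R\<^esub> b) \<odot>\<^bsub>M\<^esub> x = a \<odot>\<^bsub>M\<^esub> (b \<odot>\<^bsub>M\<^esub> x)"
    and smult_one: "x \<in> carrier M \<Longrightarrow> \<one>\<^bsub>R\<^esub> \<odot>\<^bsub>M\<^esub> x = x"

definition scalar :: "(complex, 'a) module \<Rightarrow> ('a, 'b) module \<Rightarrow> complex \<Rightarrow> 'b \<Rightarrow> 'b" where
  "scalar A M c x = (c \<odot>\<^bsub>A\<^esub> \<one>\<^bsub>A\<^esub>) \<odot>\<^bsub>M\<^esub> x"

definition fd_module :: "(complex, 'a) module \<Rightarrow> ('a, 'b) module \<Rightarrow> bool" where
  "fd_module A M \<longleftrightarrow> left_module A M \<and>
     (\<exists>S. finite S \<and> S \<subseteq> carrier M \<and>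
        (\<forall>x\<in>carrier M. \<exists>c. x = (\<Oplus>\<^bsub>M\<^esub>s\<in>S. scalar A M (c s) s)))"

definition mod_hom ::
  "(complex, 'a) module \<Rightarrow> ('a, 'b) module \<Rightarrow> ('a, 'c) module \<Rightarrow> ('b \<Rightarrow> 'c) set" where
  "mod_hom A M L = {f \<in> carrier M \<rightarrow>\<^sub>E carrier L.
     (\<forall>x\<in>carrier M. \<forall>y\<in>carrier M. f (x \<oplus>\<^bsub>M\<^esub> y) = f x \<oplus>\<^bsub>L\<^esub> f y) \<and>
     (\<forall>a\<in>carrier A. \<forall>x\<in>carrier M. f (a \<odot>\<^bsub>M\<^esub> x) = a \<odot>\<^bsub>L\<^esub> f x)}"

definition direct_sum :: "'i set \<Rightarrow> ('i \<Rightarrow> ('a, 'b) module) \<Rightarrow> ('a, 'i \<Rightarrow> 'b) module" where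
  "direct_sum I M = \<lparr>carrier = (\<Pi>\<^sub>E i\<in>I. carrier (M i)), mult = undefined, one = undefined,
     zero = (\<lambda>i\<in>I. \<zero>\<^bsub>M i\<^esub>), add = (\<lambda>x y. \<lambda>i\<in>I. x i \<oplus>\<^bsub>M i\<^esub> y i),
     smult = (\<lambda>a x. \<lambda>i\<in>I. a \<odot>\<^bsub>M i\<^esub> x i)\<rparr>"

text \<open>The idempotent endomorphism of a direct sum projecting onto the summand \<open>j\<close>.\<close>

definition summand_proj ::
  "'i set \<Rightarrow> ('i \<Rightarrow> ('a, 'b) module) \<Rightarrow> 'i \<Rightarrow> ('i \<Rightarrow> 'b) \<Rightarrow> ('i \<Rightarrow> 'b)" where
  "summand_proj I M j =
     (\<lambda>x\<in>carrier (direct_sum I M). \<lambda>i\<in>I. if i = j then x i else \<zero>\<^bsub>M i\<^esub>)"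

text \<open>
  Projective objects of the category of finite-dimensional modules.  The lifting property is
  tested on modules with elements in the type \<open>nat \<Rightarrow> complex\<close> (with arbitrary operations); every
  finite-dimensional module is isomorphic to one of these.
\<close>

definition fd_projective :: "(complex, 'a) module \<Rightarrow> ('a, 'b) module \<Rightarrow> bool" where
  "fd_projective A P \<longleftrightarrow> fd_module A P \<and>
     (\<forall>(X :: ('a, nat \<Rightarrow> complex) module) (Y :: ('a, nat \<Rightarrow> complex) module) g f.
        fd_module A X \<and> fd_module A Y \<and> g \<in> mod_hom A X Y \<and> g ` carrier X = carrier Y \<and>
        f \<in> mod_hom A P Y \<longrightarrow>
        (\<exists>h\<in>mod_hom A P X. \<forall>x\<in>carrier P. g (h x) = f x))"

text \<open>\<open>\<dots> \<rightarrow> P 2 \<rightarrow> P 1 \<rightarrow> P 0 \<rightarrow> M \<rightarrow> 0\<close> with differentials \<open>d n : P (n + 1) \<rightarrow> P n\<close>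
  and augmentation \<open>\<epsilon>\<close>.\<close>

definition projective_resolution ::
  "(complex, 'a) module \<Rightarrow> ('a, 'm) module \<Rightarrow>
   (nat \<Rightarrow> ('a, 'b) module) \<Rightarrow> (nat \<Rightarrow> 'b \<Rightarrow> 'b) \<Rightarrow> ('b \<Rightarrow> 'm) \<Rightarrow> bool" where
  "projective_resolution A M P d \<epsilon> \<longleftrightarrow>
     (\<forall>n. fd_projective A (P n)) \<and>
     (\<forall>n. d n \<in> mod_hom A (P (Suc n)) (P n)) \<and>
     \<epsilon> \<in> mod_hom A (P 0) M \<and>
     \<epsilon> ` carrier (P 0) = carrier M \<and>
     a_kernel (P 0) M \<epsilon> = d 0 ` carrier (P (Suc 0)) \<and>
     (\<forall>n. a_kernel (P (Suc n)) (P n) (d n) = d (Suc n) ` carrier (P (Suc (Suc n))))"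


section \<open>Quotients\<close>

text \<open>The quotient ring \<open>V Quot I\<close>, with the induced scalar multiplication.  It serves for
  quotients of algebras by ideals and, ignoring the multiplicative fields, for quotients of vector
  spaces by subspaces.\<close>

definition quot :: "(complex, 'v) module \<Rightarrow> 'v set \<Rightarrow> (complex, 'v set) module" where
  "quot V I = \<lparr>carrier = carrier (V Quot I), mult = mult (V Quot I), one = one (V Quot I),
     zero = zero (V Quot I), add = add (V Quot I),
     smult = (\<lambda>c X. \<Union>x\<in>X. I +>\<^bsub>V\<^esub> (c \<odot>\<^bsub>V\<^esub> x))\<rparr>"

definition algebra_iso ::
  "(complex, 'a) module \<Rightarrow> (complex, 'b) module \<Rightarrow> ('a \<Rightarrow> 'b) set" where
  "algebra_iso A B =
     {h \<in> ring_iso A B. \<forall>c. \<forall>x\<in>carrier A. h (c \<odot>\<^bsub>A\<^esub> x) = c \<odot>\<^bsub>B\<^esub> h x}"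


section \<open>Ext groups and the Yoneda product\<close>

definition cocycles ::
  "(complex, 'a) module \<Rightarrow> (nat \<Rightarrow> ('a, 'b) module) \<Rightarrow> (nat \<Rightarrow> 'b \<Rightarrow> 'b) \<Rightarrow> ('a, 'l) module \<Rightarrow>
   nat \<Rightarrow> (complex, 'b \<Rightarrow> 'l) module" where
  "cocycles A P d L n =
     \<lparr>carrier = {f \<in> mod_hom A (P n) L. \<forall>x\<in>carrier (P (Suc n)). f (d n x) = \<zero>\<^bsub>L\<^esub>},
      mult = undefined, one = undefined,
      zero = (\<lambda>x\<in>carrier (P n). \<zero>\<^bsub>L\<^esub>),
      add = (\<lambda>f g. \<lambda>x\<in>carrier (P n). f x \<oplus>\<^bsub>L\<^esub> g x),
      smult = (\<lambda>c f. \<lambda>x\<in>carrier (P n). scalar A L c (f x))\<rparr>"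

definition coboundaries ::
  "(complex, 'a) module \<Rightarrow> (nat \<Rightarrow> ('a, 'b) module) \<Rightarrow> (nat \<Rightarrow> 'b \<Rightarrow> 'b) \<Rightarrow> ('a, 'l) module \<Rightarrow>
   nat \<Rightarrow> ('b \<Rightarrow> 'l) set" where
  "coboundaries A P d L n = (case n of
       0 \<Rightarrow> {\<lambda>x\<in>carrier (P 0). \<zero>\<^bsub>L\<^esub>}
     | Suc m \<Rightarrow> (\<lambda>g. compose (carrier (P (Suc m))) g (d m)) ` mod_hom A (P m) L)"

text \<open>For a projective resolution \<open>P\<close> of \<open>M\<close> this is the degree \<open>n\<close> Ext space of \<open>M\<close> and \<open>L\<close>.\<close>

definition ext_space ::
  "(complex, 'a) module \<Rightarrow> (nat \<Rightarrow> ('a, 'b) module) \<Rightarrow> (nat \<Rightarrow> 'b \<Rightarrow> 'b) \<Rightarrow> ('a, 'l) module \<Rightarrow>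
   nat \<Rightarrow> (complex, ('b \<Rightarrow> 'l) set) module" where
  "ext_space A P d L n = quot (cocycles A P d L n) (coboundaries A P d L n)"

definition ext_class ::
  "(complex, 'a) module \<Rightarrow> (nat \<Rightarrow> ('a, 'b) module) \<Rightarrow> (nat \<Rightarrow> 'b \<Rightarrow> 'b) \<Rightarrow> ('a, 'l) module \<Rightarrow>
   nat \<Rightarrow> ('b \<Rightarrow> 'l) \<Rightarrow> ('b \<Rightarrow> 'l) set" where
  "ext_class A P d L n f = coboundaries A P d L n +>\<^bsub>cocycles A P d L n\<^esub> f"

text \<open>Chain maps \<open>P (i + k) \<rightarrow> P k\<close> lifting a cocycle \<open>f : P i \<rightarrow> M\<close>.\<close>

definition chain_lifts ::
  "(complex, 'a) module \<Rightarrow> (nat \<Rightarrow> ('a, 'b) module) \<Rightarrow> (nat \<Rightarrow> 'b \<Rightarrow> 'b) \<Rightarrow> ('b \<Rightarrow> 'm) \<Rightarrow>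
   nat \<Rightarrow> ('b \<Rightarrow> 'm) \<Rightarrow> (nat \<Rightarrow> 'b \<Rightarrow> 'b) set" where
  "chain_lifts A P d \<epsilon> i f = {\<phi>.
     (\<forall>k. \<phi> k \<in> mod_hom A (P (i + k)) (P k)) \<and>
     (\<forall>x\<in>carrier (P i). \<epsilon> (\<phi> 0 x) = f x) \<and>
     (\<forall>k. \<forall>x\<in>carrier (P (Suc (i + k))). d k (\<phi> (Suc k) x) = \<phi> k (d (i + k) x))}"

text \<open>
  The Yoneda product \<open>X \<cdot> Y\<close> of self-extension classes of \<open>M\<close> of degrees \<open>i\<close> and \<open>j\<close>, written from
  left to right: a representative of \<open>X\<close> is lifted to a chain map, which is then followed by a
  representative of \<open>Y\<close>.  The class obtained does not depend on the choices, so that the union over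
  all of them is a single class.
\<close>

definition yoneda ::
  "(complex, 'a) module \<Rightarrow> ('a, 'm) module \<Rightarrow>
   (nat \<Rightarrow> ('a, 'b) module) \<Rightarrow> (nat \<Rightarrow> 'b \<Rightarrow> 'b) \<Rightarrow> ('b \<Rightarrow> 'm) \<Rightarrow>
   nat \<Rightarrow> nat \<Rightarrow> ('b \<Rightarrow> 'm) set \<Rightarrow> ('b \<Rightarrow> 'm) set \<Rightarrow> ('b \<Rightarrow> 'm) set" where
  "yoneda A M P d \<epsilon> i j X Y = (\<Union>f\<in>X. \<Union>g\<in>Y. \<Union>\<phi>\<in>chain_lifts A P d \<epsilon> i f.
     ext_class A P d M (i + j) (compose (carrier (P (i + j))) g (\<phi> j)))"

text \<open>A homomorphism \<open>h : M \<rightarrow> M\<close> as an element of the total Ext algebra, concentrated in degree 0.\<close>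

definition ext_of_hom ::
  "(complex, 'a) module \<Rightarrow> ('a, 'm) module \<Rightarrow>
   (nat \<Rightarrow> ('a, 'b) module) \<Rightarrow> (nat \<Rightarrow> 'b \<Rightarrow> 'b) \<Rightarrow> ('b \<Rightarrow> 'm) \<Rightarrow>
   ('m \<Rightarrow> 'm) \<Rightarrow> nat \<Rightarrow> ('b \<Rightarrow> 'm) set" where
  "ext_of_hom A M P d \<epsilon> h = (\<lambda>n.
     if n = 0 then ext_class A P d M 0 (compose (carrier (P 0)) h \<epsilon>) else \<zero>\<^bsub>ext_space A P d M n\<^esub>)"

text \<open>The algebra of self-extensions of \<open>M\<close>, computed from a projective resolution of \<open>M\<close>: the
  direct sum of the Ext spaces over all degrees.\<close>

definition ext_algebra ::
  "(complex, 'a) module \<Rightarrow> ('a, 'm) module \<Rightarrow>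
   (nat \<Rightarrow> ('a, 'b) module) \<Rightarrow> (nat \<Rightarrow> 'b \<Rightarrow> 'b) \<Rightarrow> ('b \<Rightarrow> 'm) \<Rightarrow>
   (complex, nat \<Rightarrow> ('b \<Rightarrow> 'm) set) module" where
  "ext_algebra A M P d \<epsilon> =
     \<lparr>carrier = {x. (\<forall>n. x n \<in> carrier (ext_space A P d M n)) \<and>
        finite {n. x n \<noteq> \<zero>\<^bsub>ext_space A P d M n\<^esub>}},
      mult = (\<lambda>x y n. \<Oplus>\<^bsub>ext_space A P d M n\<^esub>i\<in>{..n}. yoneda A M P d \<epsilon> i (n - i) (x i) (y (n - i))),
      one = ext_of_hom A M P d \<epsilon> (\<lambda>x\<in>carrier M. x),
      zero = (\<lambda>n. \<zero>\<^bsub>ext_space A P d M n\<^esub>),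
      add = (\<lambda>x y n. x n \<oplus>\<^bsub>ext_space A P d M n\<^esub> y n),
      smult = (\<lambda>c x n. c \<odot>\<^bsub>ext_space A P d M n\<^esub> x n)\<rparr>"


section \<open>Weights and cup diagrams\<close>

text \<open>
  A weight is a labelling of the vertices \<open>0, 1, \<dots>\<close> of a number line by \<open>\<or>\<close> (\<open>Vee\<close>, pointing down)
  and \<open>\<and>\<close> (\<open>Wedge\<close>, pointing up), read from left to right.
\<close>

datatype label = Vee | Wedge

type_synonym weight = "label list"

definition block :: "nat \<Rightarrow> nat \<Rightarrow> weight set" where
  "block m n = {\<kappa>. length \<kappa> = m + n \<and> count_list \<kappa> Vee = m \<and> count_list \<kappa> Wedge = n}"

text \<open>
  The cup diagram of \<open>\<alpha>\<close>: a cup joins the pair \<open>i < j\<close> labelled \<open>\<or>\<and>\<close> as soon as all the vertices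
  strictly between \<open>i\<close> and \<open>j\<close> have been joined (necessarily among themselves).  The remaining
  vertices carry vertical rays.  The mirror image of this diagram is the cap diagram of \<open>\<alpha>\<close>.
\<close>

inductive cup :: "weight \<Rightarrow> nat \<Rightarrow> nat \<Rightarrow> bool" for \<alpha> where
  "\<lbrakk>i < j; j < length \<alpha>; \<alpha> ! i = Vee; \<alpha> ! j = Wedge;
    \<forall>k. i < k \<and> k < j \<longrightarrow> (\<exists>l. i < l \<and> l < j \<and> (cup \<alpha> k l \<or> cup \<alpha> l k))\<rbrakk> \<Longrightarrow> cup \<alpha> i j"

definition ray :: "weight \<Rightarrow> nat \<Rightarrow> bool" where
  "ray \<alpha> i \<longleftrightarrow> i < length \<alpha> \<and> (\<forall>k. \<not> cup \<alpha> i k \<and> \<not> cup \<alpha> k i)"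

text \<open>The weight \<open>\<kappa>\<close> orients the cup diagram of \<open>\<alpha>\<close>, in symbols \<open>\<alpha> \<subset> \<kappa>\<close>.\<close>

definition orients :: "weight \<Rightarrow> weight \<Rightarrow> bool" where
  "orients \<alpha> \<kappa> \<longleftrightarrow> length \<kappa> = length \<alpha> \<and>
     (\<forall>i j. cup \<alpha> i j \<longrightarrow> \<kappa> ! i \<noteq> \<kappa> ! j) \<and>
     \<not> (\<exists>i j. i < j \<and> ray \<alpha> i \<and> ray \<alpha> j \<and> \<kappa> ! i = Vee \<and> \<kappa> ! j = Wedge)"

text \<open>
  An oriented circle diagram (cup diagram of \<open>\<alpha>\<close> below, weight \<open>\<kappa>\<close>, cap diagram of \<open>\<beta>\<close> above) is
  encoded as \<open>(\<alpha>, \<kappa>, \<beta>)\<close>; within a block a weight is determined by its cup diagram.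
\<close>

type_synonym diagram = "weight \<times> weight \<times> weight"

definition diagrams :: "weight set \<Rightarrow> diagram set" where
  "diagrams \<Lambda> = {(\<alpha>, \<kappa>, \<beta>). \<alpha> \<in> \<Lambda> \<and> \<kappa> \<in> \<Lambda> \<and> \<beta> \<in> \<Lambda> \<and> orients \<alpha> \<kappa> \<and> orients \<beta> \<kappa>}"


section \<open>The surgery procedure\<close>

text \<open>
  The product of \<open>(\<alpha>, \<kappa>, \<beta>)\<close> and \<open>(\<beta>, \<mu>, \<delta>)\<close> starts from the first diagram drawn below the second.
  There are two number lines; the vertex \<open>(False, i)\<close> lies on the lower and \<open>(True, i)\<close> on the upper
  one.  \<open>S\<close> is the set of those cups of \<open>\<beta>\<close> on which surgery has not been performed yet: for these
  the middle section contains a cap attached to the lower and a cup attached to the upper line.  At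
  all other positions the two lines are joined by a vertical segment.
\<close>

type_synonym vertex = "bool \<times> nat"

inductive edge :: "weight \<Rightarrow> weight \<Rightarrow> (nat \<times> nat) set \<Rightarrow> vertex \<Rightarrow> vertex \<Rightarrow> bool"
  for \<alpha> \<delta> S where
  "cup \<alpha> i j \<Longrightarrow> edge \<alpha> \<delta> S (False, i) (False, j)"
| "cup \<delta> i j \<Longrightarrow> edge \<alpha> \<delta> S (True, i) (True, j)"
| "(i, j) \<in> S \<Longrightarrow> edge \<alpha> \<delta> S (l, i) (l, j)"
| "\<lbrakk>i < length \<alpha>; \<forall>k. (i, k) \<notin> S \<and> (k, i) \<notin> S\<rbrakk> \<Longrightarrow> edge \<alpha> \<delta> S (False, i) (True, i)"

definition component :: "weight \<Rightarrow> weight \<Rightarrow> (nat \<times> nat) set \<Rightarrow> vertex \<Rightarrow> vertex set" where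
  "component \<alpha> \<delta> S v = {u. equivclp (edge \<alpha> \<delta> S) v u}"

definition ray_ends :: "weight \<Rightarrow> weight \<Rightarrow> vertex set" where
  "ray_ends \<alpha> \<delta> = {(False, i) | i. ray \<alpha> i} \<union> {(True, i) | i. ray \<delta> i}"

text \<open>Labellings of all vertices are pairs of weights, one for each line.\<close>

definition labellings :: "nat \<Rightarrow> (weight \<times> weight) set" where
  "labellings n = {(\<kappa>, \<mu>). length \<kappa> = n \<and> length \<mu> = n}"

definition lab :: "weight \<times> weight \<Rightarrow> vertex \<Rightarrow> label" where
  "lab w v = (if fst v then snd w else fst w) ! snd v"

text \<open>Cups and caps join opposite labels, vertical segments join equal labels.\<close>

definition consistent :: "weight \<Rightarrow> weight \<Rightarrow> (nat \<times> nat) set \<Rightarrow> weight \<times> weight \<Rightarrow> bool" where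
  "consistent \<alpha> \<delta> S w \<longleftrightarrow>
     (\<forall>u v. edge \<alpha> \<delta> S u v \<longrightarrow> (lab w u = lab w v \<longleftrightarrow> fst u \<noteq> fst v))"

datatype kind = Anticlockwise | Clockwise | Line

text \<open>A circle is anticlockwise iff its rightmost vertices are labelled \<open>\<and>\<close>.\<close>

definition kind_of :: "weight \<Rightarrow> weight \<Rightarrow> weight \<times> weight \<Rightarrow> vertex set \<Rightarrow> kind" where
  "kind_of \<alpha> \<delta> w C =
     (if C \<inter> ray_ends \<alpha> \<delta> \<noteq> {} then Line
      else if \<exists>v\<in>C. (\<forall>u\<in>C. snd u \<le> snd v) \<and> lab w v = Wedge then Anticlockwise
      else Clockwise)"

text \<open>
  With \<open>1\<close>, \<open>x\<close>, \<open>y\<close> standing for an anticlockwise circle, a clockwise circle and a line, merging is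
  given by \<open>1 \<otimes> 1 \<mapsto> 1\<close>, \<open>1 \<otimes> x \<mapsto> x\<close>, \<open>x \<otimes> 1 \<mapsto> x\<close>, \<open>x \<otimes> x \<mapsto> 0\<close>, \<open>1 \<otimes> y \<mapsto> y\<close>, \<open>y \<otimes> 1 \<mapsto> y\<close>,
  \<open>x \<otimes> y \<mapsto> 0\<close>, \<open>y \<otimes> x \<mapsto> 0\<close>, and splitting by \<open>1 \<mapsto> 1 \<otimes> x + x \<otimes> 1\<close>, \<open>x \<mapsto> x \<otimes> x\<close>, \<open>y \<mapsto> x \<otimes> y\<close>
  (the circle that is split off being \<open>x\<close>).
\<close>

inductive merges :: "kind \<Rightarrow> kind \<Rightarrow> kind \<Rightarrow> bool" where
  "merges Anticlockwise c c"
| "merges c Anticlockwise c"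

inductive splits :: "kind \<Rightarrow> kind \<Rightarrow> kind \<Rightarrow> bool" where
  "splits Anticlockwise Anticlockwise Clockwise"
| "splits Anticlockwise Clockwise Anticlockwise"
| "splits Clockwise Clockwise Clockwise"
| "splits Line Clockwise Line"
| "splits Line Line Clockwise"

definition ends_labelled ::
  "weight \<Rightarrow> weight \<Rightarrow> weight \<times> weight \<Rightarrow> vertex set \<Rightarrow> label \<Rightarrow> bool" where
  "ends_labelled \<alpha> \<delta> w C t \<longleftrightarrow> (\<forall>v \<in> C \<inter> ray_ends \<alpha> \<delta>. lab w v = t)"

text \<open>
  \<open>surgery_term \<alpha> \<delta> S (i, j) w w'\<close>: the labelling \<open>w'\<close> occurs in the result of the surgery at the
  cup \<open>(i, j)\<close> applied to \<open>w\<close>.  Components not touched keep their orientation, lines keep the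
  labels at their ends.  In the last case two lines are reconnected to form two new lines; the rule
  is \<open>y \<otimes> y \<mapsto> y \<otimes> y\<close> if the rays of one of the lines are oriented upwards and those of the other
  line are oriented downwards, and \<open>y \<otimes> y \<mapsto> 0\<close> otherwise.
\<close>

definition surgery_term ::
  "weight \<Rightarrow> weight \<Rightarrow> (nat \<times> nat) set \<Rightarrow> nat \<times> nat \<Rightarrow>
   weight \<times> weight \<Rightarrow> weight \<times> weight \<Rightarrow> bool" where
  "surgery_term \<alpha> \<delta> S p w w' \<longleftrightarrow>
     (let S' = S - {p};
          A = component \<alpha> \<delta> S (False, fst p); B = component \<alpha> \<delta> S (True, fst p);
          A' = component \<alpha> \<delta> S' (False, fst p); B' = component \<alpha> \<delta> S' (False, snd p)
      in consistent \<alpha> \<delta> S' w' \<and>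
         (\<forall>l. \<forall>i < length \<alpha>. (l, i) \<notin> A \<union> B \<or> (l, i) \<in> ray_ends \<alpha> \<delta> \<longrightarrow> lab w' (l, i) = lab w (l, i)) \<and>
         (if A \<noteq> B \<and> A' = B' then merges (kind_of \<alpha> \<delta> w A) (kind_of \<alpha> \<delta> w B) (kind_of \<alpha> \<delta> w' A')
          else if A = B \<and> A' \<noteq> B' then splits (kind_of \<alpha> \<delta> w A) (kind_of \<alpha> \<delta> w' A') (kind_of \<alpha> \<delta> w' B')
          else ends_labelled \<alpha> \<delta> w A Wedge \<and> ends_labelled \<alpha> \<delta> w B Vee \<or>
               ends_labelled \<alpha> \<delta> w A Vee \<and> ends_labelled \<alpha> \<delta> w B Wedge))"

definition surgery ::
  "weight \<Rightarrow> weight \<Rightarrow> (nat \<times> nat) set \<Rightarrow> nat \<times> nat \<Rightarrow>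
   (weight \<times> weight \<Rightarrow> complex) \<Rightarrow> weight \<times> weight \<Rightarrow> complex" where
  "surgery \<alpha> \<delta> S p c w' = (if w' \<in> labellings (length \<alpha>)
     then \<Sum>w \<in> labellings (length \<alpha>). if surgery_term \<alpha> \<delta> S p w w' then c w else 0 else 0)"

fun surgeries ::
  "weight \<Rightarrow> weight \<Rightarrow> (nat \<times> nat) list \<Rightarrow>
   (weight \<times> weight \<Rightarrow> complex) \<Rightarrow> weight \<times> weight \<Rightarrow> complex" where
  "surgeries \<alpha> \<delta> [] c = c"
| "surgeries \<alpha> \<delta> (p # ps) c = surgeries \<alpha> \<delta> ps (surgery \<alpha> \<delta> (set (p # ps)) p c)"

text \<open>The cups are listed by increasing left end points.  Hence surgery reaches a cup only after all
  the cups around it, when it can be connected with its mirror image without crossings.\<close>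

definition cup_list :: "weight \<Rightarrow> (nat \<times> nat) list" where
  "cup_list \<beta> = [(i, j). i \<leftarrow> [0..<length \<beta>], j \<leftarrow> [0..<length \<beta>], cup \<beta> i j]"

definition single :: "'a \<Rightarrow> 'a \<Rightarrow> complex" where
  "single a = (\<lambda>b. if b = a then 1 else 0)"

text \<open>The coefficient of the third diagram in the product of the first two.  After the last surgery
  the two number lines carry the same weight and are identified.\<close>

fun mult_coeff :: "diagram \<Rightarrow> diagram \<Rightarrow> diagram \<Rightarrow> complex" where
  "mult_coeff (\<alpha>, \<kappa>, \<beta>) (\<gamma>, \<mu>, \<delta>) (\<alpha>', \<nu>, \<delta>') =
     (if \<beta> = \<gamma> \<and> \<alpha>' = \<alpha> \<and> \<delta>' = \<delta> then surgeries \<alpha> \<delta> (cup_list \<beta>) (single (\<kappa>, \<mu>)) (\<nu>, \<nu>) else 0)"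


section \<open>Khovanov's diagram algebra and its cell modules\<close>

definition diagram_algebra :: "weight set \<Rightarrow> (complex, diagram \<Rightarrow> complex) module" where
  "diagram_algebra \<Lambda> =
     \<lparr>carrier = {x. \<forall>t. t \<notin> diagrams \<Lambda> \<longrightarrow> x t = 0},
      mult = (\<lambda>x y t. if t \<in> diagrams \<Lambda>
        then \<Sum>r\<in>diagrams \<Lambda>. \<Sum>s\<in>diagrams \<Lambda>. x r * y s * mult_coeff r s t else 0),
      one = (\<lambda>t. if \<exists>\<alpha>\<in>\<Lambda>. t = (\<alpha>, \<alpha>, \<alpha>) then 1 else 0),
      zero = (\<lambda>t. 0),
      add = (\<lambda>x y t. x t + y t),
      smult = (\<lambda>c x t. c * x t)\<rparr>"

definition khovanov_algebra :: "nat \<Rightarrow> nat \<Rightarrow> (complex, diagram \<Rightarrow> complex) module" where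
  "khovanov_algebra m n = diagram_algebra (block m n)"

text \<open>
  The cell module of \<open>\<mu>\<close> has the basis \<open>(\<alpha> \<mu>|\<close>, \<open>\<alpha> \<subset> \<mu>\<close>.  The diagram \<open>(\<alpha>, \<kappa>, \<beta>)\<close> maps \<open>(\<beta> \<mu>|\<close> to a
  multiple of \<open>(\<alpha> \<mu>|\<close> if \<open>\<alpha> \<subset> \<mu>\<close> and to zero otherwise, and it annihilates \<open>(\<gamma> \<mu>|\<close> for
  \<open>\<gamma> \<noteq> \<beta>\<close>.  The multiple is the coefficient of \<open>(\<alpha>, \<mu>, \<delta>)\<close> in the product of \<open>(\<alpha>, \<kappa>, \<beta>)\<close> and
  \<open>(\<beta>, \<mu>, \<delta>)\<close>, which is independent of \<open>\<delta> \<subset> \<mu>\<close>; we take \<open>\<delta> = \<mu>\<close>.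
\<close>

definition cell_module ::
  "weight set \<Rightarrow> weight \<Rightarrow> (diagram \<Rightarrow> complex, weight \<Rightarrow> complex) module" where
  "cell_module \<Lambda> \<mu> =
     \<lparr>carrier = {v. \<forall>\<alpha>. \<not> (\<alpha> \<in> \<Lambda> \<and> orients \<alpha> \<mu>) \<longrightarrow> v \<alpha> = 0},
      mult = undefined, one = undefined,
      zero = (\<lambda>\<alpha>. 0),
      add = (\<lambda>v w \<alpha>. v \<alpha> + w \<alpha>),
      smult = (\<lambda>x v \<alpha>. if \<alpha> \<in> \<Lambda> \<and> orients \<alpha> \<mu>
        then \<Sum>\<kappa>\<in>\<Lambda>. \<Sum>\<beta>\<in>{\<beta>\<in>\<Lambda>. orients \<beta> \<mu>}.
               x (\<alpha>, \<kappa>, \<beta>) * mult_coeff (\<alpha>, \<kappa>, \<beta>) (\<beta>, \<mu>, \<mu>) (\<alpha>, \<mu>, \<mu>) * v \<beta>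
        else 0)\<rparr>"

text \<open>
  \<open>cell_at N j\<close> is the cell module of the weight with \<open>\<and>\<close> at \<open>j\<close> and \<open>\<or>\<close> elsewhere.  It corresponds to
  the parabolic Verma module whose highest weight, shifted by \<open>\<rho> = (N, \<dots>, 1, 0)\<close>, has the
  positions of the labels \<open>\<or>\<close> as its first \<open>N\<close> entries and the position \<open>j\<close> of the label \<open>\<and>\<close> as its
  last entry.
\<close>

definition wedge_at :: "nat \<Rightarrow> nat \<Rightarrow> weight" where
  "wedge_at N j = (replicate (N + 1) Vee)[j := Wedge]"

definition cell_at :: "nat \<Rightarrow> nat \<Rightarrow> (diagram \<Rightarrow> complex, weight \<Rightarrow> complex) module" where
  "cell_at N j = cell_module (block N 1) (wedge_at N j)"

definition cell_sum :: "nat \<Rightarrow> (diagram \<Rightarrow> complex, nat \<Rightarrow> weight \<Rightarrow> complex) module" where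
  "cell_sum N = direct_sum {0..N} (cell_at N)"


section \<open>Path algebras\<close>

text \<open>A path is given by its starting vertex and the list of its arrows, in the order in which they
  are traversed; paths are composed from left to right.\<close>

definition paths :: "('v, 'e) pre_digraph \<Rightarrow> ('v \<times> 'e list) set" where
  "paths Q = {(u, p). \<exists>v. pre_digraph.awalk Q u p v}"

definition path_algebra ::
  "('v, 'e) pre_digraph \<Rightarrow> (complex, 'v \<times> 'e list \<Rightarrow> complex) module" where
  "path_algebra Q =
     \<lparr>carrier = {x. finite {q. x q \<noteq> 0} \<and> (\<forall>q. q \<notin> paths Q \<longrightarrow> x q = 0)},
      mult = (\<lambda>x y (u, p). \<Sum>k\<le>length p.
        x (u, take k p) * y (pre_digraph.awlast Q u (take k p), drop k p)),
      one = (\<lambda>(u, p). if u \<in> verts Q \<and> p = [] then 1 else 0),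
      zero = (\<lambda>q. 0),
      add = (\<lambda>x y q. x q + y q),
      smult = (\<lambda>c x q. c * x q)\<rparr>"

datatype arrow = Id_arrow nat | F_arrow nat

fun arrow_source :: "arrow \<Rightarrow> nat" where
  "arrow_source (Id_arrow j) = j"
| "arrow_source (F_arrow j) = j"

definition ext_quiver :: "nat \<Rightarrow> (nat, arrow) pre_digraph" where
  "ext_quiver N = \<lparr>verts = {0..N}, arcs = Id_arrow ` {1..N} \<union> F_arrow ` {1..N},
     tail = arrow_source, head = (\<lambda>a. arrow_source a - 1)\<rparr>"

definition ext_relations :: "nat \<Rightarrow> (nat \<times> arrow list \<Rightarrow> complex) set" where
  "ext_relations N =
     {single (j, [F_arrow j, F_arrow (j - 1)]) | j. j \<in> {2..N}} \<union>
     {(\<lambda>q. single (j, [F_arrow j, Id_arrow (j - 1)]) q - single (j, [Id_arrow j, F_arrow (j - 1)]) q)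
        | j. j \<in> {2..N}}"

definition ext_ideal :: "nat \<Rightarrow> (nat \<times> arrow list \<Rightarrow> complex) set" where
  "ext_ideal N = Idl\<^bsub>path_algebra (ext_quiver N)\<^esub> (ext_relations N)"

definition quiver_algebra :: "nat \<Rightarrow> (complex, (nat \<times> arrow list \<Rightarrow> complex) set) module" where
  "quiver_algebra N = quot (path_algebra (ext_quiver N)) (ext_ideal N)"

definition vertex_idempotent :: "nat \<Rightarrow> nat \<Rightarrow> (nat \<times> arrow list \<Rightarrow> complex) set" where
  "vertex_idempotent N j = ext_ideal N +>\<^bsub>path_algebra (ext_quiver N)\<^esub> single (j, [])"

end

theory Submission
  imports Defs
begin

text \<open>
  In the block with a single \<open>\<and>\<close> the algebra \<open>A\<close> is a zigzag algebra: it is generated by the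
  idempotents \<open>e\<^sub>j\<close> and by elements \<open>r\<^sub>j = e\<^sub>j\<^sub>+\<^sub>1 r\<^sub>j e\<^sub>j\<close>, \<open>l\<^sub>j = e\<^sub>j l\<^sub>j e\<^sub>j\<^sub>+\<^sub>1\<close> with \<open>l l = 0\<close>,
  \<open>r r = 0\<close>, \<open>l\<^sub>j\<^sub>+\<^sub>1 r\<^sub>j\<^sub>+\<^sub>1 = r\<^sub>j l\<^sub>j\<close> and \<open>l\<^sub>0 r\<^sub>0 = 0\<close>.  Right multiplication by the \<open>l\<^sub>j\<close> gives a
  resolution \<open>0 \<rightarrow> A e\<^sub>0 \<rightarrow> \<dots> \<rightarrow> A e\<^sub>a\<^sub>-\<^sub>1 \<rightarrow> A e\<^sub>a \<rightarrow> M(a) \<rightarrow> 0\<close>.  Since every \<open>l\<^sub>j\<close> acts by zero on the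
  cell modules, a cocycle on an arbitrary resolution is determined up to coboundaries by its values
  on the images of the generators \<open>e\<^sub>a\<^sub>-\<^sub>n\<close> of these resolutions under comparison maps.  This identifies
  the degree \<open>n\<close> extensions of \<open>M(a)\<close> by \<open>M(b)\<close> with \<open>\<complex>\<close> for \<open>a - b = n\<close> and for
  \<open>a - b = n + 1\<close>.  Lifting cocycles along the generators shows that the Yoneda product is the
  product of upper triangular matrices over the dual numbers \<open>\<complex>[F]/(F\<^sup>2)\<close>.  The same algebra arises
  from the quiver by counting paths by their end points and their number of arrows \<open>F\<close>.
\<close>

section \<open>Weights with one wedge and the surgery procedure\<close>

text \<open>The resolution is arbitrary and lives in an arbitrary type, so each \<open>M(a)\<close>
  gets two comparison maps: \<open>p\<close> from its minimal resolution into \<open>P\<close>,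
  given by the images of the generators, and \<open>v\<close> back from \<open>P\<close>. Neither
  composite has to be the identity. On \<open>P\<close>, the sum over \<open>a\<close> of the round
  trips is homotopic to the identity, which makes values on generators a complete invariant. The
  composite in the other order is controlled only up to elements that act by zero on the cell
  modules, and cocycles with values in the cell modules see no more than that. Associativity of the
  surgery product is never computed. The modules of the resolution presuppose that the diagram
  algebra is a ring. The unit law then settles all products with idempotents, and surgery is
  calculated only for the loops \<open>r l\<close> and \<open>l r\<close>. The module axioms of the
  cell sum are likewise transported from \<open>P 0\<close>. The nilpotent \<open>F\<close> comes
  from \<open>r\<close>, which sends the generator of \<open>M(b)\<close> to its only other basis
  vector. Its lift commutes with the differentials without a sign, because the two kinds of loops
  agree.\<close>

lemma length_wedge_at [simp]: "length (wedge_at N j) = Suc N"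
  by (simp add: wedge_at_def del: replicate_Suc)

lemma wedge_at_nth: "i \<le> N \<Longrightarrow> j \<le> N \<Longrightarrow> wedge_at N j ! i = (if i = j then Wedge else Vee)"
  by (auto simp: wedge_at_def nth_list_update simp del: replicate_Suc)

lemma wedge_at_eq_iff [simp]: "i \<le> N \<Longrightarrow> j \<le> N \<Longrightarrow> wedge_at N i = wedge_at N j \<longleftrightarrow> i = j"
  by (metis wedge_at_nth label.distinct(1))

lemma block_eq: "block N (Suc 0) = wedge_at N ` {0..N}"
proof (intro equalityI subsetI)
  fix \<kappa> assume "\<kappa> \<in> block N (Suc 0)"
  then have len: "length \<kappa> = Suc N" and "card {i. i < length \<kappa> \<and> Wedge = \<kappa> ! i} = 1"
    by (auto simp: block_def count_list_eq_length_filter length_filter_conv_card)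
  then obtain j where j: "{i. i < length \<kappa> \<and> Wedge = \<kappa> ! i} = {j}"
    by (auto simp: card_1_singleton_iff)
  have "j \<in> {i. i < length \<kappa> \<and> Wedge = \<kappa> ! i}" by (simp add: j)
  then have jN: "j \<le> N" using len by simp
  have "\<kappa> ! i = wedge_at N j ! i" if "i < Suc N" for i
  proof -
    have "i \<in> {i. i < length \<kappa> \<and> Wedge = \<kappa> ! i} \<longleftrightarrow> i = j"
      by (simp add: j)
    then have "(Wedge = \<kappa> ! i) = (i = j)"
      using that len by simp
    then show ?thesis using that jN by (cases "\<kappa> ! i") (auto simp: wedge_at_nth)
  qed
  then have "\<kappa> = wedge_at N j" by (intro nth_equalityI) (auto simp: len)
  then show "\<kappa> \<in> wedge_at N ` {0..N}" using jN by auto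
next
  fix \<kappa> assume "\<kappa> \<in> wedge_at N ` {0..N}"
  then obtain j where j: "j \<le> N" "\<kappa> = wedge_at N j" by auto
  have "{i. i < Suc N \<and> Wedge = wedge_at N j ! i} = {j}"
    "{i. i < Suc N \<and> Vee = wedge_at N j ! i} = {..<Suc N} - {j}"
    using j by (auto simp: wedge_at_nth less_Suc_eq_le split: if_splits)
  then show "\<kappa> \<in> block N (Suc 0)"
    using j by (auto simp: block_def count_list_eq_length_filter length_filter_conv_card)
qed

text \<open>Every cup ends at a \<open>Wedge\<close>, hence at \<open>j\<close>. If it began before
  \<open>j - 1\<close>, the vertex after its left end would have to lie on a cup strictly inside,
  which could not end at \<open>j\<close>.\<close>

lemma cup_wedge_at:
  assumes "j \<le> N"
  shows "cup (wedge_at N j) a b \<longleftrightarrow> Suc a = j \<and> b = j"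
proof
  have right: "b = j \<and> a < j" if "cup (wedge_at N j) a b" for a b
    using that assms by cases (auto simp: wedge_at_nth less_Suc_eq_le split: if_splits)
  assume c: "cup (wedge_at N j) a b"
  then have ab: "b = j" "a < j" using right by auto
  show "Suc a = j \<and> b = j"
  proof (rule ccontr)
    assume "\<not> ?thesis"
    then have "Suc a < b" using ab by auto
    then obtain l where "l < b" "cup (wedge_at N j) (Suc a) l \<or> cup (wedge_at N j) l (Suc a)"
      using c ab by (metis cup.cases lessI)
    then show False using right ab \<open>Suc a < b\<close> by (metis nat_neq_iff)
  qed
next
  assume "Suc a = j \<and> b = j"
  then show "cup (wedge_at N j) a b"
    using assms by (intro cup.intros) (auto simp: wedge_at_nth)
qed

lemma ray_wedge_at:
  assumes "j \<le> N"
  shows "ray (wedge_at N j) i \<longleftrightarrow> i \<le> N \<and> (j = 0 \<or> (i \<noteq> j \<and> Suc i \<noteq> j))"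
  using assms by (cases j) (auto simp: ray_def cup_wedge_at)

text \<open>The cup of the first weight needs one \<open>Wedge\<close> and one \<open>Vee\<close> at
  its ends, so the wedge sits at \<open>i\<close> or \<open>i - 1\<close>. For \<open>i = 0\<close>
  every vertex is a ray, and the forbidden pattern \<open>Vee\<close> before \<open>Wedge\<close>
  leaves only \<open>k = 0\<close>.\<close>

lemma orients_wedge_at:
  assumes "i \<le> N" "k \<le> N"
  shows "orients (wedge_at N i) (wedge_at N k) \<longleftrightarrow> k = i \<or> Suc k = i"
proof -
  have A: "(\<forall>a b. cup (wedge_at N i) a b \<longrightarrow> wedge_at N k ! a \<noteq> wedge_at N k ! b)
     \<longleftrightarrow> i = 0 \<or> k = i \<or> Suc k = i"
    using assms by (cases i) (auto simp: cup_wedge_at wedge_at_nth)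
  have B: "\<exists>a b. a < b \<and> ray (wedge_at N 0) a \<and> ray (wedge_at N 0) b \<and>
      wedge_at N k ! a = Vee \<and> wedge_at N k ! b = Wedge" if "k > 0"
    using that assms by (intro exI[of _ 0] exI[of _ k]) (auto simp: ray_wedge_at wedge_at_nth)
  have C: "\<not> (\<exists>a b. a < b \<and> ray (wedge_at N i) a \<and> ray (wedge_at N i) b \<and>
      wedge_at N k ! a = Vee \<and> wedge_at N k ! b = Wedge)" if "k = i \<or> Suc k = i"
    using that assms by (auto simp: ray_wedge_at wedge_at_nth split: if_splits)
  show ?thesis
    unfolding orients_def A using B C by (cases i) auto
qed

lemma diagrams_block_iff:
  "(\<alpha>, \<kappa>, \<beta>) \<in> diagrams (block N (Suc 0)) \<longleftrightarrow>
    (\<exists>i k j. i \<le> N \<and> k \<le> N \<and> j \<le> N \<and> (k = i \<or> Suc k = i) \<and> (k = j \<or> Suc k = j) \<and>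
      \<alpha> = wedge_at N i \<and> \<kappa> = wedge_at N k \<and> \<beta> = wedge_at N j)"
proof
  assume "(\<alpha>, \<kappa>, \<beta>) \<in> diagrams (block N (Suc 0))"
  then obtain i k j where "i \<le> N" "k \<le> N" "j \<le> N"
    "\<alpha> = wedge_at N i" "\<kappa> = wedge_at N k" "\<beta> = wedge_at N j" "orients \<alpha> \<kappa>" "orients \<beta> \<kappa>"
    by (auto simp: diagrams_def block_eq)
  then show "\<exists>i k j. i \<le> N \<and> k \<le> N \<and> j \<le> N \<and> (k = i \<or> Suc k = i) \<and> (k = j \<or> Suc k = j) \<and>
      \<alpha> = wedge_at N i \<and> \<kappa> = wedge_at N k \<and> \<beta> = wedge_at N j"
    by (intro exI[of _ i] exI[of _ k] exI[of _ j]) (simp add: orients_wedge_at)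
qed (auto simp: diagrams_def block_eq orients_wedge_at)

lemma wedge_at_diagram_iff:
  "i \<le> N \<Longrightarrow> k \<le> N \<Longrightarrow> j \<le> N \<Longrightarrow>
    (wedge_at N i, wedge_at N k, wedge_at N j) \<in> diagrams (block N (Suc 0)) \<longleftrightarrow>
      (k = i \<or> Suc k = i) \<and> (k = j \<or> Suc k = j)"
  by (auto simp: diagrams_def block_eq orients_wedge_at)

lemma finite_block: "finite (block N (Suc 0))"
  by (simp add: block_eq)

lemma finite_diagrams: "finite \<Lambda> \<Longrightarrow> finite (diagrams \<Lambda>)"
  by (rule finite_subset[of _ "\<Lambda> \<times> \<Lambda> \<times> \<Lambda>"]) (auto simp: diagrams_def)

lemma finite_labellings: "finite (labellings n)"
proof -
  have "(UNIV :: label set) = {Vee, Wedge}" by (auto intro: label.exhaust)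
  then have "finite (UNIV :: label set)" by (metis finite.simps)
  then have "finite {\<kappa> :: label list. length \<kappa> = n}"
    using finite_lists_length_eq[of "UNIV :: label set" n] by simp
  then show ?thesis
    by (rule_tac finite_subset[of _ "{\<kappa>. length \<kappa> = n} \<times> {\<kappa>. length \<kappa> = n}"])
      (auto simp: labellings_def)
qed

lemma concat_map_upt_single:
  "concat (map (\<lambda>i. if i = a then f i else []) [0..<n]) = (if a < n then f a else [])"
  by (induction n) auto

lemma cup_list_wedge_at:
  assumes "j \<le> N"
  shows "cup_list (wedge_at N j) = (if j = 0 then [] else [(j - 1, j)])"
proof -
  have 1: "concat (map (\<lambda>b. if Suc a = j \<and> b = j then [(a, b)] else []) [0..<Suc N]) =
      (if Suc a = j then [(a, j)] else [])" for a
    using assms concat_map_upt_single[of j "\<lambda>b. [(a, b)]" "Suc N"]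
    by (cases "Suc a = j") (auto simp del: upt_Suc)
  have "cup_list (wedge_at N j) =
      concat (map (\<lambda>a. if Suc a = j then [(a, j)] else []) [0..<Suc N])"
    by (simp only: cup_list_def cup_wedge_at[OF assms] length_wedge_at 1)
  also have "\<dots> = (if j = 0 then [] else [(j - 1, j)])"
  proof (cases j)
    case (Suc j')
    then show ?thesis
      using assms concat_map_upt_single[of j' "\<lambda>a. [(a, j)]" "Suc N"] by (simp del: upt_Suc)
  qed (simp del: upt_Suc)
  finally show ?thesis .
qed

text \<open>The middle diagram has one cup, so the product is one surgery applied to one labelling,
  and the sum in \<open>surgery\<close> collapses to a single term.\<close>

lemma mult_coeff_wedge_at:
  assumes "j < N" "length \<alpha> = Suc N" "length \<kappa> = Suc N" "length \<mu> = Suc N" "length \<nu> = Suc N"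
  shows "mult_coeff (\<alpha>, \<kappa>, wedge_at N (Suc j)) (wedge_at N (Suc j), \<mu>, \<delta>) (\<alpha>, \<nu>, \<delta>) =
    (if surgery_term \<alpha> \<delta> {(j, Suc j)} (j, Suc j) (\<kappa>, \<mu>) (\<nu>, \<nu>) then 1 else 0)"
proof -
  have "(\<Sum>w \<in> labellings (length \<alpha>). if surgery_term \<alpha> \<delta> {(j, Suc j)} (j, Suc j) w (\<nu>, \<nu>)
      then single (\<kappa>, \<mu>) w else 0) = (\<Sum>w \<in> labellings (length \<alpha>). if w = (\<kappa>, \<mu>) then
      (if surgery_term \<alpha> \<delta> {(j, Suc j)} (j, Suc j) (\<kappa>, \<mu>) (\<nu>, \<nu>) then 1 else 0) else 0)"
    by (intro sum.cong) (auto simp: single_def)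
  also have "\<dots> = (if surgery_term \<alpha> \<delta> {(j, Suc j)} (j, Suc j) (\<kappa>, \<mu>) (\<nu>, \<nu>) then 1 else 0)"
    using assms by (subst sum.delta[OF finite_labellings]) (simp add: labellings_def)
  finally show ?thesis
    using assms by (simp add: cup_list_wedge_at surgery_def labellings_def)
qed

lemma mult_coeff_wedge_at_0:
  "mult_coeff (\<alpha>, \<kappa>, wedge_at N 0) (wedge_at N 0, \<mu>, \<delta>) (\<alpha>, \<nu>, \<delta>) =
    (if \<kappa> = \<nu> \<and> \<mu> = \<nu> then 1 else 0)"
  by (auto simp: cup_list_wedge_at single_def)

section \<open>Components and orientations before and after a surgery\<close>

lemma component_refl: "v \<in> component \<alpha> \<delta> S v"
  by (simp add: component_def)

lemma component_step:
  "u \<in> component \<alpha> \<delta> S v \<Longrightarrow> edge \<alpha> \<delta> S u u' \<or> edge \<alpha> \<delta> S u' u \<Longrightarrow> u' \<in> component \<alpha> \<delta> S v"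
  unfolding component_def
  by (metis equivclp_into_equivclp mem_Collect_eq sup2CI conversepI symclpI1 symclpI2)

lemma component_eqI: "u \<in> component \<alpha> \<delta> S v \<Longrightarrow> component \<alpha> \<delta> S u = component \<alpha> \<delta> S v"
  unfolding component_def by (auto intro: equivclp_sym equivclp_trans)

text \<open>A set respected by all edges is a union of components. Upper bounds for components come
  from this, lower bounds from explicit walks with \<open>component_step\<close>.\<close>

lemma component_subset:
  assumes "v \<in> C" and "\<And>x y. edge \<alpha> \<delta> S x y \<Longrightarrow> x \<in> C \<longleftrightarrow> y \<in> C"
  shows "component \<alpha> \<delta> S v \<subseteq> C"
proof
  fix u assume "u \<in> component \<alpha> \<delta> S v"
  then have "equivclp (edge \<alpha> \<delta> S) v u" by (simp add: component_def)
  then show "u \<in> C"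
    by (induction rule: equivclp_induct) (use assms in auto)
qed

lemma edge_no_surgery_cups:
  assumes "m \<le> N"
  shows "edge (wedge_at N m) (wedge_at N m) {} u v \<longleftrightarrow>
    fst u = fst v \<and> Suc (snd u) = m \<and> snd v = m \<or>
    \<not> fst u \<and> fst v \<and> snd u = snd v \<and> snd u \<le> N"
  by (cases u; cases v) (auto simp: edge.simps cup_wedge_at[OF assms])

lemma edge_surgery_cup:
  assumes "m \<le> N"
  shows "edge (wedge_at N m) (wedge_at N m) {(j, Suc j)} u v \<longleftrightarrow>
    fst u = fst v \<and> Suc (snd u) = m \<and> snd v = m \<or>
    fst u = fst v \<and> snd u = j \<and> snd v = Suc j \<or>
    \<not> fst u \<and> fst v \<and> snd u = snd v \<and> snd u \<le> N \<and> snd u \<noteq> j \<and> snd u \<noteq> Suc j"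
  by (cases u; cases v) (auto simp: edge.simps cup_wedge_at[OF assms])

lemma component_ray:
  assumes "m \<le> N" "i \<le> N" "i \<noteq> m \<or> m = 0" "Suc i \<noteq> m"
  shows "component (wedge_at N m) (wedge_at N m) {} (l, i) = {u. snd u = i}"
proof (rule equalityI)
  show "component (wedge_at N m) (wedge_at N m) {} (l, i) \<subseteq> {u. snd u = i}"
    using assms by (intro component_subset) (auto simp: edge_no_surgery_cups)
  have "(l', i) \<in> component (wedge_at N m) (wedge_at N m) {} (l, i)" for l'
  proof (cases "l' = l")
    case False
    then have "edge (wedge_at N m) (wedge_at N m) {} (l, i) (l', i) \<or>
        edge (wedge_at N m) (wedge_at N m) {} (l', i) (l, i)"
      using assms by (auto simp: edge_no_surgery_cups)
    then show ?thesis by (rule component_step[OF component_refl])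
  qed (simp add: component_refl)
  then show "{u. snd u = i} \<subseteq> component (wedge_at N m) (wedge_at N m) {} (l, i)"
    by auto
qed

lemma component_circle:
  assumes "Suc m \<le> N" "i = m \<or> i = Suc m"
  shows "component (wedge_at N (Suc m)) (wedge_at N (Suc m)) {} (l, i) =
    {u. snd u = m \<or> snd u = Suc m}" (is "?C (l, i) = ?R")
proof (rule equalityI)
  let ?e = "edge (wedge_at N (Suc m)) (wedge_at N (Suc m)) {}"
  show "?C (l, i) \<subseteq> ?R"
    using assms by (intro component_subset) (auto simp: edge_no_surgery_cups)
  have vert: "(l', k) \<in> ?C v" if "(l'', k) \<in> ?C v" "k \<le> N" for l' l'' k v
  proof (cases "l' = l''")
    case False
    then have "?e (l'', k) (l', k) \<or> ?e (l', k) (l'', k)"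
      using assms that by (auto simp: edge_no_surgery_cups)
    then show ?thesis by (rule component_step[OF that(1)])
  qed (use that in simp)
  have "(l, m) \<in> ?C (l, i) \<and> (l, Suc m) \<in> ?C (l, i)"
    using assms component_refl[of "(l, i)"] component_step[OF component_refl, of _ _ _ "(l, i)"]
    by (auto simp: edge_no_surgery_cups)
  then show "?R \<subseteq> ?C (l, i)" using vert assms(1) by fastforce
qed

lemma splits_Line_iff [simp]:
  "splits Line Line k \<longleftrightarrow> k = Clockwise"
  "splits Line k Line \<longleftrightarrow> k = Clockwise"
  by (cases k; auto intro: splits.intros elim: splits.cases)+

lemma kind_of_line: "v \<in> C \<Longrightarrow> v \<in> ray_ends \<alpha> \<delta> \<Longrightarrow> kind_of \<alpha> \<delta> w C = Line"
  by (auto simp: kind_of_def)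

text \<open>Both number lines carry the same weight, so every rightmost vertex of the circle has the
  label at \<open>m + 1\<close>.\<close>

lemma kind_of_circle:
  assumes "Suc m \<le> N"
  shows "kind_of (wedge_at N (Suc m)) (wedge_at N (Suc m)) (\<nu>, \<nu>) {u. snd u = m \<or> snd u = Suc m} =
    (if \<nu> ! Suc m = Wedge then Anticlockwise else Clockwise)"
proof -
  have "{u. snd u = m \<or> snd u = Suc m} \<inter> ray_ends (wedge_at N (Suc m)) (wedge_at N (Suc m)) = {}"
    using assms by (auto simp: ray_ends_def ray_wedge_at)
  moreover have "(\<exists>v\<in>{u. snd u = m \<or> snd u = Suc m}. (\<forall>u\<in>{u :: vertex. snd u = m \<or> snd u = Suc m}.
      snd u \<le> snd v) \<and> lab (\<nu>, \<nu>) v = Wedge) \<longleftrightarrow> \<nu> ! Suc m = Wedge"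
    by (auto simp: lab_def)
  ultimately show ?thesis by (simp only: kind_of_def) simp
qed

lemma consistent_wedge_at:
  assumes "m \<le> N" "k \<le> N" "orients (wedge_at N m) (wedge_at N k)"
  shows "consistent (wedge_at N m) (wedge_at N m) {} (wedge_at N k, wedge_at N k)"
proof -
  have "k = m \<or> Suc k = m" using assms by (simp add: orients_wedge_at)
  then show ?thesis
    unfolding consistent_def edge_no_surgery_cups[OF assms(1)] lab_def
    using assms(1,2) by (auto simp: wedge_at_nth)
qed

text \<open>The surgery cup \<open>(j, j + 1)\<close> overlaps the cup \<open>(j + 1, j + 2)\<close> on both outer diagrams.\<close>

lemma surgery_term_right:
  assumes "Suc (Suc j) \<le> N" "k = Suc j \<or> k = Suc (Suc j)"
  shows "surgery_term (wedge_at N (Suc (Suc j))) (wedge_at N (Suc (Suc j))) {(j, Suc j)} (j, Suc j)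
    (wedge_at N (Suc j), wedge_at N (Suc j)) (wedge_at N k, wedge_at N k) \<longleftrightarrow> k = Suc j"
proof -
  let ?a = "wedge_at N (Suc (Suc j))"
  let ?S = "{(j, Suc j)}"
  let ?A = "component ?a ?a ?S (False, j)"
  \<comment> \<open>The walk follows the lower cap, the outer cup, a vertical segment, the outer cap
    and the upper cup: before the surgery all these vertices lie on a single line.\<close>
  have "(False, Suc j) \<in> ?A"
    by (rule component_step[OF component_refl]) (use assms in \<open>auto simp: edge_surgery_cup\<close>)
  then have "(False, Suc (Suc j)) \<in> ?A"
    by (rule component_step) (use assms in \<open>auto simp: edge_surgery_cup\<close>)
  then have "(True, Suc (Suc j)) \<in> ?A"
    by (rule component_step) (use assms in \<open>auto simp: edge_surgery_cup\<close>)
  then have "(True, Suc j) \<in> ?A"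
    by (rule component_step) (use assms in \<open>auto simp: edge_surgery_cup\<close>)
  then have "(True, j) \<in> ?A"
    by (rule component_step) (use assms in \<open>auto simp: edge_surgery_cup\<close>)
  then have AB: "component ?a ?a ?S (True, j) = ?A" by (rule component_eqI)
  have ray: "(False, j) \<in> ray_ends ?a ?a"
    using assms by (auto simp: ray_ends_def ray_wedge_at)
  have A': "component ?a ?a {} (False, j) = {u. snd u = j}"
    using assms by (intro component_ray) auto
  have B': "component ?a ?a {} (False, Suc j) = {u. snd u = Suc j \<or> snd u = Suc (Suc j)}"
    using assms by (intro component_circle) auto
  have kA: "kind_of ?a ?a w ?A = Line" for w by (rule kind_of_line[OF component_refl ray])
  have kA': "kind_of ?a ?a w {u. snd u = j} = Line" for w by (rule kind_of_line[OF _ ray]) simp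
  have ne: "{u :: vertex. snd u = j} \<noteq> {u. snd u = Suc j \<or> snd u = Suc (Suc j)}"
    by (rule notI, drule arg_cong[where f = "\<lambda>C. (False, Suc j) \<in> C"]) simp
  have con: "consistent ?a ?a {} (wedge_at N k, wedge_at N k)"
    using assms by (intro consistent_wedge_at) (auto simp: orients_wedge_at)
  \<comment> \<open>The circle split off from a line has to be clockwise, which means
    \<open>Vee\<close> at its right end \<open>j + 2\<close>. Hence the wedge stays at
    \<open>j + 1\<close>.\<close>
  have kB': "kind_of ?a ?a (wedge_at N k, wedge_at N k) {u. snd u = Suc j \<or> snd u = Suc (Suc j)} =
      (if k = Suc j then Clockwise else Anticlockwise)"
    using assms by (subst kind_of_circle) (auto simp: wedge_at_nth)
  show ?thesis
    unfolding surgery_term_def Let_def fst_conv snd_conv Diff_cancel AB A' B' kA kA' kB'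
    using con ne assms(2) by (cases "k = Suc j") simp_all
qed

text \<open>Here the outer cup \<open>(j, j + 1)\<close> lies to the left of the surgery cup, and
  the line ends in the rays at \<open>j + 2\<close>. The circle split off lies on \<open>j\<close>
  and \<open>j + 1\<close>; being clockwise, it moves the wedge to \<open>j\<close>.\<close>

lemma surgery_term_left:
  assumes "Suc (Suc j) \<le> N" "k = j \<or> k = Suc j"
  shows "surgery_term (wedge_at N (Suc j)) (wedge_at N (Suc j)) {(Suc j, Suc (Suc j))}
    (Suc j, Suc (Suc j)) (wedge_at N (Suc j), wedge_at N (Suc j)) (wedge_at N k, wedge_at N k) \<longleftrightarrow> k = j"
proof -
  let ?a = "wedge_at N (Suc j)"
  let ?S = "{(Suc j, Suc (Suc j))}"
  let ?A = "component ?a ?a ?S (False, Suc j)"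
  have 1: "(False, Suc (Suc j)) \<in> ?A"
    by (rule component_step[OF component_refl]) (use assms in \<open>auto simp: edge_surgery_cup\<close>)
  have 2: "(False, j) \<in> ?A"
    by (rule component_step[OF component_refl]) (use assms in \<open>auto simp: edge_surgery_cup\<close>)
  then have 3: "(True, j) \<in> ?A"
    by (rule component_step) (use assms in \<open>auto simp: edge_surgery_cup\<close>)
  then have 4: "(True, Suc j) \<in> ?A"
    by (rule component_step) (use assms in \<open>auto simp: edge_surgery_cup\<close>)
  then have AB: "component ?a ?a ?S (True, Suc j) = ?A" by (rule component_eqI)
  have ray: "(False, Suc (Suc j)) \<in> ray_ends ?a ?a"
    using assms by (auto simp: ray_ends_def ray_wedge_at)
  have A': "component ?a ?a {} (False, Suc j) = {u. snd u = j \<or> snd u = Suc j}"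
    using assms by (intro component_circle) auto
  have B': "component ?a ?a {} (False, Suc (Suc j)) = {u. snd u = Suc (Suc j)}"
    using assms by (intro component_ray) auto
  have kA: "kind_of ?a ?a w ?A = Line" for w by (rule kind_of_line[OF 1 ray])
  have kB': "kind_of ?a ?a w {u. snd u = Suc (Suc j)} = Line" for w
    by (rule kind_of_line[OF _ ray]) simp
  have ne: "{u :: vertex. snd u = j \<or> snd u = Suc j} \<noteq> {u. snd u = Suc (Suc j)}"
    by (rule notI, drule arg_cong[where f = "\<lambda>C. (False, Suc j) \<in> C"]) simp
  have con: "consistent ?a ?a {} (wedge_at N k, wedge_at N k)"
    using assms by (intro consistent_wedge_at) (auto simp: orients_wedge_at)
  have kA': "kind_of ?a ?a (wedge_at N k, wedge_at N k) {u. snd u = j \<or> snd u = Suc j} =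
      (if k = j then Clockwise else Anticlockwise)"
    using assms by (subst kind_of_circle) (auto simp: wedge_at_nth)
  \<comment> \<open>The weight changes here. It changes only at \<open>j\<close> and
    \<open>j + 1\<close>, which lie on the line being cut and are not ray ends.\<close>
  have lab: "lab (wedge_at N j, wedge_at N j) (l, i) = lab (?a, ?a) (l, i)"
    if "i < length ?a" "(l, i) \<notin> ?A \<union> ?A \<or> (l, i) \<in> ray_ends ?a ?a" for l i
  proof -
    have "(l, j) \<in> ?A" "(l, Suc j) \<in> ?A"
      using 2 3 4 component_refl[of "(False, Suc j)" ?a ?a ?S] by (cases l; simp)+
    then have "i \<noteq> j" "i \<noteq> Suc j"
      using that assms by (auto simp: ray_ends_def ray_wedge_at)
    then show ?thesis using that assms by (auto simp: lab_def wedge_at_nth)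
  qed
  show ?thesis
    unfolding surgery_term_def Let_def fst_conv snd_conv Diff_cancel AB A' B' kA kA' kB'
    using con ne assms(2) lab by (cases "k = j") simp_all
qed

text \<open>The outer diagrams have no cups, so two lines meet, one on each number line. The lower
  one joins its ends at \<open>0\<close> and \<open>1\<close> by a cap, so these carry different
  labels and the rule for reconnecting two lines gives zero. This is the source of
  \<open>l 0 \<otimes> r 0 = \<zero>\<close>.\<close>

lemma surgery_term_0:
  assumes "1 \<le> N"
  shows "\<not> surgery_term (wedge_at N 0) (wedge_at N 0) {(0, Suc 0)} (0, Suc 0)
    (wedge_at N 0, wedge_at N 0) (wedge_at N 0, wedge_at N 0)"
proof -
  let ?a = "wedge_at N 0"
  let ?A = "component ?a ?a {(0, Suc 0)} (False, 0)"
  let ?B = "component ?a ?a {(0, Suc 0)} (True, 0)"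
  have A: "(False, Suc 0) \<in> ?A"
    by (rule component_step[OF component_refl]) (use assms in \<open>auto simp: edge_surgery_cup\<close>)
  have "?A \<subseteq> {u. \<not> fst u \<and> (snd u = 0 \<or> snd u = 1)}"
    using assms by (intro component_subset) (auto simp: edge_surgery_cup)
  then have ne: "?A \<noteq> ?B" using component_refl[of "(True, 0)" ?a ?a "{(0, Suc 0)}"] by auto
  have A': "component ?a ?a {} (False, 0) = {u. snd u = 0}"
    using assms by (intro component_ray) auto
  have B': "component ?a ?a {} (False, Suc 0) = {u. snd u = Suc 0}"
    using assms by (intro component_ray) auto
  have ne': "{u :: vertex. snd u = 0} \<noteq> {u. snd u = Suc 0}"
    by (rule notI, drule arg_cong[where f = "\<lambda>C. (False, 0) \<in> C"]) simp
  have "(False, 0) \<in> ?A \<inter> ray_ends ?a ?a" "(False, Suc 0) \<in> ?A \<inter> ray_ends ?a ?a"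
    using A assms component_refl by (auto simp: ray_ends_def ray_wedge_at)
  moreover have "lab (?a, ?a) (False, 0) = Wedge" "lab (?a, ?a) (False, Suc 0) = Vee"
    using assms by (auto simp: lab_def wedge_at_nth)
  ultimately have "\<not> ends_labelled ?a ?a (?a, ?a) ?A t" for t
    unfolding ends_labelled_def by (metis label.distinct(1))
  then show ?thesis
    unfolding surgery_term_def Let_def fst_conv snd_conv Diff_cancel A' B'
    using ne ne' by simp
qed

section \<open>The diagram algebra and its cell modules\<close>

lemma single_apply: "single a b = (if b = a then 1 else 0)"
  by (simp add: single_def)

lemma single_same [simp]: "single a a = 1"
  by (simp add: single_def)

lemma carrier_diagram_algebra:
  "x \<in> carrier (diagram_algebra \<Lambda>) \<longleftrightarrow> (\<forall>t. t \<notin> diagrams \<Lambda> \<longrightarrow> x t = 0)"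
  by (simp add: diagram_algebra_def)

lemma zero_diagram_algebra: "\<zero>\<^bsub>diagram_algebra \<Lambda>\<^esub> = (\<lambda>t. 0)"
  by (simp add: diagram_algebra_def)

lemma add_diagram_algebra: "x \<oplus>\<^bsub>diagram_algebra \<Lambda>\<^esub> y = (\<lambda>t. x t + y t)"
  by (simp add: diagram_algebra_def)

lemma smult_diagram_algebra: "c \<odot>\<^bsub>diagram_algebra \<Lambda>\<^esub> x = (\<lambda>t. c * x t)"
  by (simp add: diagram_algebra_def)

lemma mult_diagram_algebra:
  "x \<otimes>\<^bsub>diagram_algebra \<Lambda>\<^esub> y = (\<lambda>t. if t \<in> diagrams \<Lambda>
    then \<Sum>r\<in>diagrams \<Lambda>. \<Sum>s\<in>diagrams \<Lambda>. x r * y s * mult_coeff r s t else 0)"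
  by (simp add: diagram_algebra_def)

lemma one_diagram_algebra:
  "\<one>\<^bsub>diagram_algebra \<Lambda>\<^esub> = (\<lambda>t. if \<exists>\<alpha>\<in>\<Lambda>. t = (\<alpha>, \<alpha>, \<alpha>) then 1 else 0)"
  by (simp add: diagram_algebra_def)

lemma diagram_algebra_smult_mult:
  "(c \<odot>\<^bsub>diagram_algebra \<Lambda>\<^esub> x) \<otimes>\<^bsub>diagram_algebra \<Lambda>\<^esub> y = c \<odot>\<^bsub>diagram_algebra \<Lambda>\<^esub> (x \<otimes>\<^bsub>diagram_algebra \<Lambda>\<^esub> y)"
  by (auto simp: mult_diagram_algebra smult_diagram_algebra sum_distrib_left mult_ac)

lemma diagram_algebra_mult_smult:
  "x \<otimes>\<^bsub>diagram_algebra \<Lambda>\<^esub> (c \<odot>\<^bsub>diagram_algebra \<Lambda>\<^esub> y) = c \<odot>\<^bsub>diagram_algebra \<Lambda>\<^esub> (x \<otimes>\<^bsub>diagram_algebra \<Lambda>\<^esub> y)"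
  by (auto simp: mult_diagram_algebra smult_diagram_algebra sum_distrib_left mult_ac)

lemma single_in_diagram_algebra:
  "t \<in> diagrams \<Lambda> \<Longrightarrow> single t \<in> carrier (diagram_algebra \<Lambda>)"
  by (auto simp: carrier_diagram_algebra single_def)

lemma sum_single_left:
  "finite S \<Longrightarrow> (\<Sum>r\<in>S. single a r * f r) = (if a \<in> S then f a else 0)"
proof -
  assume "finite S"
  have "(\<Sum>r\<in>S. single a r * f r) = (\<Sum>r\<in>S. if r = a then f r else 0)"
    by (intro sum.cong) (auto simp: single_def)
  then show ?thesis using \<open>finite S\<close> by simp
qed

lemma mult_single_single:
  assumes "finite \<Lambda>" "r \<in> diagrams \<Lambda>" "s \<in> diagrams \<Lambda>"
  shows "single r \<otimes>\<^bsub>diagram_algebra \<Lambda>\<^esub> single s =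
    (\<lambda>t. if t \<in> diagrams \<Lambda> then mult_coeff r s t else 0)"
  using assms
  by (simp add: mult_diagram_algebra finite_diagrams sum_single_left mult.assoc
      flip: sum_distrib_left cong: if_cong)

lemma mult_single_right:
  assumes "finite \<Lambda>" "s \<in> diagrams \<Lambda>"
  shows "x \<otimes>\<^bsub>diagram_algebra \<Lambda>\<^esub> single s =
    (\<lambda>t. if t \<in> diagrams \<Lambda> then \<Sum>r\<in>diagrams \<Lambda>. x r * mult_coeff r s t else 0)"
  using assms
  by (simp add: mult_diagram_algebra finite_diagrams sum_single_left mult.assoc
      flip: sum_distrib_left cong: if_cong)

lemma mult_single_left:
  assumes "finite \<Lambda>" "r \<in> diagrams \<Lambda>"
  shows "single r \<otimes>\<^bsub>diagram_algebra \<Lambda>\<^esub> y =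
    (\<lambda>t. if t \<in> diagrams \<Lambda> then \<Sum>s\<in>diagrams \<Lambda>. y s * mult_coeff r s t else 0)"
  using assms
  by (simp add: mult_diagram_algebra finite_diagrams sum_single_left mult.assoc
      flip: sum_distrib_left cong: if_cong)

lemma orients_refl: "\<alpha> \<in> block N (Suc 0) \<Longrightarrow> orients \<alpha> \<alpha>"
  by (auto simp: block_eq orients_wedge_at)

lemma mult_coeff_mismatch [simp]:
  "\<beta> \<noteq> \<gamma> \<Longrightarrow> mult_coeff (\<alpha>, \<kappa>, \<beta>) (\<gamma>, \<mu>, \<delta>) t = 0"
  "\<alpha> \<noteq> \<alpha>' \<Longrightarrow> mult_coeff (\<alpha>, \<kappa>, \<beta>) (\<gamma>, \<mu>, \<delta>) (\<alpha>', \<nu>, \<delta>') = 0"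
  "\<delta> \<noteq> \<delta>' \<Longrightarrow> mult_coeff (\<alpha>, \<kappa>, \<beta>) (\<gamma>, \<mu>, \<delta>) (\<alpha>', \<nu>, \<delta>') = 0"
  by (cases t) simp_all

declare mult_coeff.simps [simp del]

lemma diagram_middle_iff:
  assumes "i \<le> N" "j \<le> N"
  shows "(wedge_at N i, \<nu>, wedge_at N j) \<in> diagrams (block N (Suc 0)) \<longleftrightarrow>
    (\<exists>k\<le>N. \<nu> = wedge_at N k \<and> (k = i \<or> Suc k = i) \<and> (k = j \<or> Suc k = j))"
  using assms by (auto simp: diagrams_def block_eq orients_wedge_at)

text \<open>Multiplying by an idempotent needs no surgery computation: the coefficients are forced by
  the unit law.\<close>

lemma mult_coeff_idempotent:
  assumes R: "ring (diagram_algebra (block N (Suc 0)))"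
    and d: "(\<alpha>, \<kappa>, \<beta>) \<in> diagrams (block N (Suc 0))" and t: "t \<in> diagrams (block N (Suc 0))"
  shows "mult_coeff (\<alpha>, \<kappa>, \<beta>) (\<beta>, \<beta>, \<beta>) t = single (\<alpha>, \<kappa>, \<beta>) t"
    and "mult_coeff (\<alpha>, \<alpha>, \<alpha>) (\<alpha>, \<kappa>, \<beta>) t = single (\<alpha>, \<kappa>, \<beta>) t"
proof -
  interpret ring "diagram_algebra (block N (Suc 0))" by (rule R)
  let ?D = "diagrams (block N (Suc 0))"
  let ?A = "diagram_algebra (block N (Suc 0))"
  have fin: "finite ?D" by (intro finite_diagrams finite_block)
  obtain \<alpha>' \<nu> \<delta>' where t': "t = (\<alpha>', \<nu>, \<delta>')" by (cases t)
  have ab: "\<alpha> \<in> block N (Suc 0)" "\<beta> \<in> block N (Suc 0)" using d by (auto simp: diagrams_def)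
  then have D: "(\<alpha>, \<alpha>, \<alpha>) \<in> ?D" "(\<beta>, \<beta>, \<beta>) \<in> ?D"
    by (auto simp: diagrams_def orients_refl)
  have "single (\<alpha>, \<kappa>, \<beta>) t = (single (\<alpha>, \<kappa>, \<beta>) \<otimes>\<^bsub>?A\<^esub> \<one>\<^bsub>?A\<^esub>) t"
    using d by (simp add: single_in_diagram_algebra)
  also have "\<dots> = (\<Sum>s\<in>?D. \<one>\<^bsub>?A\<^esub> s * mult_coeff (\<alpha>, \<kappa>, \<beta>) s t)"
    using d t by (simp add: mult_single_left finite_block)
  also have "\<dots> = (\<Sum>s\<in>?D. single (\<beta>, \<beta>, \<beta>) s * mult_coeff (\<alpha>, \<kappa>, \<beta>) s t)"
  proof (intro sum.cong refl)
    fix s :: diagram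
    obtain \<gamma> \<mu> \<delta> where s: "s = (\<gamma>, \<mu>, \<delta>)" by (cases s)
    show "\<one>\<^bsub>?A\<^esub> s * mult_coeff (\<alpha>, \<kappa>, \<beta>) s t = single (\<beta>, \<beta>, \<beta>) s * mult_coeff (\<alpha>, \<kappa>, \<beta>) s t"
      using ab by (cases "\<gamma> = \<beta>") (auto simp: s one_diagram_algebra single_def)
  qed
  also have "\<dots> = mult_coeff (\<alpha>, \<kappa>, \<beta>) (\<beta>, \<beta>, \<beta>) t"
    using D fin by (simp add: sum_single_left)
  finally show "mult_coeff (\<alpha>, \<kappa>, \<beta>) (\<beta>, \<beta>, \<beta>) t = single (\<alpha>, \<kappa>, \<beta>) t" ..
  have "single (\<alpha>, \<kappa>, \<beta>) t = (\<one>\<^bsub>?A\<^esub> \<otimes>\<^bsub>?A\<^esub> single (\<alpha>, \<kappa>, \<beta>)) t"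
    using d by (simp add: single_in_diagram_algebra)
  also have "\<dots> = (\<Sum>s\<in>?D. \<one>\<^bsub>?A\<^esub> s * mult_coeff s (\<alpha>, \<kappa>, \<beta>) t)"
    using d t by (simp add: mult_single_right finite_block)
  also have "\<dots> = (\<Sum>s\<in>?D. single (\<alpha>, \<alpha>, \<alpha>) s * mult_coeff s (\<alpha>, \<kappa>, \<beta>) t)"
  proof (intro sum.cong refl)
    fix s :: diagram
    obtain \<gamma> \<mu> \<delta> where s: "s = (\<gamma>, \<mu>, \<delta>)" by (cases s)
    show "\<one>\<^bsub>?A\<^esub> s * mult_coeff s (\<alpha>, \<kappa>, \<beta>) t = single (\<alpha>, \<alpha>, \<alpha>) s * mult_coeff s (\<alpha>, \<kappa>, \<beta>) t"
      using ab by (cases "\<gamma> = \<alpha>") (auto simp: s one_diagram_algebra single_def)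
  qed
  also have "\<dots> = mult_coeff (\<alpha>, \<alpha>, \<alpha>) (\<alpha>, \<kappa>, \<beta>) t"
    using D fin by (simp add: sum_single_left)
  finally show "mult_coeff (\<alpha>, \<alpha>, \<alpha>) (\<alpha>, \<kappa>, \<beta>) t = single (\<alpha>, \<kappa>, \<beta>) t" ..
qed

section \<open>The generators of the zigzag algebra and their relations\<close>

definition idem :: "nat \<Rightarrow> nat \<Rightarrow> diagram \<Rightarrow> complex" where
  "idem N j = single (wedge_at N j, wedge_at N j, wedge_at N j)"

text \<open>Zero at indices where the diagram does not exist. The relations can then be stated for
  all indices, and the last column needs no separate treatment.\<close>

definition up :: "nat \<Rightarrow> nat \<Rightarrow> diagram \<Rightarrow> complex" where
  "up N j = (if j < N then single (wedge_at N (Suc j), wedge_at N j, wedge_at N j) else (\<lambda>t. 0))"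

definition down :: "nat \<Rightarrow> nat \<Rightarrow> diagram \<Rightarrow> complex" where
  "down N j = (if j < N then single (wedge_at N j, wedge_at N j, wedge_at N (Suc j)) else (\<lambda>t. 0))"

text \<open>The ring axioms are an assumption at this point; the modules of the given resolution
  will supply them.\<close>

locale khovanov =
  fixes N :: nat and A :: "(complex, diagram \<Rightarrow> complex) module" (structure)
  assumes A_eq: "A = khovanov_algebra N (Suc 0)" and ring_A: "ring A"
begin

abbreviation "w \<equiv> wedge_at N"
abbreviation "e \<equiv> idem N"
abbreviation "r \<equiv> up N"
abbreviation "l \<equiv> down N"
abbreviation "\<Delta> \<equiv> diagrams (block N (Suc 0))"

lemmas A_diagram = A_eq[unfolded khovanov_algebra_def]

sublocale ring A by (rule ring_A)

lemma carrier_A: "x \<in> carrier A \<longleftrightarrow> (\<forall>t. t \<notin> \<Delta> \<longrightarrow> x t = 0)"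
  by (simp add: A_diagram carrier_diagram_algebra)

lemma zero_A: "\<zero> = (\<lambda>t. 0)"
  by (simp add: A_diagram zero_diagram_algebra)

lemma add_A: "x \<oplus> y = (\<lambda>t. x t + y t)"
  by (simp add: A_diagram add_diagram_algebra)

lemma smult_A: "c \<odot> x = (\<lambda>t. c * x t)"
  by (simp add: A_diagram smult_diagram_algebra)

lemma smult_A_closed [simp]: "x \<in> carrier A \<Longrightarrow> c \<odot> x \<in> carrier A"
  by (simp add: carrier_A smult_A)

lemma smult_A_mult: "(c \<odot> x) \<otimes> y = c \<odot> (x \<otimes> y)"
  by (simp add: A_diagram diagram_algebra_smult_mult)

lemma mult_smult_A: "x \<otimes> (c \<odot> y) = c \<odot> (x \<otimes> y)"
  by (simp add: A_diagram diagram_algebra_mult_smult)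

lemma smult_A_zero [simp]: "c \<odot> \<zero> = \<zero>"
  by (simp add: smult_A zero_A)

lemma scalar_one_central: "x \<in> carrier A \<Longrightarrow> x \<otimes> (c \<odot> \<one>) = (c \<odot> \<one>) \<otimes> x"
  by (simp add: mult_smult_A smult_A_mult)

lemma single_w_closed:
  "i \<le> N \<Longrightarrow> k \<le> N \<Longrightarrow> j \<le> N \<Longrightarrow> k = i \<or> Suc k = i \<Longrightarrow> k = j \<or> Suc k = j \<Longrightarrow>
    single (w i, w k, w j) \<in> carrier A"
  by (auto simp: A_diagram intro!: single_in_diagram_algebra simp: wedge_at_diagram_iff)

lemma e_closed [simp]: "j \<le> N \<Longrightarrow> e j \<in> carrier A"
  by (simp add: idem_def single_w_closed)

lemma r_closed [simp]: "r j \<in> carrier A"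
  by (auto simp: up_def carrier_A single_def wedge_at_diagram_iff)

lemma l_closed [simp]: "l j \<in> carrier A"
  by (auto simp: down_def carrier_A single_def wedge_at_diagram_iff)

lemma r_out: "\<not> j < N \<Longrightarrow> r j = \<zero>"
  by (simp add: up_def zero_A)

lemma l_out: "\<not> j < N \<Longrightarrow> l j = \<zero>"
  by (simp add: down_def zero_A)

lemma single_mult:
  assumes "x \<in> \<Delta>" "y \<in> \<Delta>"
  shows "single x \<otimes> single y = (\<lambda>t. if t \<in> \<Delta> then mult_coeff x y t else 0)"
  using assms unfolding A_diagram by (intro mult_single_single finite_block)

lemma mult_e:
  assumes "x \<in> carrier A" "j \<le> N"
  shows "x \<otimes> e j = (\<lambda>(\<alpha>, \<kappa>, \<beta>). if \<beta> = w j then x (\<alpha>, \<kappa>, \<beta>) else 0)"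
proof
  fix t :: diagram
  obtain \<alpha> \<kappa> \<beta> where t: "t = (\<alpha>, \<kappa>, \<beta>)" by (cases t)
  have eD: "(w j, w j, w j) \<in> \<Delta>" using assms by (simp add: wedge_at_diagram_iff)
  have fin: "finite \<Delta>" by (intro finite_diagrams finite_block)
  show "(x \<otimes> e j) t = (\<lambda>(\<alpha>, \<kappa>, \<beta>). if \<beta> = w j then x (\<alpha>, \<kappa>, \<beta>) else 0) t"
  proof (cases "t \<in> \<Delta>")
    case True
    have "(x \<otimes> e j) t = (\<Sum>u\<in>\<Delta>. x u * mult_coeff u (w j, w j, w j) t)"
      using True eD by (simp add: A_diagram idem_def mult_single_right finite_block)
    also have "\<dots> = (\<Sum>u\<in>\<Delta>. if u = t then (if \<beta> = w j then x t else 0) else 0)"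
    proof (intro sum.cong refl)
      fix u assume u: "u \<in> \<Delta>"
      obtain \<alpha>' \<kappa>' \<beta>' where u': "u = (\<alpha>', \<kappa>', \<beta>')" by (cases u)
      show "x u * mult_coeff u (w j, w j, w j) t = (if u = t then (if \<beta> = w j then x t else 0) else 0)"
      proof (cases "\<beta>' = w j")
        case True
        then have "mult_coeff u (w j, w j, w j) t = single u t"
          using mult_coeff_idempotent(1)[of N \<alpha>' \<kappa>' \<beta>' t] u u' \<open>t \<in> \<Delta>\<close> ring_A
          by (simp add: A_diagram)
        then show ?thesis using True by (auto simp: u' t single_def)
      qed (auto simp: u' t)
    qed
    also have "\<dots> = (if \<beta> = w j then x t else 0)" using True fin by simp
    finally show ?thesis by (simp add: t)
  next
    case False
    then have "(x \<otimes> e j) t = 0" "x t = 0"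
      using assms(1) unfolding carrier_A by (simp add: A_diagram mult_diagram_algebra, blast)
    then show ?thesis by (auto simp: t)
  qed
qed

lemma e_mult:
  assumes "x \<in> carrier A" "j \<le> N"
  shows "e j \<otimes> x = (\<lambda>(\<alpha>, \<kappa>, \<beta>). if \<alpha> = w j then x (\<alpha>, \<kappa>, \<beta>) else 0)"
proof
  fix t :: diagram
  obtain \<alpha> \<kappa> \<beta> where t: "t = (\<alpha>, \<kappa>, \<beta>)" by (cases t)
  have eD: "(w j, w j, w j) \<in> \<Delta>" using assms by (simp add: wedge_at_diagram_iff)
  have fin: "finite \<Delta>" by (intro finite_diagrams finite_block)
  show "(e j \<otimes> x) t = (\<lambda>(\<alpha>, \<kappa>, \<beta>). if \<alpha> = w j then x (\<alpha>, \<kappa>, \<beta>) else 0) t"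
  proof (cases "t \<in> \<Delta>")
    case True
    have "(e j \<otimes> x) t = (\<Sum>u\<in>\<Delta>. x u * mult_coeff (w j, w j, w j) u t)"
      using True eD by (simp add: A_diagram idem_def mult_single_left finite_block)
    also have "\<dots> = (\<Sum>u\<in>\<Delta>. if u = t then (if \<alpha> = w j then x t else 0) else 0)"
    proof (intro sum.cong refl)
      fix u assume u: "u \<in> \<Delta>"
      obtain \<alpha>' \<kappa>' \<beta>' where u': "u = (\<alpha>', \<kappa>', \<beta>')" by (cases u)
      show "x u * mult_coeff (w j, w j, w j) u t = (if u = t then (if \<alpha> = w j then x t else 0) else 0)"
      proof (cases "\<alpha>' = w j")
        case True
        then have "mult_coeff (w j, w j, w j) u t = single u t"
          using mult_coeff_idempotent(2)[of N \<alpha>' \<kappa>' \<beta>' t] u u' \<open>t \<in> \<Delta>\<close> ring_A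
          by (simp add: A_diagram)
        then show ?thesis using True by (auto simp: u' t single_def)
      qed (auto simp: u' t)
    qed
    also have "\<dots> = (if \<alpha> = w j then x t else 0)" using True fin by simp
    finally show ?thesis by (simp add: t)
  next
    case False
    then have "(e j \<otimes> x) t = 0" "x t = 0"
      using assms(1) unfolding carrier_A by (simp add: A_diagram mult_diagram_algebra, blast)
    then show ?thesis by (auto simp: t)
  qed
qed

lemma single_e:
  assumes "(\<alpha>, \<kappa>, w i) \<in> \<Delta>" "i \<le> N" "j \<le> N"
  shows "single (\<alpha>, \<kappa>, w i) \<otimes> e j = (if i = j then single (\<alpha>, \<kappa>, w i) else \<zero>)"
proof -
  have "single (\<alpha>, \<kappa>, w i) \<in> carrier A" using assms by (auto simp: carrier_A single_def)
  then show ?thesis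
    using assms by (auto simp: mult_e zero_A single_def fun_eq_iff)
qed

lemma e_single:
  assumes "(w i, \<kappa>, \<beta>) \<in> \<Delta>" "i \<le> N" "j \<le> N"
  shows "e j \<otimes> single (w i, \<kappa>, \<beta>) = (if i = j then single (w i, \<kappa>, \<beta>) else \<zero>)"
proof -
  have "single (w i, \<kappa>, \<beta>) \<in> carrier A" using assms by (auto simp: carrier_A single_def)
  then show ?thesis
    using assms by (auto simp: e_mult zero_A single_def fun_eq_iff)
qed

lemma e_e: "i \<le> N \<Longrightarrow> j \<le> N \<Longrightarrow> e i \<otimes> e j = (if i = j then e i else \<zero>)"
  by (simp add: idem_def single_e[unfolded idem_def] wedge_at_diagram_iff)

lemma r_e:
  assumes "j \<le> N"
  shows "r i \<otimes> e j = (if i = j then r i else \<zero>)"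
proof (cases "i < N")
  case True
  then show ?thesis using assms by (auto simp: up_def single_e wedge_at_diagram_iff)
qed (use assms in \<open>auto simp: r_out\<close>)

lemma l_e:
  assumes "j \<le> N"
  shows "l i \<otimes> e j = (if j = Suc i then l i else \<zero>)"
proof (cases "i < N")
  case True
  then show ?thesis using assms by (auto simp: down_def single_e wedge_at_diagram_iff)
qed (use assms in \<open>auto simp: l_out\<close>)

lemma e_l:
  assumes "j \<le> N"
  shows "e j \<otimes> l i = (if i = j then l i else \<zero>)"
proof (cases "i < N")
  case True
  then show ?thesis using assms by (auto simp: down_def e_single wedge_at_diagram_iff)
qed (use assms in \<open>auto simp: l_out\<close>)

lemma single_mult_mismatch:
  assumes "(\<alpha>, \<kappa>, \<beta>) \<in> \<Delta>" "(\<gamma>, \<mu>, \<delta>) \<in> \<Delta>" "\<beta> \<noteq> \<gamma> \<or> (\<forall>\<nu>. (\<alpha>, \<nu>, \<delta>) \<notin> \<Delta>)"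
  shows "single (\<alpha>, \<kappa>, \<beta>) \<otimes> single (\<gamma>, \<mu>, \<delta>) = \<zero>"
proof (cases "\<beta> = \<gamma>")
  case True
  have "mult_coeff (\<alpha>, \<kappa>, \<beta>) (\<gamma>, \<mu>, \<delta>) t = 0" if "t \<in> \<Delta>" for t
    using that True assms(3) by (cases t) (metis mult_coeff_mismatch(2,3))
  then show ?thesis using assms(1,2) by (simp add: single_mult zero_A fun_eq_iff)
qed (use assms in \<open>simp add: single_mult zero_A fun_eq_iff\<close>)

lemma no_diagram_2:
  assumes "Suc (Suc i) \<le> N" shows "(w i, \<nu>, w (Suc (Suc i))) \<notin> \<Delta>" "(w (Suc (Suc i)), \<nu>, w i) \<notin> \<Delta>"
  using assms by (auto simp: diagrams_block_iff)

text \<open>If the middle diagrams match, the outer cup diagrams are two apart, and no weight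
  orients both.\<close>

lemma l_l: "l i \<otimes> l j = \<zero>"
proof (cases "i < N \<and> j < N")
  case True
  then show ?thesis
    by (auto simp: down_def wedge_at_diagram_iff no_diagram_2 intro!: single_mult_mismatch)
qed (auto simp: r_out l_out)

lemma l_r_mismatch: "i \<noteq> j \<Longrightarrow> l i \<otimes> r j = \<zero>"
proof (cases "i < N \<and> j < N")
  case True
  assume "i \<noteq> j"
  with True show ?thesis
    by (auto simp: up_def down_def wedge_at_diagram_iff intro!: single_mult_mismatch)
qed (auto simp: r_out l_out)

text \<open>The result is the loop at \<open>k + 1\<close> whose circle is clockwise. For
  \<open>k = 0\<close> the middle diagram has no cup and nothing is cut; otherwise a line splits off
  that circle.\<close>

lemma r_l: 
  assumes "k < N"
  shows "r k \<otimes> l k = single (w (Suc k), w k, w (Suc k))"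
proof -
  have D: "(w (Suc k), w k, w k) \<in> \<Delta>" "(w k, w k, w (Suc k)) \<in> \<Delta>" "(w (Suc k), w k, w (Suc k)) \<in> \<Delta>"
    using assms by (auto simp: wedge_at_diagram_iff)
  have "mult_coeff (w (Suc k), w k, w k) (w k, w k, w (Suc k)) t = single (w (Suc k), w k, w (Suc k)) t"
    if tD: "t \<in> \<Delta>" for t
  proof -
    obtain \<alpha> \<nu> \<delta> where t: "t = (\<alpha>, \<nu>, \<delta>)" by (cases t)
    show ?thesis
    proof (cases "\<alpha> = w (Suc k) \<and> \<delta> = w (Suc k)")
      case True
      then obtain i where i: "\<nu> = w i" "i = k \<or> i = Suc k" "i \<le> N"
        using tD assms unfolding t by (auto simp: diagram_middle_iff)
      show ?thesis
      proof (cases k)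
        case 0
        then show ?thesis using i True assms by (auto simp: t single_apply mult_coeff_wedge_at_0)
      next
        case (Suc k')
        then show ?thesis
          using i True assms surgery_term_right[of k' N i]
          by (auto simp: t single_apply mult_coeff_wedge_at)
      qed
    next
      case False
      then show ?thesis by (auto simp: t single_apply)
    qed
  qed
  then show ?thesis
    using assms D by (auto simp: up_def down_def single_mult single_apply fun_eq_iff)
qed

text \<open>For \<open>k > 0\<close> both products are the clockwise loop at \<open>k\<close>. At
  \<open>k = 0\<close> two lines would be reconnected, and the surgery gives zero.\<close>

lemma l_r:
  assumes "k < N"
  shows "l k \<otimes> r k = (case k of 0 \<Rightarrow> \<zero> | Suc j \<Rightarrow> r j \<otimes> l j)"
proof -
  have D: "(w k, w k, w (Suc k)) \<in> \<Delta>" "(w (Suc k), w k, w k) \<in> \<Delta>"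
    using assms by (auto simp: wedge_at_diagram_iff)
  have coeff: "mult_coeff (w k, w k, w (Suc k)) (w (Suc k), w k, w k) t =
      (case k of 0 \<Rightarrow> 0 | Suc j \<Rightarrow> single (w k, w j, w k) t)" if tD: "t \<in> \<Delta>" for t
  proof -
    obtain \<alpha> \<nu> \<delta> where t: "t = (\<alpha>, \<nu>, \<delta>)" by (cases t)
    show ?thesis
    proof (cases "\<alpha> = w k \<and> \<delta> = w k")
      case True
      then obtain i where i: "\<nu> = w i" "i = k \<or> Suc i = k" "i \<le> N"
        using tD assms unfolding t by (auto simp: diagram_middle_iff)
      show ?thesis
      proof (cases k)
        case 0
        then show ?thesis
          using i True assms surgery_term_0[of N]
          by (auto simp: t single_apply mult_coeff_wedge_at)
      next
        case (Suc k')
        then show ?thesis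
          using i True assms surgery_term_left[of k' N i]
          by (auto simp: t single_apply mult_coeff_wedge_at)
      qed
    next
      case False
      then show ?thesis by (auto simp: t single_apply split: nat.split)
    qed
  qed
  show ?thesis
  proof (cases k)
    case 0
    then show ?thesis using assms D coeff
      by (auto simp: up_def down_def single_mult zero_A fun_eq_iff)
  next
    case (Suc j)
    then have "(w k, w j, w k) \<in> \<Delta>" using assms by (auto simp: wedge_at_diagram_iff)
    then show ?thesis using Suc assms D coeff
      by (auto simp: r_l up_def[of N "Suc j"] down_def[of N "Suc j"] single_mult single_apply fun_eq_iff
         )
  qed
qed

section \<open>Columns of the algebra and right multiplication by the elements
  \<open>l\<close>\<close>

lemma A_out: "x \<in> carrier A \<Longrightarrow> t \<notin> \<Delta> \<Longrightarrow> x t = 0"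
  unfolding carrier_A by blast

text \<open>The relation for \<open>l i \<otimes> r i\<close> gives zero or
  \<open>r (i - 1) \<otimes> l (i - 1)\<close>, which leaves two adjacent elements
  \<open>l\<close>.\<close>

lemma l_r_l: "i < N \<Longrightarrow> l i \<otimes> (r i \<otimes> l i) = \<zero>"
proof -
  assume "i < N"
  then have "(l i \<otimes> r i) \<otimes> l i = \<zero>"
    by (cases i) (simp_all add: l_r m_assoc l_l)
  then show ?thesis by (simp add: m_assoc)
qed

text \<open>The column \<open>A e_c\<close> is spanned by \<open>e c\<close>, \<open>r c\<close>,
  \<open>l b\<close> and \<open>r b \<otimes> l b\<close> with \<open>b = c - 1\<close>. The last
  two are grouped as a multiple of \<open>l b\<close>, since they span the image of the
  differential.\<close>

lemma column_decomp:
  assumes "y \<in> carrier A" "c \<le> N" "y \<otimes> e c = y"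
  shows "y = (y (w c, w c, w c) \<odot> e c \<oplus> y (w (Suc c), w c, w c) \<odot> r c) \<oplus>
    (case c of 0 \<Rightarrow> \<zero> | Suc b \<Rightarrow>
      (y (w b, w b, w c) \<odot> e b \<oplus> y (w c, w b, w c) \<odot> r b) \<otimes> l b)"
    (is "y = ?Y")
proof -
  have zero: "y (\<alpha>, \<kappa>, \<beta>) = 0" if "\<beta> \<noteq> w c" for \<alpha> \<kappa> \<beta>
  proof -
    have "(y \<otimes> e c) (\<alpha>, \<kappa>, \<beta>) = 0" using that assms(1,2) by (simp add: mult_e)
    then show ?thesis by (simp only: assms(3))
  qed
  have Y: "?Y = (\<lambda>t. y (w c, w c, w c) * e c t + y (w (Suc c), w c, w c) * r c t +
    (case c of 0 \<Rightarrow> 0 | Suc b \<Rightarrow> y (w b, w b, w c) * l b t + y (w c, w b, w c) * single (w c, w b, w c) t))"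
    (is "_ = ?Z")
  proof (cases c)
    case 0
    then show ?thesis by (simp add: add_A smult_A zero_A)
  next
    case (Suc b)
    have "(y (w b, w b, w c) \<odot> e b \<oplus> y (w c, w b, w c) \<odot> r b) \<otimes> l b =
      y (w b, w b, w c) \<odot> l b \<oplus> y (w c, w b, w c) \<odot> single (w c, w b, w c)"
      using assms(2) Suc by (simp add: l_distr smult_A_mult e_l r_l)
    then show ?thesis using Suc by (simp add: add_A smult_A)
  qed
  have "y t = ?Z t" for t
  proof (cases "t \<in> \<Delta>")
    case False
    have "e c t = 0" "r c t = 0" "\<And>b. c = Suc b \<Longrightarrow> l b t = 0 \<and> single (w c, w b, w c) t = 0"
      using False assms(2) by (auto intro!: A_out single_w_closed)
    then show ?thesis using A_out[OF assms(1) False] by (auto split: nat.split)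
  next
    case True
    then obtain i k j where t: "t = (w i, w k, w j)" "i \<le> N" "k \<le> N" "j \<le> N"
      "k = i \<or> Suc k = i" "k = j \<or> Suc k = j"
      by (cases t) (auto simp: diagrams_block_iff)
    show ?thesis
    proof (cases "j = c")
      case False
      then show ?thesis
        using t assms(2) zero
        by (auto simp: idem_def up_def down_def single_apply split: nat.split)
    next
      case True
      then show ?thesis
        using t assms(2)
        by (auto simp: idem_def up_def down_def single_apply split: nat.split)
    qed
  qed
  then show ?thesis unfolding Y by blast
qed

text \<open>One half of the exactness of the minimal resolution: without \<open>e c\<close> and
  \<open>r c\<close> parts, an element comes from the column of \<open>b\<close> by multiplication
  with \<open>l b\<close>.\<close>

lemma column_factor:
  assumes "y \<in> carrier A" "c \<le> N" "y \<otimes> e c = y"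
    and "y (w c, w c, w c) = 0" "c < N \<Longrightarrow> y (w (Suc c), w c, w c) = 0"
  shows "y \<in> (case c of 0 \<Rightarrow> {\<zero>} | Suc b \<Rightarrow> (\<lambda>z. z \<otimes> l b) ` {z \<in> carrier A. z \<otimes> e b = z})"
proof -
  have "y (w (Suc c), w c, w c) \<odot> r c = \<zero>"
    using assms(5) by (cases "c < N") (auto simp: r_out smult_A zero_A)
  then have y: "y = (case c of 0 \<Rightarrow> \<zero> | Suc b \<Rightarrow>
      (y (w b, w b, w c) \<odot> e b \<oplus> y (w c, w b, w c) \<odot> r b) \<otimes> l b)" (is "y = ?Y")
    using column_decomp[OF assms(1-3)] assms(4) assms(2)
    by (auto simp: smult_A zero_A add_A split: nat.splits)
  show ?thesis
  proof (cases c)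
    case 0
    then show ?thesis using y by simp
  next
    case (Suc b)
    define z where "z = y (w b, w b, w c) \<odot> e b \<oplus> y (w c, w b, w c) \<odot> r b"
    have "z \<in> carrier A" "z \<otimes> e b = z" "y = z \<otimes> l b"
      using y Suc assms(2) by (simp_all add: z_def l_distr smult_A_mult e_e r_e)
    then show ?thesis using Suc by auto
  qed
qed

lemma column_mult_l:
  assumes "y \<in> carrier A" "c < N" "y \<otimes> e c = y"
  shows "y \<otimes> l c = y (w c, w c, w c) \<odot> l c \<oplus> y (w (Suc c), w c, w c) \<odot> (r c \<otimes> l c)"
proof -
  have "y \<otimes> l c = ((y (w c, w c, w c) \<odot> e c \<oplus> y (w (Suc c), w c, w c) \<odot> r c) \<oplus>
    (case c of 0 \<Rightarrow> \<zero> | Suc b \<Rightarrow>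
      (y (w b, w b, w c) \<odot> e b \<oplus> y (w c, w b, w c) \<odot> r b) \<otimes> l b)) \<otimes> l c"
    using column_decomp[of y c] assms by simp
  also have "\<dots> = y (w c, w c, w c) \<odot> l c \<oplus> y (w (Suc c), w c, w c) \<odot> (r c \<otimes> l c)"
    using assms(2)
    by (cases c) (simp_all add: l_distr smult_A_mult e_l m_assoc l_l)
  finally show ?thesis .
qed

lemma column_mult_l_coeffs:
  assumes "y \<in> carrier A" "c < N" "y \<otimes> e c = y"
  shows "(y \<otimes> l c) (w c, w c, w (Suc c)) = y (w c, w c, w c)"
    and "(y \<otimes> l c) (w (Suc c), w c, w (Suc c)) = y (w (Suc c), w c, w c)"
  using assms(2) unfolding column_mult_l[OF assms] r_l[OF assms(2)]
  by (simp_all add: add_A smult_A down_def single_apply)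

text \<open>The other half of the exactness: \<open>e c \<otimes> l c\<close> and
  \<open>r c \<otimes> l c\<close> are different basis diagrams, so an element killed by
  \<open>l c\<close> has neither component.\<close>

lemma column_annihilated:
  assumes "y \<in> carrier A" "c < N" "y \<otimes> e c = y" "y \<otimes> l c = \<zero>"
  shows "y (w c, w c, w c) = 0" "y (w (Suc c), w c, w c) = 0"
  using column_mult_l_coeffs[OF assms(1-3)] assms(4) by (simp_all add: zero_A)

section \<open>The action on the cell modules\<close>

abbreviation "M \<equiv> cell_sum N"

lemma carrier_M:
  "m \<in> carrier M \<longleftrightarrow> m \<in> extensional {0..N} \<and>
    (\<forall>i\<le>N. \<forall>\<alpha>. \<not> (\<alpha> \<in> block N (Suc 0) \<and> orients \<alpha> (w i)) \<longrightarrow> m i \<alpha> = 0)"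
  by (auto simp: cell_sum_def direct_sum_def cell_at_def cell_module_def PiE_iff)

lemma carrier_M_zero:
  assumes "m \<in> carrier M" "i \<le> N" "c \<le> N" "c \<noteq> i" "c \<noteq> Suc i"
  shows "m i (w c) = 0"
  using assms by (auto simp: carrier_M orients_wedge_at)

text \<open>The summand \<open>i\<close> has basis vectors only at \<open>w i\<close> and, for
  \<open>i < N\<close>, at \<open>w (Suc i)\<close>.\<close>

lemma M_eqI:
  assumes "m \<in> carrier M" "m' \<in> carrier M"
    and "\<And>i. i \<le> N \<Longrightarrow> m i (w i) = m' i (w i)"
    and "\<And>i. i < N \<Longrightarrow> m i (w (Suc i)) = m' i (w (Suc i))"
  shows "m = m'"
proof (rule extensionalityI)
  show "m \<in> extensional {0..N}" "m' \<in> extensional {0..N}" using assms by (auto simp: carrier_M)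
  fix i assume "i \<in> {0..N}"
  then have i: "i \<le> N" by simp
  show "m i = m' i"
  proof
    fix \<alpha>
    show "m i \<alpha> = m' i \<alpha>"
    proof (cases "\<alpha> \<in> block N (Suc 0) \<and> orients \<alpha> (w i)")
      case True
      then obtain j where "\<alpha> = w j" "j \<le> N" "j = i \<or> j = Suc i"
        using i by (auto simp: block_eq orients_wedge_at)
      then show ?thesis using assms(3,4) i by auto
    next
      case False
      then show ?thesis using assms(1,2) i by (auto simp: carrier_M)
    qed
  qed
qed

lemma zero_M: "\<zero>\<^bsub>M\<^esub> = (\<lambda>i\<in>{0..N}. \<lambda>\<alpha>. 0)"
  by (simp add: cell_sum_def direct_sum_def cell_at_def cell_module_def)

lemma add_M: "x \<oplus>\<^bsub>M\<^esub> y = (\<lambda>i\<in>{0..N}. \<lambda>\<alpha>. x i \<alpha> + y i \<alpha>)"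
  by (simp add: cell_sum_def direct_sum_def cell_at_def cell_module_def)

lemma smult_M:
  "a \<odot>\<^bsub>M\<^esub> m = (\<lambda>i\<in>{0..N}. \<lambda>\<alpha>. if \<alpha> \<in> block N (Suc 0) \<and> orients \<alpha> (w i)
     then \<Sum>\<kappa>\<in>block N (Suc 0). \<Sum>\<beta>\<in>{\<beta>\<in>block N (Suc 0). orients \<beta> (w i)}.
       a (\<alpha>, \<kappa>, \<beta>) * mult_coeff (\<alpha>, \<kappa>, \<beta>) (\<beta>, w i, w i) (\<alpha>, w i, w i) * m i \<beta> else 0)"
  by (simp add: cell_sum_def direct_sum_def cell_at_def cell_module_def)

lemma smult_M_scale:
  assumes "i \<le> N"
  shows "((c \<odot> a) \<odot>\<^bsub>M\<^esub> m) i \<alpha> = c * (a \<odot>\<^bsub>M\<^esub> m) i \<alpha>"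
  using assms by (auto simp: smult_M smult_A sum_distrib_left mult_ac)

lemma single_smult_M:
  assumes "p \<le> N" "k \<le> N" "q \<le> N" "i \<le> N"
  shows "(single (w p, w k, w q) \<odot>\<^bsub>M\<^esub> m) i \<alpha> =
    (if \<alpha> = w p \<and> (p = i \<or> p = Suc i) \<and> (q = i \<or> q = Suc i)
     then mult_coeff (w p, w k, w q) (w q, w i, w i) (w p, w i, w i) * m i (w q) else 0)"
proof (cases "\<alpha> = w p \<and> (p = i \<or> p = Suc i)")
  case True
  let ?B = "{\<beta>\<in>block N (Suc 0). orients \<beta> (w i)}"
  let ?f = "\<lambda>\<kappa> \<beta>. mult_coeff (w p, \<kappa>, \<beta>) (\<beta>, w i, w i) (w p, w i, w i) * m i \<beta>"
  have fin: "finite ?B" "finite (block N (Suc 0))" using finite_block by auto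
  have "(single (w p, w k, w q) \<odot>\<^bsub>M\<^esub> m) i \<alpha> =
      (\<Sum>\<kappa>\<in>block N (Suc 0). \<Sum>\<beta>\<in>?B. single (w p, w k, w q) (w p, \<kappa>, \<beta>) * ?f \<kappa> \<beta>)"
    using True assms by (auto simp: smult_M orients_wedge_at block_eq mult.assoc)
  also have "\<dots> = (\<Sum>\<kappa>\<in>block N (Suc 0). single (w k) \<kappa> * (\<Sum>\<beta>\<in>?B. single (w q) \<beta> * ?f \<kappa> \<beta>))"
    unfolding sum_distrib_left
    by (intro sum.cong refl) (auto simp: single_apply)
  also have "\<dots> = (if w q \<in> ?B then ?f (w k) (w q) else 0)"
    using assms by (simp add: sum_single_left[OF fin(1)] sum_single_left[OF fin(2)])
      (auto simp: block_eq)
  finally show ?thesis using True assms by (auto simp: orients_wedge_at block_eq)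
next
  case False
  then show ?thesis
    using assms by (auto simp: smult_M single_apply orients_wedge_at block_eq intro!: sum.neutral)
qed

lemma e_smult_M:
  assumes "m \<in> carrier M" "c \<le> N" "i \<le> N"
  shows "(e c \<odot>\<^bsub>M\<^esub> m) i \<alpha> = (if \<alpha> = w c then m i (w c) else 0)"
proof -
  have "mult_coeff (w c, w c, w c) (w c, w i, w i) (w c, w i, w i) = 1" if "c = i \<or> c = Suc i"
    using that assms mult_coeff_idempotent(2)[of N "w c" "w i" "w i" "(w c, w i, w i)"] ring_A
    by (auto simp: A_diagram wedge_at_diagram_iff)
  moreover have "m i (w c) = 0" if "\<not> (c = i \<or> c = Suc i)"
    using that assms carrier_M_zero by auto
  ultimately show ?thesis
    using assms by (auto simp: idem_def single_smult_M)
qed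

lemma smult_M_zero_left: "i \<le> N \<Longrightarrow> ((\<lambda>t. 0) \<odot>\<^bsub>M\<^esub> m) i \<alpha> = 0"
  by (simp add: smult_M)

text \<open>The only structure constant involved is one for right multiplication by
  \<open>e c\<close>, so it is 1.\<close>

lemma r_smult_M:
  assumes "i \<le> N"
  shows "(r c \<odot>\<^bsub>M\<^esub> m) i \<alpha> = (if c < N \<and> i = c \<and> \<alpha> = w (Suc c) then m c (w c) else 0)"
proof (cases "c < N")
  case True
  have "mult_coeff (w (Suc c), w c, w c) (w c, w c, w c) (w (Suc c), w c, w c) = 1"
    using True mult_coeff_idempotent(1)[of N "w (Suc c)" "w c" "w c" "(w (Suc c), w c, w c)"] ring_A
    by (auto simp: A_diagram wedge_at_diagram_iff)
  then show ?thesis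
    using True assms by (auto simp: up_def single_smult_M)
next
  case False
  then show ?thesis using assms by (simp add: up_def smult_M_zero_left)
qed

text \<open>The only possible contribution is in the summand \<open>c\<close>, with the coefficient
  of the idempotent diagram in \<open>l c \<otimes> r c\<close>. That product is zero or a loop with
  another weight.\<close>

lemma l_smult_M:
  assumes "i \<le> N"
  shows "(l c \<odot>\<^bsub>M\<^esub> m) i \<alpha> = 0"
proof (cases "c < N")
  case True
  have D: "(w c, w c, w (Suc c)) \<in> \<Delta>" "(w (Suc c), w c, w c) \<in> \<Delta>" "(w c, w c, w c) \<in> \<Delta>"
    using True by (auto simp: wedge_at_diagram_iff)
  have "mult_coeff (w c, w c, w (Suc c)) (w (Suc c), w c, w c) (w c, w c, w c) =
      (l c \<otimes> r c) (w c, w c, w c)"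
    using True D by (simp add: up_def down_def single_mult)
  also have "\<dots> = 0"
    using True by (cases c) (auto simp: l_r zero_A r_l single_apply)
  finally show ?thesis
    using True assms by (auto simp: down_def single_smult_M)
next
  case False
  then show ?thesis using assms by (simp add: down_def smult_M_zero_left)
qed

end

section \<open>Finite-dimensional modules and projective resolutions\<close>

lemma mod_homD:
  assumes "f \<in> mod_hom A M L"
  shows "x \<in> carrier M \<Longrightarrow> f x \<in> carrier L"
    and "x \<in> carrier M \<Longrightarrow> y \<in> carrier M \<Longrightarrow> f (x \<oplus>\<^bsub>M\<^esub> y) = f x \<oplus>\<^bsub>L\<^esub> f y"
    and "a \<in> carrier A \<Longrightarrow> x \<in> carrier M \<Longrightarrow> f (a \<odot>\<^bsub>M\<^esub> x) = a \<odot>\<^bsub>L\<^esub> f x"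
    and "f \<in> extensional (carrier M)"
  using assms by (auto simp: mod_hom_def PiE_iff)

lemma mod_homI:
  assumes "\<And>x. x \<in> carrier M \<Longrightarrow> f x \<in> carrier L"
    and "\<And>x y. x \<in> carrier M \<Longrightarrow> y \<in> carrier M \<Longrightarrow> f (x \<oplus>\<^bsub>M\<^esub> y) = f x \<oplus>\<^bsub>L\<^esub> f y"
    and "\<And>a x. a \<in> carrier A \<Longrightarrow> x \<in> carrier M \<Longrightarrow> f (a \<odot>\<^bsub>M\<^esub> x) = a \<odot>\<^bsub>L\<^esub> f x"
    and "f \<in> extensional (carrier M)"
  shows "f \<in> mod_hom A M L"
  using assms by (auto simp: mod_hom_def PiE_iff)

lemma mod_hom_restrict_carrier:
  assumes "f \<in> mod_hom A M L" "f ` carrier M \<subseteq> C"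
  shows "f \<in> mod_hom A M (L\<lparr>carrier := C\<rparr>)"
  using assms by (auto simp: mod_hom_def PiE_iff)

context left_module
begin

lemma add_diff_cancel: "x \<in> carrier M \<Longrightarrow> z \<in> carrier M \<Longrightarrow> z \<oplus>\<^bsub>M\<^esub> (x \<ominus>\<^bsub>M\<^esub> z) = x"
  by (simp add: a_minus_def M.a_comm[of x] M.r_neg2)

lemma diff_add_cancel: "x \<in> carrier M \<Longrightarrow> z \<in> carrier M \<Longrightarrow> (x \<ominus>\<^bsub>M\<^esub> z) \<oplus>\<^bsub>M\<^esub> z = x"
  by (simp add: a_minus_def M.a_assoc M.l_neg)

lemma smult_zero_right: "a \<in> carrier R \<Longrightarrow> a \<odot>\<^bsub>M\<^esub> \<zero>\<^bsub>M\<^esub> = \<zero>\<^bsub>M\<^esub>"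
  using smult_r_distr[of a "\<zero>\<^bsub>M\<^esub>" "\<zero>\<^bsub>M\<^esub>"] smult_closed[of a "\<zero>\<^bsub>M\<^esub>"]
    M.add.l_cancel_one'[of "a \<odot>\<^bsub>M\<^esub> \<zero>\<^bsub>M\<^esub>" "a \<odot>\<^bsub>M\<^esub> \<zero>\<^bsub>M\<^esub>"]
  by simp

lemma smult_zero_left: "x \<in> carrier M \<Longrightarrow> \<zero>\<^bsub>R\<^esub> \<odot>\<^bsub>M\<^esub> x = \<zero>\<^bsub>M\<^esub>"
  using smult_l_distr[of "\<zero>\<^bsub>R\<^esub>" "\<zero>\<^bsub>R\<^esub>" x] smult_closed[of "\<zero>\<^bsub>R\<^esub>" x]
    M.add.l_cancel_one'[of "\<zero>\<^bsub>R\<^esub> \<odot>\<^bsub>M\<^esub> x" "\<zero>\<^bsub>R\<^esub> \<odot>\<^bsub>M\<^esub> x"]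
  by simp

lemma smult_uminus:
  assumes "a \<in> carrier R" "x \<in> carrier M"
  shows "a \<odot>\<^bsub>M\<^esub> (\<ominus>\<^bsub>M\<^esub> x) = \<ominus>\<^bsub>M\<^esub> (a \<odot>\<^bsub>M\<^esub> x)"
proof -
  have "a \<odot>\<^bsub>M\<^esub> (\<ominus>\<^bsub>M\<^esub> x) \<oplus>\<^bsub>M\<^esub> a \<odot>\<^bsub>M\<^esub> x = \<zero>\<^bsub>M\<^esub>"
    using assms by (simp add: smult_zero_right M.l_neg flip: smult_r_distr)
  then show ?thesis
    using assms by (intro M.minus_equality[symmetric]) (auto simp: smult_closed)
qed

lemma smult_diff:
  assumes "a \<in> carrier R" "x \<in> carrier M" "y \<in> carrier M"
  shows "a \<odot>\<^bsub>M\<^esub> (x \<ominus>\<^bsub>M\<^esub> y) = a \<odot>\<^bsub>M\<^esub> x \<ominus>\<^bsub>M\<^esub> a \<odot>\<^bsub>M\<^esub> y"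
  using assms by (simp add: a_minus_def smult_r_distr smult_uminus)

lemma smult_finsum:
  assumes "finite I" "a \<in> carrier R" "f \<in> I \<rightarrow> carrier M"
  shows "a \<odot>\<^bsub>M\<^esub> (\<Oplus>\<^bsub>M\<^esub>i\<in>I. f i) = (\<Oplus>\<^bsub>M\<^esub>i\<in>I. a \<odot>\<^bsub>M\<^esub> f i)"
  using assms
proof (induction I rule: finite_induct)
  case empty
  then show ?case by (simp add: smult_zero_right)
next
  case (insert i I)
  then show ?case by (simp add: Pi_iff smult_r_distr smult_closed)
qed

end

text \<open>Scalars act on modules through the elements \<open>c \<odot> \<one>\<close>. Additivity
  serves to merge coefficients in spans, centrality to make scalar multiples of homomorphisms
  homomorphisms again.\<close>

locale complex_algebra =
  fixes A :: "(complex, 'a) module" (structure)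
  assumes ring_A: "ring A"
    and scalar_closed: "c \<odot> \<one> \<in> carrier A"
    and scalar_add: "(c + d) \<odot> \<one> = c \<odot> \<one> \<oplus> d \<odot> \<one>"
    and scalar_central: "x \<in> carrier A \<Longrightarrow> x \<otimes> (c \<odot> \<one>) = (c \<odot> \<one>) \<otimes> x"
begin

sublocale ring A by (rule ring_A)

lemma scalar_in: "left_module A L \<Longrightarrow> x \<in> carrier L \<Longrightarrow> scalar A L c x \<in> carrier L"
  by (simp add: scalar_def left_module.smult_closed scalar_closed)

lemma mod_hom_zero:
  assumes "left_module A M" "left_module A L" "f \<in> mod_hom A M L"
  shows "f \<zero>\<^bsub>M\<^esub> = \<zero>\<^bsub>L\<^esub>"
proof -
  interpret M: left_module A M by fact
  interpret L: left_module A L by fact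
  have "f \<zero>\<^bsub>M\<^esub> = f (\<zero>\<^bsub>M\<^esub> \<oplus>\<^bsub>M\<^esub> \<zero>\<^bsub>M\<^esub>)" by simp
  also have "\<dots> = f \<zero>\<^bsub>M\<^esub> \<oplus>\<^bsub>L\<^esub> f \<zero>\<^bsub>M\<^esub>" using assms(3) by (subst mod_homD) auto
  finally show ?thesis using mod_homD(1)[OF assms(3), of "\<zero>\<^bsub>M\<^esub>"]
    L.M.add.l_cancel_one'[of "f \<zero>\<^bsub>M\<^esub>" "f \<zero>\<^bsub>M\<^esub>"] by simp
qed

lemma mod_hom_diff:
  assumes "left_module A M" "left_module A L" "f \<in> mod_hom A M L" "x \<in> carrier M" "y \<in> carrier M"
  shows "f (x \<ominus>\<^bsub>M\<^esub> y) = f x \<ominus>\<^bsub>L\<^esub> f y"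
proof -
  interpret M: left_module A M by fact
  interpret L: left_module A L by fact
  note f = mod_homD[OF assms(3)]
  have "f (\<ominus>\<^bsub>M\<^esub> y) \<oplus>\<^bsub>L\<^esub> f y = \<zero>\<^bsub>L\<^esub>"
    using assms by (simp add: M.M.l_neg mod_hom_zero flip: f(2))
  then have "f (\<ominus>\<^bsub>M\<^esub> y) = \<ominus>\<^bsub>L\<^esub> f y"
    using assms by (intro L.M.minus_equality[symmetric]) (auto simp: f)
  then show ?thesis using assms by (simp add: a_minus_def f)
qed

lemma mod_hom_scalar:
  assumes "f \<in> mod_hom A M L" "x \<in> carrier M"
  shows "f (scalar A M c x) = scalar A L c (f x)"
  using assms by (simp add: scalar_def mod_homD scalar_closed)

lemma smult_scalar:
  assumes "left_module A L" "a \<in> carrier A" "x \<in> carrier L"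
  shows "a \<odot>\<^bsub>L\<^esub> scalar A L c x = scalar A L c (a \<odot>\<^bsub>L\<^esub> x)"
  using assms
  by (simp add: scalar_def scalar_closed left_module.smult_closed scalar_central
      flip: left_module.smult_assoc)

lemma mod_hom_finsum:
  assumes "left_module A M" "left_module A L" "f \<in> mod_hom A M L" "finite I" "g \<in> I \<rightarrow> carrier M"
  shows "f (\<Oplus>\<^bsub>M\<^esub>i\<in>I. g i) = (\<Oplus>\<^bsub>L\<^esub>i\<in>I. f (g i))"
proof -
  interpret M: left_module A M by fact
  interpret L: left_module A L by fact
  note f = mod_homD[OF assms(3)]
  show ?thesis
    using assms(4,5)
  proof (induction I rule: finite_induct)
    case empty
    then show ?case using assms by (simp add: mod_hom_zero)
  next
    case (insert i I)
    then show ?case by (simp add: Pi_iff f)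
  qed
qed

lemma mod_hom_compose:
  assumes "f \<in> mod_hom A M L" "g \<in> mod_hom A L K" "left_module A M"
  shows "compose (carrier M) g f \<in> mod_hom A M K"
proof -
  interpret M: left_module A M by fact
  show ?thesis
    using mod_homD[OF assms(1)] mod_homD[OF assms(2)]
    by (intro mod_homI) (auto simp: compose_eq M.smult_closed)
qed

lemma mod_hom_pointwise_diff:
  assumes "left_module A M" "left_module A L" "f \<in> mod_hom A M L" "g \<in> mod_hom A M L"
  shows "(\<lambda>x\<in>carrier M. f x \<ominus>\<^bsub>L\<^esub> g x) \<in> mod_hom A M L"
proof -
  interpret M: left_module A M by fact
  interpret L: left_module A L by fact
  have 1: "(a \<oplus>\<^bsub>L\<^esub> b) \<ominus>\<^bsub>L\<^esub> (c \<oplus>\<^bsub>L\<^esub> d) = (a \<ominus>\<^bsub>L\<^esub> c) \<oplus>\<^bsub>L\<^esub> (b \<ominus>\<^bsub>L\<^esub> d)"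
    if "a \<in> carrier L" "b \<in> carrier L" "c \<in> carrier L" "d \<in> carrier L" for a b c d
    using that by (simp add: a_minus_def L.M.minus_add L.M.a_ac)
  show ?thesis
    using mod_homD[OF assms(3)] mod_homD[OF assms(4)]
    by (intro mod_homI) (auto simp: M.smult_closed L.smult_diff 1)
qed

lemma mod_hom_pointwise_finsum:
  assumes "left_module A M" "left_module A L" "finite I" "\<And>i. i \<in> I \<Longrightarrow> F i \<in> mod_hom A M L"
  shows "(\<lambda>x\<in>carrier M. \<Oplus>\<^bsub>L\<^esub>i\<in>I. F i x) \<in> mod_hom A M L"
proof -
  interpret M: left_module A M by fact
  interpret L: left_module A L by fact
  note F = mod_homD[OF assms(4)]
  have Fc: "(\<lambda>i. F i x) \<in> I \<rightarrow> carrier L" if "x \<in> carrier M" for x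
    using F that by auto
  show ?thesis
  proof (intro mod_homI)
    fix x y assume xy: "x \<in> carrier M" "y \<in> carrier M"
    have "(\<Oplus>\<^bsub>L\<^esub>i\<in>I. F i (x \<oplus>\<^bsub>M\<^esub> y)) = (\<Oplus>\<^bsub>L\<^esub>i\<in>I. F i x \<oplus>\<^bsub>L\<^esub> F i y)"
      using xy F by (intro L.M.finsum_cong') auto
    also have "\<dots> = (\<Oplus>\<^bsub>L\<^esub>i\<in>I. F i x) \<oplus>\<^bsub>L\<^esub> (\<Oplus>\<^bsub>L\<^esub>i\<in>I. F i y)"
      using xy Fc by (intro L.M.finsum_addf) auto
    finally show "(\<lambda>x\<in>carrier M. \<Oplus>\<^bsub>L\<^esub>i\<in>I. F i x) (x \<oplus>\<^bsub>M\<^esub> y) =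
      (\<lambda>x\<in>carrier M. \<Oplus>\<^bsub>L\<^esub>i\<in>I. F i x) x \<oplus>\<^bsub>L\<^esub> (\<lambda>x\<in>carrier M. \<Oplus>\<^bsub>L\<^esub>i\<in>I. F i x) y"
      using xy by simp
  next
    fix a x assume ax: "a \<in> carrier A" "x \<in> carrier M"
    have "(\<Oplus>\<^bsub>L\<^esub>i\<in>I. F i (a \<odot>\<^bsub>M\<^esub> x)) = (\<Oplus>\<^bsub>L\<^esub>i\<in>I. a \<odot>\<^bsub>L\<^esub> F i x)"
      using ax F by (intro L.M.finsum_cong') (auto simp: L.smult_closed)
    also have "\<dots> = a \<odot>\<^bsub>L\<^esub> (\<Oplus>\<^bsub>L\<^esub>i\<in>I. F i x)"
      using ax Fc assms(3) by (simp add: L.smult_finsum)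
    finally show "(\<lambda>x\<in>carrier M. \<Oplus>\<^bsub>L\<^esub>i\<in>I. F i x) (a \<odot>\<^bsub>M\<^esub> x) =
      a \<odot>\<^bsub>L\<^esub> (\<lambda>x\<in>carrier M. \<Oplus>\<^bsub>L\<^esub>i\<in>I. F i x) x"
      using ax by (simp add: M.smult_closed)
  qed (use Fc in auto)
qed

lemma mod_hom_zero_map:
  assumes "left_module A M" "left_module A L"
  shows "(\<lambda>x\<in>carrier M. \<zero>\<^bsub>L\<^esub>) \<in> mod_hom A M L"
proof -
  interpret M: left_module A M by fact
  interpret L: left_module A L by fact
  show ?thesis by (intro mod_homI) (auto simp: M.smult_closed L.smult_zero_right)
qed

lemma mod_hom_pointwise_add:
  assumes "left_module A M" "left_module A L" "f \<in> mod_hom A M L" "g \<in> mod_hom A M L"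
  shows "(\<lambda>x\<in>carrier M. f x \<oplus>\<^bsub>L\<^esub> g x) \<in> mod_hom A M L"
proof -
  interpret M: left_module A M by fact
  interpret L: left_module A L by fact
  show ?thesis
    using mod_homD[OF assms(3)] mod_homD[OF assms(4)]
    by (intro mod_homI) (auto simp: M.smult_closed L.smult_r_distr L.M.a_ac)
qed

lemma scalar_add_right:
  assumes "left_module A L" "x \<in> carrier L" "y \<in> carrier L"
  shows "scalar A L c (x \<oplus>\<^bsub>L\<^esub> y) = scalar A L c x \<oplus>\<^bsub>L\<^esub> scalar A L c y"
  using assms by (simp add: scalar_def scalar_closed left_module.smult_r_distr)

lemma scalar_zero_right:
  assumes "left_module A L" shows "scalar A L c \<zero>\<^bsub>L\<^esub> = \<zero>\<^bsub>L\<^esub>"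
  using assms by (simp add: scalar_def scalar_closed left_module.smult_zero_right)

lemma mod_hom_pointwise_scalar:
  assumes "left_module A M" "left_module A L" "f \<in> mod_hom A M L"
  shows "(\<lambda>x\<in>carrier M. scalar A L c (f x)) \<in> mod_hom A M L"
proof -
  interpret M: left_module A M by fact
  show ?thesis
    using mod_homD[OF assms(3)] assms
    by (intro mod_homI) (auto simp: M.smult_closed scalar_in scalar_add_right smult_scalar)
qed

text \<open>A map may collapse a spanning set. Coefficients of elements with the same image are
  added up, so that the sum can be indexed by the image set, as \<open>fd_module\<close>
  demands.\<close>

lemma span_image:
  assumes "left_module A M" "finite I" "h \<in> I \<rightarrow> carrier M"
  shows "\<exists>c'. (\<Oplus>\<^bsub>M\<^esub>i\<in>I. scalar A M (c i) (h i)) = (\<Oplus>\<^bsub>M\<^esub>s\<in>h ` I. scalar A M (c' s) s)"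
proof -
  interpret M: left_module A M by fact
  show ?thesis
  using assms(2,3)
proof (induction I rule: finite_induct)
  case empty
  then show ?case by simp
next
  case (insert i I)
  from insert obtain c' where c':
    "(\<Oplus>\<^bsub>M\<^esub>i\<in>I. scalar A M (c i) (h i)) = (\<Oplus>\<^bsub>M\<^esub>s\<in>h ` I. scalar A M (c' s) s)"
    by (auto simp: Pi_iff)
  have hc: "h i \<in> carrier M" "\<And>j. j \<in> I \<Longrightarrow> h j \<in> carrier M" using insert by auto
  have sc: "scalar A M b x \<in> carrier M" if "x \<in> carrier M" for b x
    using that assms(1) by (rule scalar_in[rotated])
  have sum: "(\<Oplus>\<^bsub>M\<^esub>j\<in>insert i I. scalar A M (c j) (h j)) =
      scalar A M (c i) (h i) \<oplus>\<^bsub>M\<^esub> (\<Oplus>\<^bsub>M\<^esub>s\<in>h ` I. scalar A M (c' s) s)"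
    using insert hc sc by (subst M.M.finsum_insert) (auto simp: c')
  show ?case
  proof (cases "h i \<in> h ` I")
    case False
    have "(\<Oplus>\<^bsub>M\<^esub>s\<in>h ` insert i I. scalar A M ((c'(h i := c i)) s) s) =
      scalar A M (c i) (h i) \<oplus>\<^bsub>M\<^esub> (\<Oplus>\<^bsub>M\<^esub>s\<in>h ` I. scalar A M ((c'(h i := c i)) s) s)"
      using False insert hc sc by (simp add: Pi_iff)
    also have "(\<Oplus>\<^bsub>M\<^esub>s\<in>h ` I. scalar A M ((c'(h i := c i)) s) s) = (\<Oplus>\<^bsub>M\<^esub>s\<in>h ` I. scalar A M (c' s) s)"
    proof (intro M.M.finsum_cong')
      fix s assume "s \<in> h ` I"
      with False have "s \<noteq> h i" by metis
      then show "scalar A M ((c'(h i := c i)) s) s = scalar A M (c' s) s" by simp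
    qed (use hc sc in auto)
    finally show ?thesis unfolding sum by metis
  next
    case True
    define J where "J = h ` I - {h i}"
    have hJ: "h ` insert i I = insert (h i) J" "h ` I = insert (h i) J" using True by (auto simp: J_def)
    have fin: "finite J" "h i \<notin> J" "\<And>s. s \<in> J \<Longrightarrow> s \<in> carrier M" using insert hc by (auto simp: J_def)
    have add: "scalar A M (b + b') x = scalar A M b x \<oplus>\<^bsub>M\<^esub> scalar A M b' x" if "x \<in> carrier M" for b b' x
      using that by (simp add: scalar_def scalar_add M.smult_l_distr scalar_closed)
    have "(\<Oplus>\<^bsub>M\<^esub>s\<in>insert (h i) J. scalar A M ((c'(h i := c i + c' (h i))) s) s) =
      scalar A M (c i + c' (h i)) (h i) \<oplus>\<^bsub>M\<^esub> (\<Oplus>\<^bsub>M\<^esub>s\<in>J. scalar A M ((c'(h i := c i + c' (h i))) s) s)"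
      using hc sc fin by (subst M.M.finsum_insert) auto
    also have "(\<Oplus>\<^bsub>M\<^esub>s\<in>J. scalar A M ((c'(h i := c i + c' (h i))) s) s) = (\<Oplus>\<^bsub>M\<^esub>s\<in>J. scalar A M (c' s) s)"
      using fin sc by (intro M.M.finsum_cong') auto
    also have "scalar A M (c i + c' (h i)) (h i) \<oplus>\<^bsub>M\<^esub> (\<Oplus>\<^bsub>M\<^esub>s\<in>J. scalar A M (c' s) s) =
      scalar A M (c i) (h i) \<oplus>\<^bsub>M\<^esub> (scalar A M (c' (h i)) (h i) \<oplus>\<^bsub>M\<^esub> (\<Oplus>\<^bsub>M\<^esub>s\<in>J. scalar A M (c' s) s))"
      using hc fin sc by (subst add) (auto intro!: M.M.a_assoc M.M.finsum_closed)
    also have "scalar A M (c' (h i)) (h i) \<oplus>\<^bsub>M\<^esub> (\<Oplus>\<^bsub>M\<^esub>s\<in>J. scalar A M (c' s) s) =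
      (\<Oplus>\<^bsub>M\<^esub>s\<in>h ` I. scalar A M (c' s) s)"
      using hc sc fin by (subst hJ(2), subst M.M.finsum_insert) auto
    finally show ?thesis unfolding sum hJ(1) by metis
  qed
qed
qed

text \<open>The target is only a record with compatible operations, not yet a module. This is how
  the module axioms are obtained for the cell sum, for images of homomorphisms and for copies on
  another type.\<close>

lemma left_module_image:
  fixes X :: "('a, 'b) module" and Y :: "('a, 'c) module"
  assumes "left_module A X" and im: "g ` carrier X = carrier Y"
    and add: "\<And>x y. x \<in> carrier X \<Longrightarrow> y \<in> carrier X \<Longrightarrow> g (x \<oplus>\<^bsub>X\<^esub> y) = g x \<oplus>\<^bsub>Y\<^esub> g y"
    and smult: "\<And>a x. a \<in> carrier A \<Longrightarrow> x \<in> carrier X \<Longrightarrow> g (a \<odot>\<^bsub>X\<^esub> x) = a \<odot>\<^bsub>Y\<^esub> g x"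
    and zero: "g \<zero>\<^bsub>X\<^esub> = \<zero>\<^bsub>Y\<^esub>"
  shows "left_module A Y"
proof -
  interpret X: left_module A X by fact
  have pre: "\<exists>x\<in>carrier X. y = g x" if "y \<in> carrier Y" for y using that im by auto
  have cl: "g x \<in> carrier Y" if "x \<in> carrier X" for x using that im by auto
  have ab: "abelian_group Y"
  proof (rule abelian_groupI)
    show "\<zero>\<^bsub>Y\<^esub> \<in> carrier Y" using cl[of "\<zero>\<^bsub>X\<^esub>"] zero by simp
  next
    fix x assume "x \<in> carrier Y"
    then obtain u where u: "u \<in> carrier X" "x = g u" using pre by blast
    show "\<zero>\<^bsub>Y\<^esub> \<oplus>\<^bsub>Y\<^esub> x = x" using add[of "\<zero>\<^bsub>X\<^esub>" u] u zero by simp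
    have "g (\<ominus>\<^bsub>X\<^esub> u) \<oplus>\<^bsub>Y\<^esub> x = \<zero>\<^bsub>Y\<^esub>" using add[of "\<ominus>\<^bsub>X\<^esub> u" u] u zero by (simp add: X.M.l_neg)
    then show "\<exists>y\<in>carrier Y. y \<oplus>\<^bsub>Y\<^esub> x = \<zero>\<^bsub>Y\<^esub>" using cl u by blast
  next
    fix x y assume "x \<in> carrier Y" "y \<in> carrier Y"
    then obtain u v where u: "u \<in> carrier X" "x = g u" "v \<in> carrier X" "y = g v" using pre by metis
    show "x \<oplus>\<^bsub>Y\<^esub> y \<in> carrier Y" using u cl by (simp flip: add)
    show "x \<oplus>\<^bsub>Y\<^esub> y = y \<oplus>\<^bsub>Y\<^esub> x" using u by (simp add: X.M.a_comm flip: add)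
    fix z assume "z \<in> carrier Y"
    then obtain t where t: "t \<in> carrier X" "z = g t" using pre by metis
    show "x \<oplus>\<^bsub>Y\<^esub> y \<oplus>\<^bsub>Y\<^esub> z = x \<oplus>\<^bsub>Y\<^esub> (y \<oplus>\<^bsub>Y\<^esub> z)"
      using u t by (simp add: X.M.a_assoc flip: add)
  qed
  show ?thesis
    unfolding left_module_def left_module_axioms_def
  proof (intro conjI allI impI)
    fix a b x y
    show "a \<odot>\<^bsub>Y\<^esub> x \<in> carrier Y" if "a \<in> carrier A" "x \<in> carrier Y"
      using that pre[of x] cl by (auto simp: X.smult_closed simp flip: smult)
    show "(a \<oplus> b) \<odot>\<^bsub>Y\<^esub> x = a \<odot>\<^bsub>Y\<^esub> x \<oplus>\<^bsub>Y\<^esub> b \<odot>\<^bsub>Y\<^esub> x"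
      if "a \<in> carrier A" "b \<in> carrier A" "x \<in> carrier Y"
      using that pre[of x] by (auto simp: X.smult_closed X.smult_l_distr simp flip: smult add)
    show "a \<odot>\<^bsub>Y\<^esub> (x \<oplus>\<^bsub>Y\<^esub> y) = a \<odot>\<^bsub>Y\<^esub> x \<oplus>\<^bsub>Y\<^esub> a \<odot>\<^bsub>Y\<^esub> y"
      if "a \<in> carrier A" "x \<in> carrier Y" "y \<in> carrier Y"
      using that pre[of x] pre[of y] by (auto simp: X.smult_closed X.smult_r_distr simp flip: smult add)
    show "(a \<otimes> b) \<odot>\<^bsub>Y\<^esub> x = a \<odot>\<^bsub>Y\<^esub> (b \<odot>\<^bsub>Y\<^esub> x)"
      if "a \<in> carrier A" "b \<in> carrier A" "x \<in> carrier Y"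
      using that pre[of x] by (auto simp: X.smult_closed X.smult_assoc simp flip: smult)
    show "\<one> \<odot>\<^bsub>Y\<^esub> x = x" if "x \<in> carrier Y"
      using that pre[of x] by (auto simp: X.smult_one simp flip: smult)
  qed (use ab ring_A in auto)
qed

lemma fd_module_image:
  fixes X :: "('a, 'b) module" and Y :: "('a, 'c) module"
  assumes fd: "fd_module A X" and im: "g ` carrier X = carrier Y"
    and add: "\<And>x y. x \<in> carrier X \<Longrightarrow> y \<in> carrier X \<Longrightarrow> g (x \<oplus>\<^bsub>X\<^esub> y) = g x \<oplus>\<^bsub>Y\<^esub> g y"
    and smult: "\<And>a x. a \<in> carrier A \<Longrightarrow> x \<in> carrier X \<Longrightarrow> g (a \<odot>\<^bsub>X\<^esub> x) = a \<odot>\<^bsub>Y\<^esub> g x"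
    and zero: "g \<zero>\<^bsub>X\<^esub> = \<zero>\<^bsub>Y\<^esub>"
  shows "fd_module A Y"
proof -
  have X: "left_module A X" using fd by (simp add: fd_module_def)
  have Y: "left_module A Y" by (rule left_module_image[OF X im add smult zero])
  interpret X: left_module A X by fact
  interpret Y: left_module A Y by fact
  obtain S where S: "finite S" "S \<subseteq> carrier X"
    "\<And>x. x \<in> carrier X \<Longrightarrow> \<exists>c. x = (\<Oplus>\<^bsub>X\<^esub>s\<in>S. scalar A X (c s) s)"
    using fd by (auto simp: fd_module_def)
  define g' where "g' = restrict g (carrier X)"
  have g': "g' \<in> mod_hom A X Y"
    using im add smult by (intro mod_homI) (auto simp: g'_def X.smult_closed)
  have "\<exists>c. y = (\<Oplus>\<^bsub>Y\<^esub>s\<in>g' ` S. scalar A Y (c s) s)" if yY: "y \<in> carrier Y" for y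
  proof -
    obtain x where x: "x \<in> carrier X" "y = g' x" using yY im by (auto simp: g'_def)
    obtain c where "x = (\<Oplus>\<^bsub>X\<^esub>s\<in>S. scalar A X (c s) s)" using S x by blast
    then have "y = (\<Oplus>\<^bsub>Y\<^esub>s\<in>S. g' (scalar A X (c s) s))"
      using S(1,2) x X by (auto simp: mod_hom_finsum[OF X Y g' S(1)] scalar_in Pi_iff subset_iff)
    also have "\<dots> = (\<Oplus>\<^bsub>Y\<^esub>s\<in>S. scalar A Y (c s) (g' s))"
      using S(2) Y mod_homD(1)[OF g'] mod_hom_scalar[OF g']
      by (intro Y.M.finsum_cong') (auto simp: scalar_in subset_iff)
    finally show ?thesis
      using span_image[OF Y S(1), of g' c] S(2) mod_homD(1)[OF g'] by (auto simp: subset_iff)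
  qed
  then show ?thesis
    unfolding fd_module_def
    using Y S(1,2) mod_homD(1)[OF g'] by (intro conjI exI[of _ "g' ` S"]) auto
qed

text \<open>Any injection into \<open>nat \<Rightarrow> complex\<close> transports the module structure; a choice of coefficient
  vectors with respect to a finite spanning set is injective without being linear.\<close>

lemma fd_module_copy:
  fixes X :: "('a, 'b) module"
  assumes "fd_module A X"
  obtains X' :: "('a, nat \<Rightarrow> complex) module" and \<iota> \<kappa>
  where "fd_module A X'" "\<iota> \<in> mod_hom A X X'" "\<kappa> \<in> mod_hom A X' X"
    "\<And>x. x \<in> carrier X \<Longrightarrow> \<kappa> (\<iota> x) = x" "\<And>x. x \<in> carrier X' \<Longrightarrow> \<iota> (\<kappa> x) = x"
proof -
  have X: "left_module A X" using assms by (simp add: fd_module_def)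
  interpret X: left_module A X by fact
  obtain S where S: "finite S" "S \<subseteq> carrier X"
    "\<And>x. x \<in> carrier X \<Longrightarrow> \<exists>c. x = (\<Oplus>\<^bsub>X\<^esub>s\<in>S. scalar A X (c s) s)"
    using assms by (auto simp: fd_module_def)
  then obtain c where c: "\<And>x. x \<in> carrier X \<Longrightarrow> x = (\<Oplus>\<^bsub>X\<^esub>s\<in>S. scalar A X (c x s) s)" by metis
  obtain en :: "'b \<Rightarrow> nat" where en: "inj_on en S"
    using finite_imp_inj_to_nat_seg[OF S(1)] by blast
  define \<psi> where "\<psi> = (\<lambda>x n. c x (inv_into S en n))"
  have inj: "inj_on \<psi> (carrier X)"
  proof (rule inj_onI)
    fix x y assume xy: "x \<in> carrier X" "y \<in> carrier X" "\<psi> x = \<psi> y"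
    have "c x s = c y s" if "s \<in> S" for s
      using fun_cong[OF xy(3), of "en s"] that en by (simp add: \<psi>_def)
    then have "(\<Oplus>\<^bsub>X\<^esub>s\<in>S. scalar A X (c x s) s) = (\<Oplus>\<^bsub>X\<^esub>s\<in>S. scalar A X (c y s) s)"
      using S(2) X by (intro X.M.finsum_cong') (auto simp: scalar_in subset_iff)
    then show "x = y" using c xy by metis
  qed
  define \<kappa>0 where "\<kappa>0 = inv_into (carrier X) \<psi>"
  have k: "\<kappa>0 (\<psi> x) = x" if "x \<in> carrier X" for x
    using that inj by (simp add: \<kappa>0_def)
  define X' :: "('a, nat \<Rightarrow> complex) module" where
    "X' = \<lparr>carrier = \<psi> ` carrier X, mult = undefined, one = undefined, zero = \<psi> \<zero>\<^bsub>X\<^esub>,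
      add = (\<lambda>x y. \<psi> (\<kappa>0 x \<oplus>\<^bsub>X\<^esub> \<kappa>0 y)), smult = (\<lambda>a x. \<psi> (a \<odot>\<^bsub>X\<^esub> \<kappa>0 x))\<rparr>"
  show ?thesis
  proof
    show "fd_module A X'"
      by (rule fd_module_image[OF assms, of \<psi>]) (auto simp: X'_def k)
    show "restrict \<psi> (carrier X) \<in> mod_hom A X X'"
      by (intro mod_homI) (auto simp: X'_def k X.smult_closed)
    show "restrict \<kappa>0 (carrier X') \<in> mod_hom A X' X"
      by (intro mod_homI) (auto simp: X'_def k X.smult_closed dest: inj_onD[OF inj])
  qed (auto simp: X'_def k)
qed

text \<open>The definition of projectivity speaks of surjections between modules on one fixed type.
  The target is therefore cut down to the image of \<open>g\<close>, and both modules are replaced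
  by copies on that type.\<close>

lemma projective_lift:
  assumes P: "fd_projective A P" and X: "fd_module A X" and Y: "left_module A Y"
    and g: "g \<in> mod_hom A X Y" and f: "f \<in> mod_hom A P Y" and im: "f ` carrier P \<subseteq> g ` carrier X"
  obtains h where "h \<in> mod_hom A P X" "\<And>x. x \<in> carrier P \<Longrightarrow> g (h x) = f x"
proof -
  have X': "left_module A X" and P': "left_module A P"
    using P X by (auto simp: fd_module_def fd_projective_def)
  define Z where "Z = Y\<lparr>carrier := g ` carrier X\<rparr>"
  have gZ: "g \<in> mod_hom A X Z" and fZ: "f \<in> mod_hom A P Z"
    using g f im by (auto simp: Z_def intro!: mod_hom_restrict_carrier)
  have Z: "fd_module A Z"
    by (rule fd_module_image[OF X, of g]) (use mod_homD[OF g] mod_hom_zero[OF X' Y g] in \<open>auto simp: Z_def\<close>)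
  then have Z': "left_module A Z" by (simp add: fd_module_def)
  obtain X1 :: "('a, nat \<Rightarrow> complex) module" and \<iota>X \<kappa>X where X1: "fd_module A X1" "\<iota>X \<in> mod_hom A X X1" "\<kappa>X \<in> mod_hom A X1 X"
    "\<And>x. x \<in> carrier X \<Longrightarrow> \<kappa>X (\<iota>X x) = x" "\<And>x. x \<in> carrier X1 \<Longrightarrow> \<iota>X (\<kappa>X x) = x"
    by (rule fd_module_copy[OF X]) (rule that)
  obtain Z1 :: "('a, nat \<Rightarrow> complex) module" and \<iota>Z \<kappa>Z where Z1: "fd_module A Z1" "\<iota>Z \<in> mod_hom A Z Z1" "\<kappa>Z \<in> mod_hom A Z1 Z"
    "\<And>x. x \<in> carrier Z \<Longrightarrow> \<kappa>Z (\<iota>Z x) = x" "\<And>x. x \<in> carrier Z1 \<Longrightarrow> \<iota>Z (\<kappa>Z x) = x"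
    by (rule fd_module_copy[OF Z]) (rule that)
  have X1': "left_module A X1" using X1 by (simp add: fd_module_def)
  define g1 where "g1 = compose (carrier X1) \<iota>Z (compose (carrier X1) g \<kappa>X)"
  define f1 where "f1 = compose (carrier P) \<iota>Z f"
  have g1: "g1 \<in> mod_hom A X1 Z1"
    unfolding g1_def by (intro mod_hom_compose[OF mod_hom_compose[OF X1(3) gZ X1'] Z1(2) X1'])
  have f1: "f1 \<in> mod_hom A P Z1"
    unfolding f1_def by (intro mod_hom_compose[OF fZ Z1(2) P'])
  have "g1 ` carrier X1 = carrier Z1"
  proof (intro equalityI subsetI)
    fix z assume z: "z \<in> carrier Z1"
    then have "\<kappa>Z z \<in> carrier Z" using mod_homD(1)[OF Z1(3)] by blast
    then obtain x where x: "x \<in> carrier X" "\<kappa>Z z = g x" by (auto simp: Z_def)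
    then have "z = g1 (\<iota>X x)"
      using z X1(4)[OF x(1)] Z1(5)[OF z] mod_homD(1)[OF X1(2) x(1)] by (simp add: g1_def compose_eq)
    then show "z \<in> g1 ` carrier X1" using x mod_homD(1)[OF X1(2)] by blast
  qed (use mod_homD(1)[OF g1] in auto)
  then obtain h1 where h1: "h1 \<in> mod_hom A P X1" "\<And>x. x \<in> carrier P \<Longrightarrow> g1 (h1 x) = f1 x"
    using P X1(1) Z1(1) g1 f1 unfolding fd_projective_def by blast
  show ?thesis
  proof
    show "compose (carrier P) \<kappa>X h1 \<in> mod_hom A P X"
      by (intro mod_hom_compose[OF h1(1) X1(3) P'])
    fix x assume x: "x \<in> carrier P"
    have h1x: "h1 x \<in> carrier X1" using x mod_homD(1)[OF h1(1)] by blast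
    have "\<iota>Z (g (\<kappa>X (h1 x))) = \<iota>Z (f x)"
      using h1(2)[OF x] x h1x by (simp add: g1_def f1_def compose_eq)
    then have "\<kappa>Z (\<iota>Z (g (\<kappa>X (h1 x)))) = \<kappa>Z (\<iota>Z (f x))" by simp
    then have "g (\<kappa>X (h1 x)) = f x"
      using Z1(4) x h1x mod_homD(1)[OF fZ] mod_homD(1)[OF gZ] mod_homD(1)[OF X1(3)] by simp
    then show "g (compose (carrier P) \<kappa>X h1 x) = f x" using x by (simp add: compose_eq)
  qed
qed

end

text \<open>Both algebras of the theorem are built from quotients by the joint kernel of complex
  coordinates. Here all operations of \<open>quot\<close> become pointwise operations on
  coordinates. The assumption \<open>diff\<close> provides differences without asking for group
  axioms.\<close>

locale coordinatized_quotient =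
  fixes V :: "(complex, 'v) module" (structure) and I :: "'v set" and \<theta> :: "'v \<Rightarrow> 'k \<Rightarrow> complex"
  assumes nonempty: "carrier V \<noteq> {}"
    and add_closed: "x \<in> carrier V \<Longrightarrow> y \<in> carrier V \<Longrightarrow> x \<oplus> y \<in> carrier V"
    and diff: "x \<in> carrier V \<Longrightarrow> y \<in> carrier V \<Longrightarrow> \<exists>b\<in>carrier V. x = b \<oplus> y"
    and smult_closed: "x \<in> carrier V \<Longrightarrow> c \<odot> x \<in> carrier V"
    and \<theta>_add: "x \<in> carrier V \<Longrightarrow> y \<in> carrier V \<Longrightarrow> \<theta> (x \<oplus> y) k = \<theta> x k + \<theta> y k"
    and \<theta>_smult: "x \<in> carrier V \<Longrightarrow> \<theta> (c \<odot> x) k = c * \<theta> x k"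
    and kernel: "I = {x \<in> carrier V. \<forall>k. \<theta> x k = 0}"
begin

lemma coset_eq:
  assumes "x \<in> carrier V"
  shows "I +> x = {y \<in> carrier V. \<theta> y = \<theta> x}"
proof (intro equalityI subsetI)
  fix y assume "y \<in> I +> x"
  then show "y \<in> {y \<in> carrier V. \<theta> y = \<theta> x}"
    using assms by (auto simp: a_r_coset_def' kernel add_closed \<theta>_add fun_eq_iff)
next
  fix y assume y: "y \<in> {y \<in> carrier V. \<theta> y = \<theta> x}"
  then obtain b where b: "b \<in> carrier V" "y = b \<oplus> x" using assms diff by blast
  have "\<theta> b k = 0" for k using \<theta>_add[OF b(1) assms, of k] y b by simp
  then show "y \<in> I +> x" using b by (auto simp: a_r_coset_def' kernel)
qed

lemma coset_self: "x \<in> carrier V \<Longrightarrow> x \<in> I +> x"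
  by (simp add: coset_eq)

definition coord :: "'v set \<Rightarrow> 'k \<Rightarrow> complex" where
  "coord X = \<theta> (SOME x. x \<in> X)"

lemma coord_coset: "x \<in> carrier V \<Longrightarrow> coord (I +> x) = \<theta> x"
proof -
  assume x: "x \<in> carrier V"
  have "(SOME y. y \<in> I +> x) \<in> I +> x" by (rule someI[where P = "\<lambda>y. y \<in> I +> x", OF coset_self[OF x]])
  then have "(SOME y. y \<in> I +> x) \<in> {y \<in> carrier V. \<theta> y = \<theta> x}" by (simp only: coset_eq[OF x])
  then show ?thesis by (simp add: coord_def)
qed

lemma carrier_quot: "carrier (quot V I) = (\<lambda>x. I +> x) ` carrier V"
  by (auto simp: quot_def FactRing_def A_RCOSETS_def')

lemma coset_in_quot: "x \<in> carrier V \<Longrightarrow> I +> x \<in> carrier (quot V I)"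
  by (simp add: carrier_quot)

lemma coord_inj: "X \<in> carrier (quot V I) \<Longrightarrow> Y \<in> carrier (quot V I) \<Longrightarrow> coord X = coord Y \<Longrightarrow> X = Y"
proof -
  assume "X \<in> carrier (quot V I)" "Y \<in> carrier (quot V I)" and eq: "coord X = coord Y"
  then obtain x y where "x \<in> carrier V" "X = I +> x" "y \<in> carrier V" "Y = I +> y"
    by (auto simp: carrier_quot)
  then show "X = Y" using eq by (simp add: coord_coset) (simp add: coset_eq)
qed

lemma coset_cong: "x \<in> carrier V \<Longrightarrow> y \<in> carrier V \<Longrightarrow> \<theta> x = \<theta> y \<Longrightarrow> I +> x = I +> y"
  by (simp add: coset_eq)

lemma exists_zero: "\<exists>z\<in>carrier V. \<theta> z = (\<lambda>k. 0)"
proof -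
  obtain x where x: "x \<in> carrier V" using nonempty by auto
  then obtain z where z: "z \<in> carrier V" "x = z \<oplus> x" using diff by blast
  then have "\<theta> z k = 0" for k using \<theta>_add[OF z(1) x, of k] by simp
  then show ?thesis using z by blast
qed

text \<open>The zero of \<open>quot\<close> is the set \<open>I\<close> itself, which first has to
  be recognised as the coset of an element with zero coordinates.\<close>

lemma zero_quot: "\<zero>\<^bsub>quot V I\<^esub> \<in> carrier (quot V I)" "coord \<zero>\<^bsub>quot V I\<^esub> = (\<lambda>k. 0)"
proof -
  obtain z where z: "z \<in> carrier V" "\<theta> z = (\<lambda>k. 0)" using exists_zero by blast
  have "\<zero>\<^bsub>quot V I\<^esub> = I +> z"
    using coset_eq[OF z(1)] z(2) by (simp add: quot_def FactRing_def fun_eq_iff flip: kernel)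
  then show "\<zero>\<^bsub>quot V I\<^esub> \<in> carrier (quot V I)" "coord \<zero>\<^bsub>quot V I\<^esub> = (\<lambda>k. 0)"
    using z by (auto simp: coset_in_quot coord_coset)
qed

lemma coset_add:
  assumes "x \<in> carrier V" "y \<in> carrier V"
  shows "(I +> x) \<oplus>\<^bsub>quot V I\<^esub> (I +> y) = I +> (x \<oplus> y)"
proof -
  have "AbelCoset.set_add V (I +> x) (I +> y) = I +> (x \<oplus> y)"
  proof (intro equalityI subsetI)
    fix z assume "z \<in> AbelCoset.set_add V (I +> x) (I +> y)"
    then obtain a b where "a \<in> I +> x" "b \<in> I +> y" "z = a \<oplus> b"
      by (auto simp: set_add_def')
    then have ab: "a \<in> carrier V" "\<theta> a = \<theta> x" "b \<in> carrier V" "\<theta> b = \<theta> y" "z = a \<oplus> b"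
      unfolding coset_eq[OF assms(1)] coset_eq[OF assms(2)] by auto
    then have "\<theta> z = \<theta> (x \<oplus> y)" using assms by (intro ext) (simp add: \<theta>_add)
    then show "z \<in> I +> (x \<oplus> y)"
      using ab assms by (simp add: coset_eq add_closed)
  next
    fix z assume z: "z \<in> I +> (x \<oplus> y)"
    then obtain b where b: "b \<in> carrier V" "z = b \<oplus> y"
      using assms diff[of z y] by (auto simp: coset_eq add_closed)
    have "\<theta> b k = \<theta> x k" for k
      using z b assms \<theta>_add[OF b(1) assms(2), of k] by (simp add: coset_eq add_closed \<theta>_add)
    then have "b \<in> I +> x" "y \<in> I +> y" using b assms by (simp_all add: coset_eq fun_eq_iff)
    then show "z \<in> AbelCoset.set_add V (I +> x) (I +> y)"
      using b by (auto simp: set_add_def')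
  qed
  then show ?thesis by (simp add: quot_def FactRing_def)
qed

lemma coset_smult:
  assumes "x \<in> carrier V"
  shows "c \<odot>\<^bsub>quot V I\<^esub> (I +> x) = I +> (c \<odot> x)"
proof -
  have "I +> (c \<odot> y) = I +> (c \<odot> x)" if "y \<in> I +> x" for y
    using that assms by (intro coset_cong) (auto simp: coset_eq smult_closed \<theta>_smult fun_eq_iff)
  then have "(\<Union>y\<in>I +> x. I +> (c \<odot> y)) = I +> (c \<odot> x)"
    using coset_self[OF assms] by (intro UN_constant_eq) blast+
  then show ?thesis by (simp add: quot_def)
qed

lemma add_quot:
  assumes "X \<in> carrier (quot V I)" "Y \<in> carrier (quot V I)"
  shows "X \<oplus>\<^bsub>quot V I\<^esub> Y \<in> carrier (quot V I)"
    and "coord (X \<oplus>\<^bsub>quot V I\<^esub> Y) = (\<lambda>k. coord X k + coord Y k)"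
  using assms by (auto simp: carrier_quot coset_add coord_coset add_closed \<theta>_add fun_eq_iff)

lemma smult_quot:
  assumes "X \<in> carrier (quot V I)"
  shows "c \<odot>\<^bsub>quot V I\<^esub> X \<in> carrier (quot V I)"
    and "coord (c \<odot>\<^bsub>quot V I\<^esub> X) = (\<lambda>k. c * coord X k)"
  using assms by (auto simp: carrier_quot coset_smult coord_coset smult_closed \<theta>_smult fun_eq_iff)

text \<open>The structure that \<open>finsum\<close> requires in the components of the Ext
  product.\<close>

lemma abelian_monoid_quot: "abelian_monoid (quot V I)"
proof (rule abelian_monoidI)
  fix X Y Z
  assume X: "X \<in> carrier (quot V I)"
  show "\<zero>\<^bsub>quot V I\<^esub> \<oplus>\<^bsub>quot V I\<^esub> X = X"
    by (rule coord_inj) (simp_all add: X add_quot zero_quot)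
  assume Y: "Y \<in> carrier (quot V I)"
  show "X \<oplus>\<^bsub>quot V I\<^esub> Y \<in> carrier (quot V I)" by (rule add_quot[OF X Y])
  show "X \<oplus>\<^bsub>quot V I\<^esub> Y = Y \<oplus>\<^bsub>quot V I\<^esub> X"
    by (rule coord_inj) (simp_all add: X Y add_quot add_ac)
  assume Z: "Z \<in> carrier (quot V I)"
  show "X \<oplus>\<^bsub>quot V I\<^esub> Y \<oplus>\<^bsub>quot V I\<^esub> Z = X \<oplus>\<^bsub>quot V I\<^esub> (Y \<oplus>\<^bsub>quot V I\<^esub> Z)"
    by (rule coord_inj) (simp_all add: X Y Z add_quot add_ac)
qed (simp add: zero_quot)

lemma finsum_quot:
  assumes "finite J" "X \<in> J \<rightarrow> carrier (quot V I)"
  shows "(\<Oplus>\<^bsub>quot V I\<^esub>j\<in>J. X j) \<in> carrier (quot V I)"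
    and "coord (\<Oplus>\<^bsub>quot V I\<^esub>j\<in>J. X j) = (\<lambda>k. \<Sum>j\<in>J. coord (X j) k)"
proof -
  interpret Q: abelian_monoid "quot V I" by (rule abelian_monoid_quot)
  show "(\<Oplus>\<^bsub>quot V I\<^esub>j\<in>J. X j) \<in> carrier (quot V I)" using assms by simp
  show "coord (\<Oplus>\<^bsub>quot V I\<^esub>j\<in>J. X j) = (\<lambda>k. \<Sum>j\<in>J. coord (X j) k)"
    using assms
  proof (induction J rule: finite_induct)
    case empty
    then show ?case by (simp add: zero_quot)
  next
    case (insert j J)
    then show ?case by (simp add: Pi_iff add_quot fun_eq_iff)
  qed
qed

end

section \<open>Projective resolutions: chain lifts, homotopies and cocycles\<close>

locale resolution = complex_algebra A for A :: "(complex, 'a) module" (structure) +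
  fixes M :: "('a, 'm) module" and P :: "nat \<Rightarrow> ('a, 'b) module" and d :: "nat \<Rightarrow> 'b \<Rightarrow> 'b"
    and \<epsilon> :: "'b \<Rightarrow> 'm"
  assumes resolution: "projective_resolution A M P d \<epsilon>" and M_fd: "fd_module A M"
begin

lemma P_projective: "fd_projective A (P n)"
  using resolution by (simp add: projective_resolution_def)

lemma P_fd: "fd_module A (P n)"
  using P_projective by (simp add: fd_projective_def)

lemma P_module: "left_module A (P n)"
  using P_fd by (simp add: fd_module_def)

lemma M_module: "left_module A M"
  using M_fd by (simp add: fd_module_def)

sublocale M: left_module A M by (rule M_module)

lemma d_hom: "d n \<in> mod_hom A (P (Suc n)) (P n)"
  using resolution by (simp add: projective_resolution_def)

lemma \<epsilon>_hom: "\<epsilon> \<in> mod_hom A (P 0) M"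
  using resolution by (simp add: projective_resolution_def)

lemma \<epsilon>_surj: "\<epsilon> ` carrier (P 0) = carrier M"
  using resolution by (simp add: projective_resolution_def)

lemmas d_closed = mod_homD(1)[OF d_hom]
lemmas \<epsilon>_closed = mod_homD(1)[OF \<epsilon>_hom]

lemma exact_0: "x \<in> carrier (P 0) \<Longrightarrow> \<epsilon> x = \<zero>\<^bsub>M\<^esub> \<longleftrightarrow> x \<in> d 0 ` carrier (P (Suc 0))"
  using resolution by (auto simp: projective_resolution_def a_kernel_def')

lemma exact_Suc:
  "x \<in> carrier (P (Suc n)) \<Longrightarrow> d n x = \<zero>\<^bsub>P n\<^esub> \<longleftrightarrow> x \<in> d (Suc n) ` carrier (P (Suc (Suc n)))"
proof -
  assume x: "x \<in> carrier (P (Suc n))"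
  have "a_kernel (P (Suc n)) (P n) (d n) = d (Suc n) ` carrier (P (Suc (Suc n)))"
    using resolution by (simp add: projective_resolution_def)
  then show ?thesis using x by (auto simp: a_kernel_def')
qed

lemma \<epsilon>_d: "x \<in> carrier (P (Suc 0)) \<Longrightarrow> \<epsilon> (d 0 x) = \<zero>\<^bsub>M\<^esub>"
  using exact_0 d_closed by blast

lemma d_d: "x \<in> carrier (P (Suc (Suc n))) \<Longrightarrow> d n (d (Suc n) x) = \<zero>\<^bsub>P n\<^esub>"
  using exact_Suc d_closed by blast

lemma hom_P_zero: "f \<in> mod_hom A (P n) L \<Longrightarrow> left_module A L \<Longrightarrow> f \<zero>\<^bsub>P n\<^esub> = \<zero>\<^bsub>L\<^esub>"
  by (rule mod_hom_zero[OF P_module])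

lemma lift_through_d:
  assumes "f \<in> mod_hom A (P m) (P n)" "\<And>x. x \<in> carrier (P m) \<Longrightarrow> f x \<in> d n ` carrier (P (Suc n))"
  shows "\<exists>h\<in>mod_hom A (P m) (P (Suc n)). \<forall>x\<in>carrier (P m). d n (h x) = f x"
proof -
  have im: "f ` carrier (P m) \<subseteq> d n ` carrier (P (Suc n))" using assms(2) by auto
  obtain h where "h \<in> mod_hom A (P m) (P (Suc n))" "\<And>x. x \<in> carrier (P m) \<Longrightarrow> d n (h x) = f x"
    by (rule projective_lift[OF P_projective P_fd P_module d_hom assms(1) im]) (rule that)
  then show ?thesis by auto
qed

lemma chain_lift_exists:
  assumes f: "f \<in> mod_hom A (P i) M" "\<And>x. x \<in> carrier (P (Suc i)) \<Longrightarrow> f (d i x) = \<zero>\<^bsub>M\<^esub>"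
  shows "\<exists>\<phi>. \<phi> \<in> chain_lifts A P d \<epsilon> i f"
proof -
  \<comment> \<open>The last clause says that the next lifting problem is solvable, which turns the
    construction into a dependent choice.\<close>
  define R where "R = (\<lambda>k \<phi>. \<phi> \<in> mod_hom A (P (i + k)) (P k) \<and>
    (k = 0 \<longrightarrow> (\<forall>x\<in>carrier (P i). \<epsilon> (\<phi> x) = f x)) \<and>
    (\<forall>x\<in>carrier (P (Suc (i + k))). \<phi> (d (i + k) x) \<in> d k ` carrier (P (Suc k))))"
  define Q where "Q = (\<lambda>k \<phi> \<phi>'. \<forall>x\<in>carrier (P (Suc (i + k))). d k (\<phi>' x) = \<phi> (d (i + k) x))"
  have base: "\<exists>\<phi>. R 0 \<phi>"
  proof -
    have im: "f ` carrier (P i) \<subseteq> \<epsilon> ` carrier (P 0)" using mod_homD(1)[OF f(1)] by (auto simp: \<epsilon>_surj)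
    obtain h where h: "h \<in> mod_hom A (P i) (P 0)" "\<And>x. x \<in> carrier (P i) \<Longrightarrow> \<epsilon> (h x) = f x"
      by (rule projective_lift[OF P_projective P_fd M_module \<epsilon>_hom f(1) im]) (rule that)
    have "h (d i x) \<in> d 0 ` carrier (P (Suc 0))" if x: "x \<in> carrier (P (Suc i))" for x
      using exact_0[OF mod_homD(1)[OF h(1) d_closed[OF x]]] h(2)[OF d_closed[OF x]] f(2)[OF x] by simp
    then have R0: "R 0 h" using h by (simp add: R_def)
    then show ?thesis by blast
  qed
  have step: "\<exists>\<phi>'. R (Suc k) \<phi>' \<and> Q k \<phi> \<phi>'" if R: "R k \<phi>" for k \<phi>
  proof -
    have hom: "compose (carrier (P (Suc (i + k)))) \<phi> (d (i + k)) \<in> mod_hom A (P (Suc (i + k))) (P k)"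
      using R by (intro mod_hom_compose[OF d_hom _ P_module]) (simp add: R_def)
    then obtain \<phi>' where p: "\<phi>' \<in> mod_hom A (P (Suc (i + k))) (P (Suc k))"
      "\<forall>x\<in>carrier (P (Suc (i + k))). d k (\<phi>' x) = compose (carrier (P (Suc (i + k)))) \<phi> (d (i + k)) x"
      using lift_through_d[OF hom] R by (auto simp: R_def compose_eq)
    have "\<phi>' (d (Suc (i + k)) x) \<in> d (Suc k) ` carrier (P (Suc (Suc k)))"
      if x: "x \<in> carrier (P (Suc (Suc (i + k))))" for x
    proof -
      have "d k (\<phi>' (d (Suc (i + k)) x)) = \<phi> (d (i + k) (d (Suc (i + k)) x))"
        using p(2) x d_closed[OF x] by (simp add: compose_eq)
      also have "\<dots> = \<zero>\<^bsub>P k\<^esub>"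
        using R x by (simp add: d_d R_def hom_P_zero P_module)
      finally show ?thesis
        using exact_Suc x d_closed mod_homD(1)[OF p(1)] by blast
    qed
    then have "R (Suc k) \<phi>'" using p(1) by (simp add: R_def)
    then show ?thesis using p(2) by (auto simp: Q_def compose_eq)
  qed
  obtain \<phi> where "\<forall>k. R k (\<phi> k) \<and> Q k (\<phi> k) (\<phi> (Suc k))"
    using dependent_nat_choice[of R Q, OF base step] by blast
  then have "\<phi> \<in> chain_lifts A P d \<epsilon> i f"
    by (simp add: chain_lifts_def R_def Q_def)
  then show ?thesis by blast
qed

text \<open>The uniqueness half of the comparison theorem, for a chain map covering zero: in each
  degree the homotopy lifts what the previous one leaves over.\<close>

lemma null_homotopic:
  assumes \<phi>: "\<And>k. \<phi> k \<in> mod_hom A (P k) (P k)"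
    and aug: "\<And>x. x \<in> carrier (P 0) \<Longrightarrow> \<epsilon> (\<phi> 0 x) = \<zero>\<^bsub>M\<^esub>"
    and chain: "\<And>k x. x \<in> carrier (P (Suc k)) \<Longrightarrow> d k (\<phi> (Suc k) x) = \<phi> k (d k x)"
  shows "\<exists>h. (\<forall>k. h k \<in> mod_hom A (P k) (P (Suc k))) \<and>
    (\<forall>x\<in>carrier (P 0). \<phi> 0 x = d 0 (h 0 x)) \<and>
    (\<forall>k. \<forall>x\<in>carrier (P (Suc k)). \<phi> (Suc k) x = d (Suc k) (h (Suc k) x) \<oplus>\<^bsub>P (Suc k)\<^esub> h k (d k x))"
proof -
  define R where "R = (\<lambda>k h. h \<in> mod_hom A (P k) (P (Suc k)) \<and>
    (k = 0 \<longrightarrow> (\<forall>x\<in>carrier (P 0). \<phi> 0 x = d 0 (h x))) \<and>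
    (\<forall>x\<in>carrier (P (Suc k)). d k (h (d k x)) = \<phi> k (d k x)))"
  define Q where "Q = (\<lambda>k h h'. \<forall>x\<in>carrier (P (Suc k)).
    \<phi> (Suc k) x = d (Suc k) (h' x) \<oplus>\<^bsub>P (Suc k)\<^esub> h (d k x))"
  note \<phi>_closed = mod_homD(1)[OF \<phi>]
  have base: "\<exists>h. R 0 h"
  proof -
    have "\<phi> 0 x \<in> d 0 ` carrier (P (Suc 0))" if "x \<in> carrier (P 0)" for x
      using exact_0[OF \<phi>_closed[OF that]] aug[OF that] by simp
    then obtain h where h: "h \<in> mod_hom A (P 0) (P (Suc 0))" "\<forall>x\<in>carrier (P 0). d 0 (h x) = \<phi> 0 x"
      using lift_through_d[OF \<phi>] by blast
    then have R0: "R 0 h" by (auto simp: R_def d_closed)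
    then show ?thesis by blast
  qed
  have step: "\<exists>h'. R (Suc k) h' \<and> Q k h h'" if R: "R k h" for k h
  proof -
    interpret P0: left_module A "P k" by (rule P_module)
    interpret P1: left_module A "P (Suc k)" by (rule P_module)
    have h: "h \<in> mod_hom A (P k) (P (Suc k))" "\<forall>x\<in>carrier (P (Suc k)). d k (h (d k x)) = \<phi> k (d k x)"
      using R by (auto simp: R_def)
    note h_closed = mod_homD(1)[OF h(1)]
    \<comment> \<open>The part of \<open>\<phi> (Suc k)\<close> not yet accounted for by
      \<open>h\<close>. The last clause of the invariant makes \<open>d k\<close> kill it, so it
      lifts through the next differential.\<close>
    define g where "g = (\<lambda>x\<in>carrier (P (Suc k)). \<phi> (Suc k) x \<ominus>\<^bsub>P (Suc k)\<^esub>
      compose (carrier (P (Suc k))) h (d k) x)"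
    have g: "g \<in> mod_hom A (P (Suc k)) (P (Suc k))"
      unfolding g_def
      by (rule mod_hom_pointwise_diff[OF P_module P_module \<phi> mod_hom_compose[OF d_hom h(1) P_module]])
    have g_eq: "g x = \<phi> (Suc k) x \<ominus>\<^bsub>P (Suc k)\<^esub> h (d k x)" if "x \<in> carrier (P (Suc k))" for x
      using that by (simp add: g_def compose_eq)
    have "d k (g x) = \<zero>\<^bsub>P k\<^esub>" if x: "x \<in> carrier (P (Suc k))" for x
    proof -
      have "d k (g x) = d k (\<phi> (Suc k) x) \<ominus>\<^bsub>P k\<^esub> d k (h (d k x))"
        using x by (simp add: g_eq mod_hom_diff[OF P_module P_module d_hom] \<phi>_closed h_closed d_closed)
      also have "\<dots> = \<zero>\<^bsub>P k\<^esub>"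
        using x h(2) chain[OF x] \<phi>_closed[OF d_closed[OF x]] by (simp add: P0.M.r_neg a_minus_def)
      finally show ?thesis .
    qed
    then have "g x \<in> d (Suc k) ` carrier (P (Suc (Suc k)))" if "x \<in> carrier (P (Suc k))" for x
      using exact_Suc[OF mod_homD(1)[OF g that]] that by simp
    then obtain h' where h': "h' \<in> mod_hom A (P (Suc k)) (P (Suc (Suc k)))"
      "\<forall>x\<in>carrier (P (Suc k)). d (Suc k) (h' x) = g x"
      using lift_through_d[OF g] by blast
    have "Q k h h'"
      using h'(2) \<phi>_closed h_closed d_closed
      by (auto simp: Q_def g_eq a_minus_def P1.M.a_assoc P1.M.l_neg)
    moreover have "R (Suc k) h'"
    proof -
      have "d (Suc k) (h' (d (Suc k) x)) = \<phi> (Suc k) (d (Suc k) x)"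
        if x: "x \<in> carrier (P (Suc (Suc k)))" for x
      proof -
        note y = d_closed[OF x]
        have "d (Suc k) (h' (d (Suc k) x)) = g (d (Suc k) x)" using h'(2) y by blast
        also have "\<dots> = \<phi> (Suc k) (d (Suc k) x) \<ominus>\<^bsub>P (Suc k)\<^esub> h (d k (d (Suc k) x))"
          by (rule g_eq[OF y])
        also have "h (d k (d (Suc k) x)) = \<zero>\<^bsub>P (Suc k)\<^esub>"
          unfolding d_d[OF x] by (rule hom_P_zero[OF h(1) P_module])
        finally show ?thesis using \<phi>_closed[OF y] by (simp add: a_minus_def)
      qed
      then show ?thesis using h'(1) by (simp add: R_def)
    qed
    ultimately show ?thesis by blast
  qed
  obtain h where h: "\<forall>k. R k (h k) \<and> Q k (h k) (h (Suc k))"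
    using dependent_nat_choice[of R Q, OF base step] by blast
  then show ?thesis by (intro exI[of _ h]) (auto simp: R_def Q_def)
qed

abbreviation "C n \<equiv> cocycles A P d M n"
abbreviation "B n \<equiv> coboundaries A P d M n"

lemma carrier_C: "f \<in> carrier (C n) \<longleftrightarrow> f \<in> mod_hom A (P n) M \<and>
    (\<forall>x\<in>carrier (P (Suc n)). f (d n x) = \<zero>\<^bsub>M\<^esub>)"
  by (simp add: cocycles_def)

lemma add_C: "f \<oplus>\<^bsub>C n\<^esub> g = (\<lambda>x\<in>carrier (P n). f x \<oplus>\<^bsub>M\<^esub> g x)"
  by (simp add: cocycles_def)

lemma smult_C: "c \<odot>\<^bsub>C n\<^esub> f = (\<lambda>x\<in>carrier (P n). scalar A M c (f x))"
  by (simp add: cocycles_def)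

lemma C_add_closed:
  assumes "f \<in> carrier (C n)" "g \<in> carrier (C n)"
  shows "f \<oplus>\<^bsub>C n\<^esub> g \<in> carrier (C n)"
proof -
  have "f \<in> mod_hom A (P n) M" "g \<in> mod_hom A (P n) M" using assms by (simp_all add: carrier_C)
  then have "f \<oplus>\<^bsub>C n\<^esub> g \<in> mod_hom A (P n) M"
    unfolding add_C by (rule mod_hom_pointwise_add[OF P_module M_module])
  then show ?thesis using assms by (simp add: carrier_C add_C d_closed)
qed

lemma C_smult_closed:
  assumes "f \<in> carrier (C n)"
  shows "c \<odot>\<^bsub>C n\<^esub> f \<in> carrier (C n)"
proof -
  have "f \<in> mod_hom A (P n) M" using assms by (simp add: carrier_C)
  then have "c \<odot>\<^bsub>C n\<^esub> f \<in> mod_hom A (P n) M"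
    unfolding smult_C by (rule mod_hom_pointwise_scalar[OF P_module M_module])
  then show ?thesis using assms by (simp add: carrier_C smult_C d_closed scalar_zero_right M_module)
qed

lemma C_zero_closed: "(\<lambda>x\<in>carrier (P n). \<zero>\<^bsub>M\<^esub>) \<in> carrier (C n)"
  using mod_hom_zero_map[OF P_module M_module] by (simp add: carrier_C d_closed)

lemma C_diff:
  assumes "f \<in> carrier (C n)" "g \<in> carrier (C n)"
  shows "\<exists>b\<in>carrier (C n). f = b \<oplus>\<^bsub>C n\<^esub> g"
proof
  let ?b = "\<lambda>x\<in>carrier (P n). f x \<ominus>\<^bsub>M\<^esub> g x"
  have hom: "f \<in> mod_hom A (P n) M" "g \<in> mod_hom A (P n) M" using assms by (auto simp: carrier_C)
  show "?b \<in> carrier (C n)"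
    using mod_hom_pointwise_diff[OF P_module M_module hom] assms
    by (auto simp: carrier_C d_closed a_minus_def)
  show "f = ?b \<oplus>\<^bsub>C n\<^esub> g"
  proof (rule extensionalityI[OF mod_homD(4)[OF hom(1)]])
    fix x assume x: "x \<in> carrier (P n)"
    then show "f x = (?b \<oplus>\<^bsub>C n\<^esub> g) x"
      using mod_homD(1)[OF hom(1) x] mod_homD(1)[OF hom(2) x]
      by (simp add: add_C a_minus_def M.M.a_assoc M.M.l_neg)
  qed (simp add: add_C)
qed

end

section \<open>The Ext algebra of the cell modules\<close>

text \<open>For an idempotent \<open>u\<close> this is the left ideal \<open>A u\<close>; membership
  becomes an equation instead of an existence statement.\<close>

definition column_module :: "('a, 'c) ring_scheme \<Rightarrow> 'a \<Rightarrow> ('a, 'a) module" where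
  "column_module A u = \<lparr>carrier = {y \<in> carrier A. y \<otimes>\<^bsub>A\<^esub> u = y}, mult = undefined,
     one = undefined, zero = \<zero>\<^bsub>A\<^esub>, add = add A, smult = mult A\<rparr>"

lemma column_module_simps [simp]:
  "y \<in> carrier (column_module A u) \<longleftrightarrow> y \<in> carrier A \<and> y \<otimes>\<^bsub>A\<^esub> u = y"
  "\<zero>\<^bsub>column_module A u\<^esub> = \<zero>\<^bsub>A\<^esub>"
  "x \<oplus>\<^bsub>column_module A u\<^esub> y = x \<oplus>\<^bsub>A\<^esub> y"
  "x \<odot>\<^bsub>column_module A u\<^esub> y = x \<otimes>\<^bsub>A\<^esub> y"
  by (simp_all add: column_module_def)

lemma (in ring) left_module_regular: "left_module R (column_module R \<one>)"
proof -
  have "abelian_group (column_module R \<one>)"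
  proof (rule abelian_groupI)
    fix x assume "x \<in> carrier (column_module R \<one>)"
    then show "\<exists>y\<in>carrier (column_module R \<one>). y \<oplus>\<^bsub>column_module R \<one>\<^esub> x = \<zero>\<^bsub>column_module R \<one>\<^esub>"
      by (intro bexI[of _ "\<ominus> x"]) (simp_all add: l_neg)
  qed (simp_all add: a_ac)
  then show ?thesis
    by (intro left_module.intro left_module_axioms.intro ring_axioms)
      (simp_all add: l_distr r_distr m_assoc)
qed

type_synonym coeffs = "nat \<times> nat \<times> nat \<Rightarrow> complex"

text \<open>Coordinates common to both algebras. A path from \<open>a\<close> to \<open>b\<close>
  with \<open>s\<close> arrows \<open>F\<close> has length \<open>a - b\<close>, so
  \<open>b + s \<le> a\<close>; in Ext the same inequality says that the degree
  \<open>a - b - s\<close> is not negative.\<close>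

definition coefficient_space :: "nat \<Rightarrow> coeffs set" where
  "coefficient_space N = {X. \<forall>a b s. X (a, b, s) \<noteq> 0 \<longrightarrow> b + s \<le> a \<and> a \<le> N \<and> s \<le> 1}"

text \<open>Upper triangular matrices over the dual numbers; the index \<open>s\<close> is the exponent of the
  nilpotent element.\<close>

definition coeff_mult :: "nat \<Rightarrow> coeffs \<Rightarrow> coeffs \<Rightarrow> coeffs" where
  "coeff_mult N X Y = (\<lambda>(a, b, s). (\<Sum>c\<le>N. X (a, c, 0) * Y (c, b, s)) +
    (if s = 1 then \<Sum>c\<le>N. X (a, c, 1) * Y (c, b, 0) else 0))"

lemma coefficient_spaceD:
  "X \<in> coefficient_space N \<Longrightarrow> \<not> (b + s \<le> a \<and> a \<le> N \<and> s \<le> 1) \<Longrightarrow> X (a, b, s) = 0"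
  by (auto simp: coefficient_space_def)

lemma coeff_mult_closed:
  assumes "X \<in> coefficient_space N" "Y \<in> coefficient_space N"
  shows "coeff_mult N X Y \<in> coefficient_space N"
  unfolding coefficient_space_def
proof (intro CollectI allI impI)
  fix a b s assume nz: "coeff_mult N X Y (a, b, s) \<noteq> 0"
  have "\<exists>c. X (a, c, 0) \<noteq> 0 \<and> Y (c, b, s) \<noteq> 0 \<or> s = 1 \<and> X (a, c, 1) \<noteq> 0 \<and> Y (c, b, 0) \<noteq> 0"
  proof (rule ccontr)
    assume none: "\<not> ?thesis"
    then have "(\<Sum>c\<le>N. X (a, c, 0) * Y (c, b, s)) = 0" by (intro sum.neutral) auto
    moreover have "(\<Sum>c\<le>N. X (a, c, 1) * Y (c, b, 0)) = 0" if "s = 1"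
      using none that by (intro sum.neutral) auto
    ultimately show False using nz by (auto simp: coeff_mult_def split: if_splits)
  qed
  then show "b + s \<le> a \<and> a \<le> N \<and> s \<le> 1"
    using assms unfolding coefficient_space_def by fastforce
qed

locale khovanov_ext =
  khovanov N A + resolution A "cell_sum N" P d \<epsilon>
  for N :: nat and A (structure) and P :: "nat \<Rightarrow> (diagram \<Rightarrow> complex, 'b) module"
    and d :: "nat \<Rightarrow> 'b \<Rightarrow> 'b" and \<epsilon> :: "'b \<Rightarrow> (nat \<Rightarrow> weight \<Rightarrow> complex)"

lemma khovanov_complex_algebra:
  assumes "ring A" "A = khovanov_algebra N (Suc 0)"
  shows "complex_algebra A"
proof -
  interpret khovanov N A by (intro khovanov.intro assms)
  show ?thesis
  proof (rule complex_algebra.intro)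
    show "(c + d) \<odot>\<^bsub>A\<^esub> \<one>\<^bsub>A\<^esub> = c \<odot>\<^bsub>A\<^esub> \<one>\<^bsub>A\<^esub> \<oplus>\<^bsub>A\<^esub> d \<odot>\<^bsub>A\<^esub> \<one>\<^bsub>A\<^esub>" for c d
      by (simp add: smult_A add_A distrib_right)
  qed (simp_all add: ring_axioms scalar_one_central)
qed

text \<open>The resolution supplies the missing axioms: \<open>P 0\<close> being a module makes the
  diagram algebra a ring, and the surjection \<open>\<epsilon>\<close> transports the module
  structure to the cell sum.\<close>

lemma khovanov_extI:
  assumes "projective_resolution A (cell_sum N) P d \<epsilon>" "A = khovanov_algebra N (Suc 0)"
  shows "khovanov_ext N A P d \<epsilon>"
proof -
  have P: "fd_module A (P 0)" and \<epsilon>: "\<epsilon> \<in> mod_hom A (P 0) (cell_sum N)"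
    and surj: "\<epsilon> ` carrier (P 0) = carrier (cell_sum N)"
    using assms(1) by (auto simp: projective_resolution_def fd_projective_def)
  interpret P: left_module A "P 0" using P by (simp add: fd_module_def)
  interpret khovanov N A by (intro khovanov.intro P.R.ring_axioms assms(2))
  interpret complex_algebra A using P.R.ring_axioms assms(2) by (rule khovanov_complex_algebra)
  have "\<epsilon> \<zero>\<^bsub>P 0\<^esub> = \<zero>\<^bsub>cell_sum N\<^esub>"
  proof (rule extensionalityI[of _ "{0..N}"])
    have "\<epsilon> \<zero>\<^bsub>P 0\<^esub> \<in> carrier (cell_sum N)" using mod_homD(1)[OF \<epsilon>] by simp
    then show "\<epsilon> \<zero>\<^bsub>P 0\<^esub> \<in> extensional {0..N}" by (simp add: carrier_M)
    \<comment> \<open>The cell sum is not yet known to be a group, so the cancellation takes place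
      in its complex coordinates.\<close>
    have eq: "\<epsilon> \<zero>\<^bsub>P 0\<^esub> = \<epsilon> \<zero>\<^bsub>P 0\<^esub> \<oplus>\<^bsub>cell_sum N\<^esub> \<epsilon> \<zero>\<^bsub>P 0\<^esub>"
      using mod_homD(2)[OF \<epsilon>, of "\<zero>\<^bsub>P 0\<^esub>" "\<zero>\<^bsub>P 0\<^esub>"] by simp
    show "\<epsilon> \<zero>\<^bsub>P 0\<^esub> i = \<zero>\<^bsub>cell_sum N\<^esub> i" if "i \<in> {0..N}" for i
    proof
      fix \<alpha>
      have "\<epsilon> \<zero>\<^bsub>P 0\<^esub> i \<alpha> = (\<epsilon> \<zero>\<^bsub>P 0\<^esub> \<oplus>\<^bsub>cell_sum N\<^esub> \<epsilon> \<zero>\<^bsub>P 0\<^esub>) i \<alpha>"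
        by (rule arg_cong[OF eq])
      then show "\<epsilon> \<zero>\<^bsub>P 0\<^esub> i \<alpha> = \<zero>\<^bsub>cell_sum N\<^esub> i \<alpha>" using that by (simp add: add_M zero_M)
    qed
  qed (simp add: zero_M)
  then have "fd_module A (cell_sum N)"
    using mod_homD[OF \<epsilon>] by (intro fd_module_image[OF P surj])
  then show ?thesis
    by (intro khovanov_ext.intro resolution.intro resolution_axioms.intro
        khovanov_axioms complex_algebra_axioms assms(1))
qed

context khovanov_ext
begin

section \<open>The minimal resolutions of the cell modules\<close>

lemma l_smult_M_zero: "l c \<odot>\<^bsub>M\<^esub> m = \<zero>\<^bsub>M\<^esub>"
proof (rule extensionalityI[of _ "{0..N}"])
  show "(l c \<odot>\<^bsub>M\<^esub> m) i = \<zero>\<^bsub>M\<^esub> i" if "i \<in> {0..N}" for i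
    using that by (intro ext) (simp add: l_smult_M zero_M)
qed (simp_all add: smult_M zero_M)

lemma add_M_apply: "i \<le> N \<Longrightarrow> (x \<oplus>\<^bsub>M\<^esub> y) i \<alpha> = x i \<alpha> + y i \<alpha>"
  by (simp add: add_M)

text \<open>The part of \<open>y\<close> that factors through some \<open>l\<close> acts by zero, so
  only the coefficients of \<open>e c\<close> and \<open>r c\<close> are visible on the cell
  modules.\<close>

lemma column_action:
  assumes "y \<in> carrier A" "c \<le> N" "y \<otimes> e c = y" "m \<in> carrier M" "i \<le> N"
  shows "(y \<odot>\<^bsub>M\<^esub> m) i \<alpha> = (if \<alpha> = w c then y (w c, w c, w c) * m i (w c) else 0) +
    (if c < N \<and> i = c \<and> \<alpha> = w (Suc c) then y (w (Suc c), w c, w c) * m c (w c) else 0)"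
proof -
  let ?z = "case c of 0 \<Rightarrow> \<zero> | Suc b \<Rightarrow>
      (y (w b, w b, w c) \<odot> e b \<oplus> y (w c, w b, w c) \<odot> r b) \<otimes> l b"
  have z: "?z \<in> carrier A" using assms(2) by (auto split: nat.split)
  have z0: "?z \<odot>\<^bsub>M\<^esub> m = \<zero>\<^bsub>M\<^esub>"
    using assms(2,4)
    by (auto simp: M.smult_assoc l_smult_M_zero M.smult_zero_right M.smult_zero_left split: nat.split)
  have "y \<odot>\<^bsub>M\<^esub> m = ((y (w c, w c, w c) \<odot> e c \<oplus> y (w (Suc c), w c, w c) \<odot> r c) \<oplus> ?z) \<odot>\<^bsub>M\<^esub> m"
    using column_decomp[OF assms(1-3)] by (rule arg_cong)
  also have "\<dots> = ((y (w c, w c, w c) \<odot> e c) \<odot>\<^bsub>M\<^esub> m \<oplus>\<^bsub>M\<^esub> (y (w (Suc c), w c, w c) \<odot> r c) \<odot>\<^bsub>M\<^esub> m) \<oplus>\<^bsub>M\<^esub> \<zero>\<^bsub>M\<^esub>"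
    using assms z by (simp only: M.smult_l_distr z0[symmetric] a_closed smult_A_closed e_closed r_closed)
  finally show ?thesis
    using assms by (simp add: add_M_apply zero_M smult_M_scale e_smult_M r_smult_M)
qed

text \<open>The column is the image of the regular module under right multiplication by
  \<open>u\<close>, and the regular module is spanned by the basis diagrams.\<close>

lemma column_fd: 
  assumes "u \<in> carrier A" "u \<otimes> u = u"
  shows "fd_module A (column_module A u)"
proof -
  let ?R = "column_module A \<one>"
  interpret R: left_module A ?R by (rule left_module_regular)
  have fin: "finite \<Delta>" by (intro finite_diagrams finite_block)
  have sc: "scalar A ?R c y = c \<odot> y" if "y \<in> carrier A" for c y
    using that by (simp add: scalar_def smult_A_mult)
  have sum: "(\<Oplus>\<^bsub>?R\<^esub>i\<in>I. F i) = (\<lambda>t. \<Sum>i\<in>I. F i t)" if "finite I" "F \<in> I \<rightarrow> carrier A"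
    for I :: "diagram set" and F
    using that
  proof (induction I rule: finite_induct)
    case empty
    show ?case by (simp add: zero_A)
  next
    case (insert i I)
    have "(\<Oplus>\<^bsub>?R\<^esub>j\<in>insert i I. F j) = F i \<oplus> (\<Oplus>\<^bsub>?R\<^esub>j\<in>I. F j)"
      using insert by (subst R.M.finsum_insert) (auto simp: Pi_iff)
    then show ?case using insert by (simp add: Pi_iff add_A)
  qed
  have "fd_module A ?R"
    unfolding fd_module_def
  proof (intro conjI exI[of _ "single ` \<Delta>"] ballI)
    show "single ` \<Delta> \<subseteq> carrier ?R" by (auto simp: carrier_A single_apply)
    fix x assume x: "x \<in> carrier ?R"
    have "x = (\<lambda>t. \<Sum>i\<in>\<Delta>. (x i \<odot> single i) t)"
    proof
      fix t
      have "(\<Sum>i\<in>\<Delta>. (x i \<odot> single i) t) = (\<Sum>i\<in>\<Delta>. if i = t then x t else 0)"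
        by (intro sum.cong) (auto simp: smult_A single_apply)
      then show "x t = (\<Sum>i\<in>\<Delta>. (x i \<odot> single i) t)"
        using x fin A_out[of x t] by simp
    qed
    also have "\<dots> = (\<Oplus>\<^bsub>?R\<^esub>i\<in>\<Delta>. x i \<odot> single i)"
      using fin by (intro sum[symmetric]) (auto intro!: smult_A_closed simp: carrier_A single_apply)
    also have "\<dots> = (\<Oplus>\<^bsub>?R\<^esub>i\<in>\<Delta>. scalar A ?R (x i) (single i))"
    proof (rule R.M.finsum_cong'[OF refl])
      have s: "single i \<in> carrier A" if "i \<in> \<Delta>" for i :: diagram
        using that by (auto simp: carrier_A single_apply)
      then show "(\<lambda>i. scalar A ?R (x i) (single i)) \<in> \<Delta> \<rightarrow> carrier ?R"
        by (auto simp: sc)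
      show "x i \<odot> single i = scalar A ?R (x i) (single i)" if "i \<in> \<Delta>" for i
        using s[OF that] by (simp add: sc)
    qed
    finally show "\<exists>c. x = (\<Oplus>\<^bsub>?R\<^esub>s\<in>single ` \<Delta>. scalar A ?R (c s) s)"
      using span_image[OF R.left_module_axioms fin, of single x]
      by (auto simp: carrier_A single_apply)
  qed (use fin R.left_module_axioms in auto)
  then show ?thesis
  proof (rule fd_module_image[where g = "\<lambda>y. y \<otimes> u"])
    show "(\<lambda>y. y \<otimes> u) ` carrier ?R = carrier (column_module A u)"
    proof (intro equalityI subsetI)
      show "x \<in> (\<lambda>y. y \<otimes> u) ` carrier ?R" if "x \<in> carrier (column_module A u)" for x
        by (rule image_eqI[of _ _ x]) (use that in simp_all)
    qed (use assms in \<open>auto simp: m_assoc\<close>)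
  qed (use assms in \<open>simp_all add: l_distr m_assoc\<close>)
qed

text \<open>\<open>E a n\<close> is the idempotent of the degree \<open>n\<close> term in the
  minimal resolution of \<open>M(a)\<close>. By right multiplication, \<open>D a n\<close> is the
  differential from degree \<open>n + 1\<close> to \<open>n\<close>, and \<open>U a n\<close> is the
  degree \<open>n\<close> part of the chain map to the resolution of \<open>M(a - 1)\<close> that
  lifts \<open>F\<close>. The zero values beyond the length \<open>a\<close> make these infinite
  sequences.\<close>

definition E :: "nat \<Rightarrow> nat \<Rightarrow> diagram \<Rightarrow> complex" where
  "E a n = (if n \<le> a then e (a - n) else \<zero>)"

definition D :: "nat \<Rightarrow> nat \<Rightarrow> diagram \<Rightarrow> complex" where
  "D a n = (if n < a then l (a - Suc n) else \<zero>)"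

definition U :: "nat \<Rightarrow> nat \<Rightarrow> diagram \<Rightarrow> complex" where
  "U a n = (if n < a then r (a - Suc n) else \<zero>)"

lemma E_closed [simp]: "a \<le> N \<Longrightarrow> E a n \<in> carrier A"
  by (simp add: E_def)

lemma D_closed [simp]: "D a n \<in> carrier A"
  by (simp add: D_def)

lemma U_closed [simp]: "U a n \<in> carrier A"
  by (simp add: U_def)

lemma E_idem: "a \<le> N \<Longrightarrow> E a n \<otimes> E a n = E a n"
  by (simp add: E_def e_e)

lemma E_D: "a \<le> N \<Longrightarrow> E a (Suc n) \<otimes> D a n = D a n"
  by (auto simp: E_def D_def e_l)

lemma D_E: "a \<le> N \<Longrightarrow> D a n \<otimes> E a n = D a n"
  by (auto simp: E_def D_def l_e)

lemma D_D: "D a (Suc n) \<otimes> D a n = \<zero>"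
  by (simp add: D_def l_l)

text \<open>\<open>U\<close> commutes with the differentials by the zigzag relation, and at the end
  of the resolution by \<open>l 0 \<otimes> r 0 = \<zero>\<close>.\<close>

lemma D_U: 
  assumes "a \<le> N"
  shows "D a n \<otimes> U a n = U a (Suc n) \<otimes> D a (Suc n)"
proof (cases "n < a")
  case True
  then have lr: "D a n \<otimes> U a n = (case a - Suc n of 0 \<Rightarrow> \<zero> | Suc j \<Rightarrow> r j \<otimes> l j)"
    using assms l_r[of "a - Suc n"] by (simp add: D_def U_def)
  show ?thesis
  proof (cases "a - Suc n")
    case 0
    then show ?thesis using lr by (simp add: U_def)
  next
    case (Suc j)
    then have "Suc n < a" "a - Suc (Suc n) = j" by auto
    then show ?thesis using lr Suc by (simp add: D_def U_def)
  qed
qed (simp add: D_def U_def)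

text \<open>The resolution of \<open>M(c)\<close> is that of \<open>M(c + 1)\<close> without its
  first term.\<close>

lemma D_Suc: "D (Suc c) (Suc k) = D c k"
  by (simp add: D_def)

lemma D_smult_M: "m \<in> carrier M \<Longrightarrow> D a n \<odot>\<^bsub>M\<^esub> m = \<zero>\<^bsub>M\<^esub>"
  by (simp add: D_def l_smult_M_zero M.smult_zero_left)

lemma E_smult_M:
  assumes "a \<le> N" "m \<in> carrier M" "E a n \<odot>\<^bsub>M\<^esub> m = m" "n \<le> a" "i \<le> N" "\<alpha> \<noteq> w (a - n)"
  shows "m i \<alpha> = 0"
proof -
  have "(E a n \<odot>\<^bsub>M\<^esub> m) i \<alpha> = 0"
    using e_smult_M[of m "a - n" i \<alpha>] assms(1,2,4-6) by (simp add: E_def)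
  then show ?thesis by (simp only: assms(3))
qed

text \<open>The vector in the summand \<open>M(a)\<close> fixed by \<open>e a\<close>; it generates
  that summand.\<close>

definition top_vector :: "nat \<Rightarrow> nat \<Rightarrow> weight \<Rightarrow> complex" where
  "top_vector a = (\<lambda>i\<in>{0..N}. \<lambda>\<alpha>. if i = a \<and> \<alpha> = w a then 1 else 0)"

lemma top_vector_closed: "a \<le> N \<Longrightarrow> top_vector a \<in> carrier M"
  by (auto simp: top_vector_def carrier_M orients_wedge_at block_eq)

lemma top_vector_apply: "i \<le> N \<Longrightarrow> top_vector a i \<alpha> = (if i = a \<and> \<alpha> = w a then 1 else 0)"
  by (simp add: top_vector_def)

lemma e_top_vector: "a \<le> N \<Longrightarrow> e a \<odot>\<^bsub>M\<^esub> top_vector a = top_vector a"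
  by (rule M_eqI) (auto simp: M.smult_closed top_vector_closed e_smult_M top_vector_apply)

section \<open>Comparison maps between the minimal resolutions and \<open>P\<close>\<close>

lemma smult_P_closed: "x \<in> carrier A \<Longrightarrow> y \<in> carrier (P n) \<Longrightarrow> x \<odot>\<^bsub>P n\<^esub> y \<in> carrier (P n)"
  by (rule left_module.smult_closed[OF P_module])

lemma smult_P_assoc: "x \<in> carrier A \<Longrightarrow> y \<in> carrier A \<Longrightarrow> z \<in> carrier (P n) \<Longrightarrow>
    (x \<otimes> y) \<odot>\<^bsub>P n\<^esub> z = x \<odot>\<^bsub>P n\<^esub> (y \<odot>\<^bsub>P n\<^esub> z)"
  by (rule left_module.smult_assoc[OF P_module])

lemma smult_P_zero: "z \<in> carrier (P n) \<Longrightarrow> \<zero> \<odot>\<^bsub>P n\<^esub> z = \<zero>\<^bsub>P n\<^esub>"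
  by (rule left_module.smult_zero_left[OF P_module])

lemma smult_d: "x \<in> carrier A \<Longrightarrow> y \<in> carrier (P (Suc n)) \<Longrightarrow>
    d n (x \<odot>\<^bsub>P (Suc n)\<^esub> y) = x \<odot>\<^bsub>P n\<^esub> d n y"
  by (rule mod_homD(3)[OF d_hom])

text \<open>The minimal resolution of \<open>M(a)\<close> has the terms \<open>P(a - n)\<close>; the images of their generators
  under a comparison map to the given resolution.\<close>

lemma generators_exist:
  assumes a: "a \<le> N"
  shows "\<exists>p. \<forall>n. (p n \<in> carrier (P n) \<and> E a n \<odot>\<^bsub>P n\<^esub> p n = p n \<and>
    (n = 0 \<longrightarrow> \<epsilon> (p n) = top_vector a)) \<and> d n (p (Suc n)) = D a n \<odot>\<^bsub>P n\<^esub> p n"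
proof -
  define R where "R = (\<lambda>n x. x \<in> carrier (P n) \<and> E a n \<odot>\<^bsub>P n\<^esub> x = x \<and>
    (n = 0 \<longrightarrow> \<epsilon> x = top_vector a) \<and> D a n \<odot>\<^bsub>P n\<^esub> x \<in> d n ` carrier (P (Suc n)))"
  define Q where "Q = (\<lambda>n x y. d n y = D a n \<odot>\<^bsub>P n\<^esub> x)"
  have base: "\<exists>x. R 0 x"
  proof -
    have "top_vector a \<in> \<epsilon> ` carrier (P 0)" using a by (simp add: \<epsilon>_surj top_vector_closed)
    then obtain q where q: "q \<in> carrier (P 0)" "\<epsilon> q = top_vector a" by auto
    \<comment> \<open>The idempotent may be applied because it fixes the top vector.\<close>
    define x where "x = E a 0 \<odot>\<^bsub>P 0\<^esub> q"
    have x: "x \<in> carrier (P 0)" using a q by (simp add: x_def smult_P_closed)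
    have "E a 0 \<odot>\<^bsub>P 0\<^esub> x = x"
      using a q unfolding x_def by (subst smult_P_assoc[symmetric]) (simp_all add: E_idem)
    moreover have ex: "\<epsilon> x = top_vector a"
      using a q by (simp add: x_def mod_homD(3)[OF \<epsilon>_hom] E_def e_top_vector)
    moreover have "\<epsilon> (D a 0 \<odot>\<^bsub>P 0\<^esub> x) = \<zero>\<^bsub>M\<^esub>"
      using a x by (simp add: mod_homD(3)[OF \<epsilon>_hom] D_smult_M ex top_vector_closed)
    then have "D a 0 \<odot>\<^bsub>P 0\<^esub> x \<in> d 0 ` carrier (P (Suc 0))"
      using exact_0[OF smult_P_closed[OF D_closed x]] by simp
    ultimately have "R 0 x" using x by (simp add: R_def)
    then show ?thesis by blast
  qed
  have step: "\<exists>y. R (Suc n) y \<and> Q n x y" if R: "R n x" for n x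
  proof -
    have x: "x \<in> carrier (P n)" and "D a n \<odot>\<^bsub>P n\<^esub> x \<in> d n ` carrier (P (Suc n))"
      using R by (simp_all add: R_def)
    then obtain q where q: "q \<in> carrier (P (Suc n))" "d n q = D a n \<odot>\<^bsub>P n\<^esub> x" by auto
    \<comment> \<open>Since \<open>E a (Suc n) \<otimes> D a n = D a n\<close>, the equation for
      \<open>d n\<close> survives this projection.\<close>
    define y where "y = E a (Suc n) \<odot>\<^bsub>P (Suc n)\<^esub> q"
    have y: "y \<in> carrier (P (Suc n))" using a q by (simp add: y_def smult_P_closed)
    have "E a (Suc n) \<odot>\<^bsub>P (Suc n)\<^esub> y = y"
      using a q unfolding y_def by (subst smult_P_assoc[symmetric]) (simp_all add: E_idem)
    moreover have dy: "d n y = D a n \<odot>\<^bsub>P n\<^esub> x"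
      using a q x unfolding y_def by (simp add: smult_d E_D flip: smult_P_assoc)
    moreover have "d n (D a (Suc n) \<odot>\<^bsub>P (Suc n)\<^esub> y) = \<zero>\<^bsub>P n\<^esub>"
      using x y by (simp add: smult_d dy D_D smult_P_zero flip: smult_P_assoc)
    then have "D a (Suc n) \<odot>\<^bsub>P (Suc n)\<^esub> y \<in> d (Suc n) ` carrier (P (Suc (Suc n)))"
      using exact_Suc[OF smult_P_closed[OF D_closed y]] by simp
    ultimately show ?thesis using y by (auto simp: R_def Q_def)
  qed
  show ?thesis
    using dependent_nat_choice[of R Q, OF base step] unfolding R_def Q_def by blast
qed

definition p :: "nat \<Rightarrow> nat \<Rightarrow> 'b" where
  "p a = (SOME p. \<forall>n. (p n \<in> carrier (P n) \<and> E a n \<odot>\<^bsub>P n\<^esub> p n = p n \<and>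
    (n = 0 \<longrightarrow> \<epsilon> (p n) = top_vector a)) \<and> d n (p (Suc n)) = D a n \<odot>\<^bsub>P n\<^esub> p n)"

lemma p:
  assumes "a \<le> N"
  shows p_closed [simp]: "p a n \<in> carrier (P n)" and E_p: "E a n \<odot>\<^bsub>P n\<^esub> p a n = p a n"
    and \<epsilon>_p: "\<epsilon> (p a 0) = top_vector a" and d_p: "d n (p a (Suc n)) = D a n \<odot>\<^bsub>P n\<^esub> p a n"
  using someI_ex[OF generators_exist[OF assms], folded p_def] by auto

lemma p_out: "a \<le> N \<Longrightarrow> a < n \<Longrightarrow> p a n = \<zero>\<^bsub>P n\<^esub>"
  using E_p[of a n] smult_P_zero[OF p_closed, of a n] by (simp add: E_def)

lemma smult_A_0: "0 \<odot> x = \<zero>"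
  by (simp add: smult_A zero_A)

lemma M_ext:
  assumes "m \<in> carrier M" "m' \<in> carrier M" "\<And>i \<alpha>. i \<le> N \<Longrightarrow> m i \<alpha> = m' i \<alpha>"
  shows "m = m'"
  by (rule M_eqI[OF assms(1,2)]) (use assms(3) in auto)

lemma zero_M_apply: "i \<le> N \<Longrightarrow> \<zero>\<^bsub>M\<^esub> i \<alpha> = 0"
  by (simp add: zero_M)

lemma finsum_M_apply:
  assumes "finite J" "m \<in> J \<rightarrow> carrier M" "i \<le> N"
  shows "(\<Oplus>\<^bsub>M\<^esub>j\<in>J. m j) i \<alpha> = (\<Sum>j\<in>J. m j i \<alpha>)"
  using assms(1,2)
proof (induction J rule: finite_induct)
  case empty
  then show ?case using assms(3) by (simp add: zero_M_apply)
next
  case (insert j J)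
  then show ?case using assms(3) by (simp add: Pi_iff add_M_apply)
qed

abbreviation "\<pi> \<equiv> summand_proj {0..N} (cell_at N)"

lemma \<pi>_apply:
  assumes "m \<in> carrier M" "i \<le> N"
  shows "\<pi> a m i \<alpha> = (if i = a then m i \<alpha> else 0)"
  using assms by (simp add: summand_proj_def cell_at_def cell_module_def flip: cell_sum_def)

lemma \<pi>_closed:
  assumes "m \<in> carrier M"
  shows "\<pi> a m \<in> carrier M"
proof -
  have "\<pi> a m \<in> extensional {0..N}"
    using assms by (simp add: summand_proj_def flip: cell_sum_def)
  moreover have "\<forall>i\<le>N. \<forall>\<alpha>. \<not> (\<alpha> \<in> block N (Suc 0) \<and> orients \<alpha> (w i)) \<longrightarrow> m i \<alpha> = 0"
    using assms unfolding carrier_M by (rule conjunct2)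
  ultimately show ?thesis using \<pi>_apply[OF assms] unfolding carrier_M[of "\<pi> a m"] by auto
qed

lemma \<pi>_hom: "\<pi> a \<in> mod_hom A M M"
proof (intro mod_homI)
  show "\<pi> a (x \<oplus>\<^bsub>M\<^esub> y) = \<pi> a x \<oplus>\<^bsub>M\<^esub> \<pi> a y" if "x \<in> carrier M" "y \<in> carrier M" for x y
    using that by (intro M_ext) (auto simp: \<pi>_closed \<pi>_apply add_M_apply)
  show "\<pi> a (b \<odot>\<^bsub>M\<^esub> x) = b \<odot>\<^bsub>M\<^esub> \<pi> a x" if b: "b \<in> carrier A" "x \<in> carrier M" for b x
  proof (rule M_ext)
    fix i \<alpha> assume i: "i \<le> N"
    show "\<pi> a (b \<odot>\<^bsub>M\<^esub> x) i \<alpha> = (b \<odot>\<^bsub>M\<^esub> \<pi> a x) i \<alpha>"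
      unfolding \<pi>_apply[OF M.smult_closed[OF b] i] using b i
      by (cases "i = a") (simp_all add: smult_M \<pi>_apply)
  qed (use b in \<open>auto simp: \<pi>_closed M.smult_closed\<close>)
  show "\<pi> a \<in> extensional (carrier M)"
    by (simp add: summand_proj_def flip: cell_sum_def)
qed (simp add: \<pi>_closed)

lemma E_column_fd: "a \<le> N \<Longrightarrow> fd_module A (column_module A (E a n))"
  by (intro column_fd) (simp_all add: E_idem)

lemma E_column_module: "a \<le> N \<Longrightarrow> left_module A (column_module A (E a n))"
  using E_column_fd by (simp add: fd_module_def)

lemma column_factor_D:
  assumes "a \<le> N" "n \<le> a" "y \<in> carrier A" "y \<otimes> E a n = y"
    and "y (w (a - n), w (a - n), w (a - n)) = 0"
    and "a - n < N \<Longrightarrow> y (w (Suc (a - n)), w (a - n), w (a - n)) = 0"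
  shows "y \<in> (\<lambda>z. z \<otimes> D a n) ` carrier (column_module A (E a (Suc n)))"
proof -
  have y: "y \<in> (case a - n of 0 \<Rightarrow> {\<zero>} | Suc b \<Rightarrow> (\<lambda>z. z \<otimes> l b) ` {z \<in> carrier A. z \<otimes> e b = z})"
    using assms by (intro column_factor) (auto simp: E_def)
  show ?thesis
  proof (cases "a - n")
    case 0
    then have "y = \<zero> \<otimes> D a n" "\<zero> \<otimes> E a (Suc n) = \<zero>" using y assms by simp_all
    then show ?thesis by (intro image_eqI[of _ _ \<zero>]) simp_all
  next
    case (Suc b)
    then have "n < a" "a - Suc n = b" by auto
    then show ?thesis using y Suc by (auto simp: D_def E_def)
  qed
qed

lemma mult_D_hom:
  assumes "a \<le> N"
  shows "(\<lambda>z\<in>carrier (column_module A (E a (Suc n))). z \<otimes> D a n)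
    \<in> mod_hom A (column_module A (E a (Suc n))) (column_module A (E a n))"
  using assms by (intro mod_homI) (auto simp: m_assoc D_E l_distr)

text \<open>Acting on the top vector maps the column \<open>A e_a\<close> onto \<open>M(a)\<close>,
  and projectivity of \<open>P 0\<close> lifts the projection of \<open>\<epsilon>\<close> to this
  summand.\<close>

lemma comparison_start:
  assumes a: "a \<le> N"
  obtains v where "v \<in> mod_hom A (P 0) (column_module A (E a 0))"
    "\<And>x. x \<in> carrier (P 0) \<Longrightarrow> v x \<odot>\<^bsub>M\<^esub> top_vector a = \<pi> a (\<epsilon> x)"
proof -
  let ?C = "column_module A (E a 0)"
  let ?g = "\<lambda>y\<in>carrier ?C. y \<odot>\<^bsub>M\<^esub> top_vector a"
  let ?f = "compose (carrier (P 0)) (\<pi> a) \<epsilon>"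
  have g: "?g \<in> mod_hom A ?C M"
    using a by (intro mod_homI)
      (auto simp: M.smult_closed M.smult_l_distr M.smult_assoc top_vector_closed m_assoc l_distr)
  have f: "?f \<in> mod_hom A (P 0) M"
    by (rule mod_hom_compose[OF \<epsilon>_hom \<pi>_hom P_module])
  have "\<pi> a m \<in> ?g ` carrier ?C" if m: "m \<in> carrier M" for m
  proof (rule image_eqI)
    \<comment> \<open>\<open>e a\<close> and \<open>r a\<close> reach the two basis vectors of
      \<open>M(a)\<close>.\<close>
    let ?y = "m a (w a) \<odot> e a \<oplus> m a (w (Suc a)) \<odot> r a"
    show y: "?y \<in> carrier ?C" using a by (simp add: E_def l_distr smult_A_mult e_e r_e)
    have act: "(?y \<odot>\<^bsub>M\<^esub> top_vector a) i \<alpha> = m a (w a) * (if \<alpha> = w a \<and> i = a then 1 else 0) +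
        m a (w (Suc a)) * (if a < N \<and> i = a \<and> \<alpha> = w (Suc a) then 1 else 0)" if "i \<le> N" for i \<alpha>
      using a that
      by (simp add: M.smult_l_distr top_vector_closed add_M_apply smult_M_scale e_smult_M r_smult_M
          top_vector_apply)
    have "\<pi> a m = ?y \<odot>\<^bsub>M\<^esub> top_vector a"
      using a m by (intro M_eqI) (auto simp: act \<pi>_apply \<pi>_closed M.smult_closed top_vector_closed)
    then show "\<pi> a m = ?g ?y" using y by simp
  qed
  then have im: "?f ` carrier (P 0) \<subseteq> ?g ` carrier ?C" by (auto simp: compose_eq \<epsilon>_closed)
  obtain v where v: "v \<in> mod_hom A (P 0) ?C" "\<And>x. x \<in> carrier (P 0) \<Longrightarrow> ?g (v x) = ?f x"
    by (rule projective_lift[OF P_projective E_column_fd[OF a] M_module g f im]) (rule that)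
  show ?thesis
  proof (rule that[OF v(1)])
    fix x assume "x \<in> carrier (P 0)"
    then show "v x \<odot>\<^bsub>M\<^esub> top_vector a = \<pi> a (\<epsilon> x)"
      using v(2)[of x] mod_homD(1)[OF v(1), of x] by (simp add: compose_eq)
  qed
qed

text \<open>Exactness of the minimal resolution of \<open>M(a)\<close> and projectivity of
  \<open>P\<close> give a chain map out of \<open>P\<close> that covers the projection onto
  \<open>M(a)\<close>. Exactness is a condition on only two coefficients in each degree up to
  \<open>a\<close>.\<close>

lemma comparison_exists:
  assumes a: "a \<le> N"
  shows "\<exists>v. \<forall>n. (v n \<in> mod_hom A (P n) (column_module A (E a n)) \<and>
    (n = 0 \<longrightarrow> (\<forall>x\<in>carrier (P 0). v n x \<odot>\<^bsub>M\<^esub> top_vector a = \<pi> a (\<epsilon> x)))) \<and>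
    (\<forall>x\<in>carrier (P (Suc n)). v (Suc n) x \<otimes> D a n = v n (d n x))"
proof -
  let ?C = "\<lambda>n. column_module A (E a n)"
  define R where "R = (\<lambda>n v. v \<in> mod_hom A (P n) (?C n) \<and>
    (n = 0 \<longrightarrow> (\<forall>x\<in>carrier (P 0). v x \<odot>\<^bsub>M\<^esub> top_vector a = \<pi> a (\<epsilon> x))) \<and>
    (\<forall>x\<in>carrier (P (Suc n)). v (d n x) \<in> (\<lambda>z. z \<otimes> D a n) ` carrier (?C (Suc n))))"
  define Q where "Q = (\<lambda>n v v'. \<forall>x\<in>carrier (P (Suc n)). v' x \<otimes> D a n = v (d n x))"
  have base: "\<exists>v. R 0 v"
  proof -
    obtain v where v: "v \<in> mod_hom A (P 0) (?C 0)"
      "\<And>x. x \<in> carrier (P 0) \<Longrightarrow> v x \<odot>\<^bsub>M\<^esub> top_vector a = \<pi> a (\<epsilon> x)"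
      by (rule comparison_start[OF a]) (rule that)
    have "v (d 0 x) \<in> (\<lambda>z. z \<otimes> D a 0) ` carrier (?C (Suc 0))" if x: "x \<in> carrier (P (Suc 0))" for x
    proof -
      let ?y = "v (d 0 x)"
      have y: "?y \<in> carrier A" "?y \<otimes> E a 0 = ?y"
        using mod_homD(1)[OF v(1) d_closed[OF x]] by auto
      \<comment> \<open>Exactness in degree 0: annihilating the top vector forces both visible
        coefficients to vanish.\<close>
      have 0: "?y \<odot>\<^bsub>M\<^esub> top_vector a = \<zero>\<^bsub>M\<^esub>"
        using v(2)[OF d_closed[OF x]] x by (simp add: \<epsilon>_d mod_hom_zero[OF M_module M_module \<pi>_hom])
      have act: "(?y \<odot>\<^bsub>M\<^esub> top_vector a) a \<alpha> = (if \<alpha> = w a then ?y (w a, w a, w a) else 0) +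
          (if a < N \<and> \<alpha> = w (Suc a) then ?y (w (Suc a), w a, w a) else 0)" for \<alpha>
        using column_action[OF y(1) a _ top_vector_closed[OF a] a, of \<alpha>] y(2) a
        by (simp add: E_def top_vector_apply)
      have "?y (w a, w a, w a) = 0"
        using act[of "w a"] a unfolding 0 by (auto simp: zero_M_apply split: if_splits)
      moreover have "?y (w (Suc a), w a, w a) = 0" if "a < N"
        using act[of "w (Suc a)"] that unfolding 0 by (simp add: zero_M_apply)
      ultimately show ?thesis
        using a y by (intro column_factor_D) simp_all
    qed
    then have "R 0 v" using v by (simp add: R_def)
    then show ?thesis by blast
  qed
  have step: "\<exists>v'. R (Suc n) v' \<and> Q n v v'" if R: "R n v" for n v
  proof -
    let ?f = "compose (carrier (P (Suc n))) v (d n)"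
    let ?g = "\<lambda>z\<in>carrier (?C (Suc n)). z \<otimes> D a n"
    have v: "v \<in> mod_hom A (P n) (?C n)" using R by (simp add: R_def)
    have f: "?f \<in> mod_hom A (P (Suc n)) (?C n)" by (rule mod_hom_compose[OF d_hom v P_module])
    have im: "?f ` carrier (P (Suc n)) \<subseteq> ?g ` carrier (?C (Suc n))"
    proof
      fix y assume "y \<in> ?f ` carrier (P (Suc n))"
      then obtain x where "x \<in> carrier (P (Suc n))" "y = v (d n x)" by (auto simp: compose_eq)
      then have "y \<in> (\<lambda>z. z \<otimes> D a n) ` carrier (?C (Suc n))" using R unfolding R_def by blast
      then show "y \<in> ?g ` carrier (?C (Suc n))" by auto
    qed
    obtain v' where v': "v' \<in> mod_hom A (P (Suc n)) (?C (Suc n))"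
      "\<And>x. x \<in> carrier (P (Suc n)) \<Longrightarrow> ?g (v' x) = ?f x"
      by (rule projective_lift[OF P_projective E_column_fd[OF a] E_column_module[OF a]
            mult_D_hom[OF a] f im]) (rule that)
    have Q: "v' x \<otimes> D a n = v (d n x)" if "x \<in> carrier (P (Suc n))" for x
      using v'(2)[OF that] mod_homD(1)[OF v'(1) that] that by (simp add: compose_eq)
    have "v' (d (Suc n) x) \<in> (\<lambda>z. z \<otimes> D a (Suc n)) ` carrier (?C (Suc (Suc n)))"
      if x: "x \<in> carrier (P (Suc (Suc n)))" for x
    proof -
      let ?y = "v' (d (Suc n) x)"
      have y: "?y \<in> carrier A" "?y \<otimes> E a (Suc n) = ?y"
        using mod_homD(1)[OF v'(1) d_closed[OF x]] by auto
      have yD: "?y \<otimes> D a n = \<zero>"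
        using Q[OF d_closed[OF x]] x hom_P_zero[OF v E_column_module[OF a]] by (simp add: d_d)
      show ?thesis
      proof (cases "n < a")
        case True
        then have "?y \<otimes> e (a - Suc n) = ?y" "?y \<otimes> l (a - Suc n) = \<zero>"
          using y yD by (simp_all add: E_def D_def)
        then show ?thesis
          using True a y column_annihilated[of ?y "a - Suc n"] by (intro column_factor_D) auto
      next
        case False
        then have "?y = \<zero>" using y by (simp add: E_def)
        then show ?thesis by (intro image_eqI[of _ _ \<zero>]) (use a in simp_all)
      qed
    qed
    then have "R (Suc n) v'" using v'(1) by (simp add: R_def)
    then show ?thesis using Q by (auto simp: Q_def)
  qed
  obtain v where "\<forall>n. R n (v n) \<and> Q n (v n) (v (Suc n))"
    using dependent_nat_choice[of R Q, OF base step] by blast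
  then show ?thesis by (intro exI[of _ v]) (simp add: R_def Q_def del: column_module_simps)
qed

definition v :: "nat \<Rightarrow> nat \<Rightarrow> 'b \<Rightarrow> diagram \<Rightarrow> complex" where
  "v a = (SOME v. \<forall>n. (v n \<in> mod_hom A (P n) (column_module A (E a n)) \<and>
    (n = 0 \<longrightarrow> (\<forall>x\<in>carrier (P 0). v n x \<odot>\<^bsub>M\<^esub> top_vector a = \<pi> a (\<epsilon> x)))) \<and>
    (\<forall>x\<in>carrier (P (Suc n)). v (Suc n) x \<otimes> D a n = v n (d n x)))"

lemma v:
  assumes "a \<le> N"
  shows v_hom: "v a n \<in> mod_hom A (P n) (column_module A (E a n))"
    and v_0: "x \<in> carrier (P 0) \<Longrightarrow> v a 0 x \<odot>\<^bsub>M\<^esub> top_vector a = \<pi> a (\<epsilon> x)"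
    and v_d: "y \<in> carrier (P (Suc n)) \<Longrightarrow> v a n (d n y) = v a (Suc n) y \<otimes> D a n"
  using someI_ex[OF comparison_exists[OF assms], folded v_def] by auto

lemma v_closed:
  assumes "a \<le> N" "x \<in> carrier (P n)"
  shows "v a n x \<in> carrier A" "v a n x \<otimes> E a n = v a n x"
  using mod_homD(1)[OF v_hom[OF assms(1)] assms(2)] by simp_all

lemma v_mult_hom:
  assumes "a \<le> N" "left_module A L" "q \<in> carrier L"
  shows "(\<lambda>x\<in>carrier (P n). v a n x \<odot>\<^bsub>L\<^esub> q) \<in> mod_hom A (P n) L"
proof -
  interpret L: left_module A L by fact
  interpret Pn: left_module A "P n" by (rule P_module)
  show ?thesis
    using assms mod_homD(2,3)[OF v_hom[OF assms(1), of n]] v_closed(1)[OF assms(1)]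
    by (intro mod_homI) (auto simp: Pn.smult_closed L.smult_closed L.smult_l_distr L.smult_assoc)
qed

text \<open>Both \<open>l l\<close> and \<open>l r l\<close> vanish, so left multiplication by
  \<open>D\<close> does not see the part of a column that factors through \<open>l\<close>.\<close>

lemma l_kills_column:
  assumes "b < N"
  shows "l b' \<otimes> ((x \<odot> e b \<oplus> y \<odot> r b) \<otimes> l b) = \<zero>"
proof -
  have "l b' \<otimes> ((x \<odot> e b \<oplus> y \<odot> r b) \<otimes> l b) = x \<odot> (l b' \<otimes> l b) \<oplus> y \<odot> (l b' \<otimes> (r b \<otimes> l b))"
    using assms by (simp add: l_distr r_distr smult_A_mult mult_smult_A e_l)
  also have "l b' \<otimes> (r b \<otimes> l b) = \<zero>"
    using assms l_r_l[of b] by (cases "b' = b") (simp_all add: l_r_mismatch flip: m_assoc)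
  finally show ?thesis by (simp add: l_l)
qed

text \<open>The composite of the comparison maps lifts the identity of \<open>M(a)\<close> or, for
  different summands, zero. Only the coefficients of \<open>e\<close> and \<open>r\<close> are
  claimed; the rest is uncontrolled but acts by zero on the cell modules.\<close>

lemma v_p:
  assumes a: "a \<le> N" and a': "a' \<le> N" and "n \<le> a"
  shows "v a n (p a' n) (w (a - n), w (a - n), w (a - n)) = (if a = a' then 1 else 0) \<and>
    (a - n < N \<longrightarrow> v a n (p a' n) (w (Suc (a - n)), w (a - n), w (a - n)) = 0)"
  using \<open>n \<le> a\<close>
proof (induction n)
  case 0
  let ?y = "v a 0 (p a' 0)"
  have y: "?y \<in> carrier A" "?y \<otimes> e a = ?y"
    using v_closed[OF a p_closed[OF a'], of 0] by (simp_all add: E_def)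
  have "(?y \<odot>\<^bsub>M\<^esub> top_vector a) a \<alpha> = (if a = a' \<and> \<alpha> = w a then 1 else 0)" for \<alpha>
    using a a' by (simp add: v_0 \<epsilon>_p \<pi>_apply top_vector_closed top_vector_apply)
  then have "(if a = a' \<and> \<alpha> = w a then 1 else 0) = (if \<alpha> = w a then ?y (w a, w a, w a) else 0) +
      (if a < N \<and> \<alpha> = w (Suc a) then ?y (w (Suc a), w a, w a) else 0)" for \<alpha>
    using column_action[OF y(1) a y(2) top_vector_closed[OF a] a, of \<alpha>] a
    by (simp add: top_vector_apply)
  from this[of "w a"] this[of "w (Suc a)"] show ?case using a by (auto split: if_splits)
next
  case (Suc n)
  define b where "b = a - Suc n"
  have b: "a - n = Suc b" "b < N" using Suc a by (auto simp: b_def)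
  let ?y = "v a n (p a' n)" and ?Y = "v a (Suc n) (p a' (Suc n))"
  have y: "?y \<in> carrier A" "?y \<otimes> e (Suc b) = ?y"
    using v_closed[OF a p_closed[OF a'], of n] Suc b by (simp_all add: E_def)
  have Y: "?Y \<in> carrier A" "?Y \<otimes> e b = ?Y"
    using v_closed[OF a p_closed[OF a'], of "Suc n"] Suc b by (simp_all add: E_def b_def)
  let ?z = "(?y (w b, w b, w (Suc b)) \<odot> e b \<oplus> ?y (w (Suc b), w b, w (Suc b)) \<odot> r b) \<otimes> l b"
  have z: "?z \<in> carrier A" using b by simp
  have r0: "?y (w (Suc (Suc b)), w (Suc b), w (Suc b)) \<odot> r (Suc b) = \<zero>"
    using Suc b by (cases "Suc b < N") (auto simp: r_out smult_A zero_A)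
  have "?y = ?y (w (Suc b), w (Suc b), w (Suc b)) \<odot> e (Suc b) \<oplus> ?z"
    using column_decomp[OF y(1) _ y(2)] b z unfolding r0 by simp
  also have "?y (w (Suc b), w (Suc b), w (Suc b)) = (if a = a' then 1 else 0)"
    using Suc b by simp
  finally have y_eq: "?y = (if a = a' then 1 else 0) \<odot> e (Suc b) \<oplus> ?z" .
  \<comment> \<open>From the left, \<open>D\<close> kills the unknown part \<open>?z\<close>. Hence
    \<open>?Y \<otimes> l b\<close> is known, and right multiplication by \<open>l b\<close> loses
    neither of the two coefficients of \<open>?Y\<close>.\<close>
  have Dz: "D a' n \<otimes> ?z = \<zero>" using l_kills_column[OF b(2)] z by (simp add: D_def)
  have "?Y \<otimes> l b = ?Y \<otimes> D a n" using Suc by (simp add: D_def b_def)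
  also have "\<dots> = v a n (d n (p a' (Suc n)))" by (rule v_d[OF a p_closed[OF a'], symmetric])
  also have "\<dots> = D a' n \<otimes> ?y"
    using mod_homD(3)[OF v_hom[OF a] D_closed p_closed[OF a']] by (simp add: d_p a')
  also have "\<dots> = D a' n \<otimes> ((if a = a' then 1 else 0) \<odot> e (Suc b))"
    by (subst y_eq) (use b z Dz in \<open>simp add: r_distr\<close>)
  also have "\<dots> = (if a = a' then 1 else 0) \<odot> l b"
  proof (cases "a = a'")
    case True
    then have "a' - Suc n = b" "n < a'" using Suc by (simp_all add: b_def)
    then show ?thesis using True b by (simp add: D_def mult_smult_A l_e)
  next
    case False
    then show ?thesis by (simp add: smult_A_0)
  qed
  finally have "?Y \<otimes> l b = (if a = a' then 1 else 0) \<odot> l b" .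
  then show ?case
    using column_mult_l_coeffs[OF Y(1) b(2) Y(2)] b
    by (simp add: smult_A down_def single_apply flip: b_def)
qed

text \<open>The uncontrolled part of \<open>v a n (p a' n)\<close> disappears here: on
  \<open>M\<close> the element acts like the idempotent or like zero.\<close>

lemma v_p_smult_M:
  assumes "a \<le> N" "a' \<le> N" "n \<le> a" "m \<in> carrier M" "E a n \<odot>\<^bsub>M\<^esub> m = m"
  shows "v a n (p a' n) \<odot>\<^bsub>M\<^esub> m = (if a = a' then m else \<zero>\<^bsub>M\<^esub>)"
proof (rule M_ext)
  let ?y = "v a n (p a' n)"
  have y: "?y \<in> carrier A" "?y \<otimes> e (a - n) = ?y"
    using v_closed[OF assms(1) p_closed[OF assms(2)], of n] assms(3) by (simp_all add: E_def)
  show "?y \<odot>\<^bsub>M\<^esub> m \<in> carrier M" using y assms by (simp add: M.smult_closed)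
  show "(if a = a' then m else \<zero>\<^bsub>M\<^esub>) \<in> carrier M" using assms by simp
  fix i \<alpha> assume i: "i \<le> N"
  have "(?y \<odot>\<^bsub>M\<^esub> m) i \<alpha> = (if \<alpha> = w (a - n) then (if a = a' then 1 else 0) * m i (w (a - n)) else 0)"
    using column_action[OF y(1) _ y(2) assms(4) i, of \<alpha>] v_p[OF assms(1-3)] assms(1) by auto
  then show "(?y \<odot>\<^bsub>M\<^esub> m) i \<alpha> = (if a = a' then m else \<zero>\<^bsub>M\<^esub>) i \<alpha>"
    using E_smult_M[OF assms(1,4,5,3) i, of \<alpha>] i by (auto simp: zero_M_apply)
qed

text \<open>The key \<open>(a, b, s)\<close> stands for the extensions of \<open>M(a)\<close> by \<open>M(b)\<close> in degree \<open>a - b - s\<close>,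
  where \<open>s\<close> is \<open>0\<close> or \<open>1\<close>; the corresponding cocycle sends the generator of \<open>P(b + s)\<close> to the
  basis vector of \<open>M(b)\<close> on which the idempotent of \<open>b + s\<close> acts by the identity.\<close>

definition \<theta> :: "nat \<Rightarrow> ('b \<Rightarrow> nat \<Rightarrow> weight \<Rightarrow> complex) \<Rightarrow> nat \<times> nat \<times> nat \<Rightarrow> complex" where
  "\<theta> n f = (\<lambda>(a, b, s). if a \<le> N \<and> s \<le> 1 \<and> n + b + s = a then f (p a n) b (w (b + s)) else 0)"

section \<open>Ext classes and their values on the generators\<close>

lemma cocycle_hom: "f \<in> carrier (C n) \<Longrightarrow> f \<in> mod_hom A (P n) M"
  by (simp add: carrier_C)

lemma hom_generator:
  assumes "f \<in> mod_hom A (P n) M" "a \<le> N"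
  shows "f (p a n) \<in> carrier M" "E a n \<odot>\<^bsub>M\<^esub> f (p a n) = f (p a n)"
  using assms mod_homD(1)[OF assms(1)] mod_homD(3)[OF assms(1), of "E a n" "p a n"]
  by (simp_all add: E_p)

lemma \<theta>_apply: "\<theta> n f (a, b, s) = (if a \<le> N \<and> s \<le> 1 \<and> n + b + s = a then f (p a n) b (w (b + s)) else 0)"
  by (simp add: \<theta>_def)

text \<open>A vector fixed by \<open>E a n\<close> is supported at \<open>w (a - n)\<close>, which
  occurs only in \<open>M(a - n)\<close> and \<open>M(a - n - 1)\<close>, in one dimension each.
  These two coordinates are the ones recorded with \<open>s = 0\<close> and
  \<open>s = 1\<close>.\<close>

lemma \<theta>_eq_generators:
  assumes f: "f \<in> mod_hom A (P n) M" and g: "g \<in> mod_hom A (P n) M" and eq: "\<theta> n f = \<theta> n g"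
    and a: "a \<le> N"
  shows "f (p a n) = g (p a n)"
proof (cases "n \<le> a")
  case True
  show ?thesis
  proof (rule M_eqI[OF hom_generator(1)[OF f a] hom_generator(1)[OF g a]])
    fix i assume i: "i \<le> N"
    show "f (p a n) i (w i) = g (p a n) i (w i)"
    proof (cases "i = a - n")
      case eqi: True
      then show ?thesis using fun_cong[OF eq, of "(a, i, 0)"] True a by (simp add: \<theta>_apply)
    next
      case False
      then have "w i \<noteq> w (a - n)" using i a by simp
      then show ?thesis
        using E_smult_M[OF a hom_generator[OF f a] True i] E_smult_M[OF a hom_generator[OF g a] True i]
        by simp
    qed
  next
    fix i assume i: "i < N"
    show "f (p a n) i (w (Suc i)) = g (p a n) i (w (Suc i))"
    proof (cases "Suc i = a - n")
      case eqi: True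
      then have "n + i + 1 = a" using True by simp
      then show ?thesis using fun_cong[OF eq, of "(a, i, 1)"] a by (simp add: \<theta>_apply)
    next
      case False
      then have "w (Suc i) \<noteq> w (a - n)" "i \<le> N" using i a by simp_all
      then show ?thesis
        using E_smult_M[OF a hom_generator[OF f a] True] E_smult_M[OF a hom_generator[OF g a] True]
        by simp
    qed
  qed
next
  case False
  then show ?thesis using a hom_P_zero[OF f M_module] hom_P_zero[OF g M_module] by (simp add: p_out)
qed

text \<open>The differential of a generator is \<open>D a m\<close> times a generator, and every
  \<open>D\<close> acts by zero on \<open>M\<close>.\<close>

lemma coboundary_generator:
  assumes "f \<in> B n" "a \<le> N"
  shows "f (p a n) = \<zero>\<^bsub>M\<^esub>"
proof (cases n)
  case 0
  then show ?thesis using assms by (simp add: coboundaries_def)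
next
  case (Suc m)
  then obtain g where g: "g \<in> mod_hom A (P m) M" "f = compose (carrier (P (Suc m))) g (d m)"
    using assms by (auto simp: coboundaries_def)
  have "f (p a (Suc m)) = g (D a m \<odot>\<^bsub>P m\<^esub> p a m)"
    using assms(2) g by (simp add: compose_eq d_p)
  also have "\<dots> = \<zero>\<^bsub>M\<^esub>"
    using assms(2) mod_homD(3)[OF g(1) D_closed p_closed] hom_generator(1)[OF g(1)]
    by (simp add: D_smult_M)
  finally show ?thesis using Suc by simp
qed

lemma coboundary_cocycle:
  assumes "f \<in> B n"
  shows "f \<in> carrier (C n)"
proof (cases n)
  case 0
  then show ?thesis using assms C_zero_closed[of 0] by (simp add: coboundaries_def)
next
  case (Suc m)
  then obtain g where g: "g \<in> mod_hom A (P m) M" "f = compose (carrier (P (Suc m))) g (d m)"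
    using assms by (auto simp: coboundaries_def)
  have "f \<in> mod_hom A (P n) M"
    unfolding g(2) Suc by (rule mod_hom_compose[OF d_hom g(1) P_module])
  moreover have "f (d n x) = \<zero>\<^bsub>M\<^esub>" if "x \<in> carrier (P (Suc n))" for x
    using that Suc g by (simp add: compose_eq d_closed d_d hom_P_zero[OF g(1) M_module])
  ultimately show ?thesis by (simp add: carrier_C)
qed

text \<open>The identity of \<open>P\<close> minus the sum over \<open>a\<close> of the round trips
  through the minimal resolutions. The nested restrictions follow the form of the closure lemmas for
  pointwise differences and sums.\<close>

definition complement :: "nat \<Rightarrow> 'b \<Rightarrow> 'b" where
  "complement n = (\<lambda>x\<in>carrier (P n). (\<lambda>x\<in>carrier (P n). x) x \<ominus>\<^bsub>P n\<^esub>
    (\<lambda>x\<in>carrier (P n). \<Oplus>\<^bsub>P n\<^esub>a\<in>{0..N}. (\<lambda>x\<in>carrier (P n). v a n x \<odot>\<^bsub>P n\<^esub> p a n) x) x)"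

lemma identity_hom: "(\<lambda>x\<in>carrier (P n). x) \<in> mod_hom A (P n) (P n)"
proof -
  interpret Pn: left_module A "P n" by (rule P_module)
  show ?thesis by (intro mod_homI) (simp_all add: Pn.smult_closed)
qed

lemma complement_hom: "complement n \<in> mod_hom A (P n) (P n)"
  unfolding complement_def
proof (rule mod_hom_pointwise_diff[OF P_module P_module identity_hom])
  show "(\<lambda>x\<in>carrier (P n). \<Oplus>\<^bsub>P n\<^esub>a\<in>{0..N}. (\<lambda>x\<in>carrier (P n). v a n x \<odot>\<^bsub>P n\<^esub> p a n) x)
      \<in> mod_hom A (P n) (P n)"
  proof (rule mod_hom_pointwise_finsum[OF P_module P_module])
    show "(\<lambda>x\<in>carrier (P n). v a n x \<odot>\<^bsub>P n\<^esub> p a n) \<in> mod_hom A (P n) (P n)"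
      if "a \<in> {0..N}" for a
      using that by (intro v_mult_hom[OF _ P_module]) auto
  qed simp
qed

lemma complement_apply:
  assumes "x \<in> carrier (P n)"
  shows "complement n x = x \<ominus>\<^bsub>P n\<^esub> (\<Oplus>\<^bsub>P n\<^esub>a\<in>{0..N}. v a n x \<odot>\<^bsub>P n\<^esub> p a n)"
proof -
  interpret Pn: left_module A "P n" by (rule P_module)
  have "(\<Oplus>\<^bsub>P n\<^esub>a\<in>{0..N}. (\<lambda>x\<in>carrier (P n). v a n x \<odot>\<^bsub>P n\<^esub> p a n) x) =
      (\<Oplus>\<^bsub>P n\<^esub>a\<in>{0..N}. v a n x \<odot>\<^bsub>P n\<^esub> p a n)"
    using assms by (intro Pn.M.finsum_cong') (auto simp: v_closed Pn.smult_closed)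
  then show ?thesis using assms by (simp add: complement_def)
qed

text \<open>Stated for a general target because it is applied to the differentials, to
  \<open>\<epsilon>\<close> and to cocycles.\<close>

lemma hom_complement:
  assumes f: "f \<in> mod_hom A (P n) L" and L: "left_module A L" and x: "x \<in> carrier (P n)"
  shows "f (complement n x) = f x \<ominus>\<^bsub>L\<^esub> (\<Oplus>\<^bsub>L\<^esub>a\<in>{0..N}. v a n x \<odot>\<^bsub>L\<^esub> f (p a n))"
proof -
  interpret Pn: left_module A "P n" by (rule P_module)
  interpret L: left_module A L by (rule L)
  have F: "(\<lambda>a. v a n x \<odot>\<^bsub>P n\<^esub> p a n) \<in> {0..N} \<rightarrow> carrier (P n)"
    using x by (auto simp: v_closed Pn.smult_closed)
  have "f (complement n x) = f x \<ominus>\<^bsub>L\<^esub> f (\<Oplus>\<^bsub>P n\<^esub>a\<in>{0..N}. v a n x \<odot>\<^bsub>P n\<^esub> p a n)"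
    using x F by (simp add: complement_apply mod_hom_diff[OF P_module L f] Pn.M.finsum_closed)
  also have "f (\<Oplus>\<^bsub>P n\<^esub>a\<in>{0..N}. v a n x \<odot>\<^bsub>P n\<^esub> p a n) = (\<Oplus>\<^bsub>L\<^esub>a\<in>{0..N}. f (v a n x \<odot>\<^bsub>P n\<^esub> p a n))"
    by (rule mod_hom_finsum[OF P_module L f _ F]) simp
  also have "\<dots> = (\<Oplus>\<^bsub>L\<^esub>a\<in>{0..N}. v a n x \<odot>\<^bsub>L\<^esub> f (p a n))"
    using x mod_homD(1)[OF f] mod_homD(3)[OF f]
    by (intro L.M.finsum_cong') (auto simp: v_closed L.smult_closed)
  finally show ?thesis .
qed

text \<open>Both comparison maps are chain maps: the factor \<open>D a n\<close> moves from
  \<open>p\<close> to \<open>v\<close> across the action.\<close>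

lemma complement_chain:
  assumes x: "x \<in> carrier (P (Suc n))"
  shows "d n (complement (Suc n) x) = complement n (d n x)"
proof -
  interpret Pn: left_module A "P n" by (rule P_module)
  have "(\<Oplus>\<^bsub>P n\<^esub>a\<in>{0..N}. v a (Suc n) x \<odot>\<^bsub>P n\<^esub> d n (p a (Suc n))) =
      (\<Oplus>\<^bsub>P n\<^esub>a\<in>{0..N}. v a n (d n x) \<odot>\<^bsub>P n\<^esub> p a n)"
    using x
    by (intro Pn.M.finsum_cong')
      (auto simp: v_closed Pn.smult_closed d_closed v_d d_p Pn.smult_assoc)
  then show ?thesis
    by (simp add: hom_complement[OF d_hom P_module x] complement_apply d_closed[OF x])
qed

text \<open>The round trips cover the projections of \<open>M\<close> onto its summands, and these
  add up to the identity.\<close>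

lemma complement_augmentation:
  assumes x: "x \<in> carrier (P 0)"
  shows "\<epsilon> (complement 0 x) = \<zero>\<^bsub>M\<^esub>"
proof -
  have "(\<Oplus>\<^bsub>M\<^esub>a\<in>{0..N}. v a 0 x \<odot>\<^bsub>M\<^esub> \<epsilon> (p a 0)) = (\<Oplus>\<^bsub>M\<^esub>a\<in>{0..N}. \<pi> a (\<epsilon> x))"
    using x by (intro M.M.finsum_cong') (auto simp: \<epsilon>_p v_0 \<pi>_closed \<epsilon>_closed)
  also have "\<dots> = \<epsilon> x"
  proof (rule M_ext)
    fix i \<alpha> assume i: "i \<le> N"
    have "(\<Oplus>\<^bsub>M\<^esub>a\<in>{0..N}. \<pi> a (\<epsilon> x)) i \<alpha> = (\<Sum>a\<in>{0..N}. \<pi> a (\<epsilon> x) i \<alpha>)"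
      using x i by (intro finsum_M_apply) (auto simp: \<pi>_closed \<epsilon>_closed)
    also have "\<dots> = (\<Sum>a\<in>{0..N}. if i = a then \<epsilon> x i \<alpha> else 0)"
      using x i by (intro sum.cong) (auto simp: \<pi>_apply \<epsilon>_closed)
    also have "\<dots> = \<epsilon> x i \<alpha>" using i by simp
    finally show "(\<Oplus>\<^bsub>M\<^esub>a\<in>{0..N}. \<pi> a (\<epsilon> x)) i \<alpha> = \<epsilon> x i \<alpha>" .
  qed (use x in \<open>auto simp: \<pi>_closed \<epsilon>_closed intro!: M.M.finsum_closed\<close>)
  finally show ?thesis
    using x \<epsilon>_closed[OF x] by (simp add: hom_complement[OF \<epsilon>_hom M_module] a_minus_def M.M.r_neg)
qed

text \<open>The map \<open>complement\<close> covers zero and is therefore null-homotopic. A cocycle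
  vanishing on the generators is unchanged by composition with it, and a cocycle after a
  null-homotopic map is a coboundary.\<close>

lemma generators_detect_coboundary:
  assumes f: "f \<in> carrier (C n)" and 0: "\<And>a. a \<le> N \<Longrightarrow> f (p a n) = \<zero>\<^bsub>M\<^esub>"
  shows "f \<in> B n"
proof -
  have hom: "f \<in> mod_hom A (P n) M" using f by (rule cocycle_hom)
  have cocycle: "f (d n x) = \<zero>\<^bsub>M\<^esub>" if "x \<in> carrier (P (Suc n))" for x
    using f that by (simp add: carrier_C)
  have fc: "f (complement n x) = f x" if x: "x \<in> carrier (P n)" for x
  proof -
    have "(\<Oplus>\<^bsub>M\<^esub>a\<in>{0..N}. v a n x \<odot>\<^bsub>M\<^esub> f (p a n)) = (\<Oplus>\<^bsub>M\<^esub>a\<in>{0..N}. \<zero>\<^bsub>M\<^esub>)"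
      using x 0 by (intro M.M.finsum_cong') (auto simp: v_closed M.smult_zero_right)
    also have "\<dots> = \<zero>\<^bsub>M\<^esub>" by (rule M.M.finsum_zero)
    finally show ?thesis
      using x mod_homD(1)[OF hom x] by (simp add: hom_complement[OF hom M_module] a_minus_def)
  qed
  obtain h where h: "\<And>k. h k \<in> mod_hom A (P k) (P (Suc k))"
    "\<And>x. x \<in> carrier (P 0) \<Longrightarrow> complement 0 x = d 0 (h 0 x)"
    "\<And>k x. x \<in> carrier (P (Suc k)) \<Longrightarrow>
      complement (Suc k) x = d (Suc k) (h (Suc k) x) \<oplus>\<^bsub>P (Suc k)\<^esub> h k (d k x)"
    using null_homotopic[of complement] complement_hom complement_augmentation complement_chain
    by metis
  note h_closed = mod_homD(1)[OF h(1)]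
  show ?thesis
  proof (cases n)
    case 0
    have "f = (\<lambda>x\<in>carrier (P 0). \<zero>\<^bsub>M\<^esub>)"
    proof (rule extensionalityI[OF mod_homD(4)[OF hom]])
      fix x assume x: "x \<in> carrier (P n)"
      then have "f x = f (d 0 (h 0 x))" using fc[OF x] h(2) 0 by simp
      also have "\<dots> = \<zero>\<^bsub>M\<^esub>" using cocycle[of "h 0 x"] h_closed[of x 0] x 0 by simp
      finally show "f x = (\<lambda>x\<in>carrier (P 0). \<zero>\<^bsub>M\<^esub>) x" using x 0 by simp
    qed (simp add: 0)
    then show ?thesis using 0 by (simp add: coboundaries_def)
  next
    case (Suc m)
    \<comment> \<open>Of the two terms of the homotopy, \<open>f\<close> kills
      \<open>d (h x)\<close>; the other one exhibits \<open>f\<close> as the coboundary of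
      \<open>f\<close> after \<open>h m\<close>.\<close>
    let ?g = "compose (carrier (P m)) f (h m)"
    have g: "?g \<in> mod_hom A (P m) M"
      using hom unfolding Suc by (rule mod_hom_compose[OF h(1) _ P_module])
    have "f = compose (carrier (P (Suc m))) ?g (d m)"
    proof (rule extensionalityI[OF mod_homD(4)[OF hom]])
      fix x assume "x \<in> carrier (P n)"
      then have x: "x \<in> carrier (P (Suc m))" using Suc by simp
      have hx: "h (Suc m) x \<in> carrier (P (Suc n))" "h m (d m x) \<in> carrier (P n)"
        using h_closed[OF x] h_closed[OF d_closed[OF x]] Suc by simp_all
      have "f x = f (d n (h (Suc m) x) \<oplus>\<^bsub>P n\<^esub> h m (d m x))"
        using fc[of x] h(3)[OF x] x Suc by simp
      also have "\<dots> = f (d n (h (Suc m) x)) \<oplus>\<^bsub>M\<^esub> f (h m (d m x))"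
        using hx d_closed[OF hx(1)] by (intro mod_homD(2)[OF hom])
      also have "\<dots> = f (h m (d m x))"
        using cocycle[OF hx(1)] mod_homD(1)[OF hom hx(2)] by simp
      finally show "f x = compose (carrier (P (Suc m))) ?g (d m) x"
        using x by (simp add: compose_eq d_closed)
    qed (simp add: Suc compose_def)
    then show ?thesis using g Suc by (auto simp: coboundaries_def)
  qed
qed

lemma scalar_M_apply:
  assumes "m \<in> carrier M" "i \<le> N"
  shows "scalar A M c m i \<alpha> = c * m i \<alpha>"
  using assms by (simp add: scalar_def smult_M_scale M.smult_one)

text \<open>The kernel condition joins two facts: coboundaries vanish on all generators, and a
  cocycle vanishing there is a coboundary.\<close>

sublocale Ext: coordinatized_quotient "C n" "B n" "\<theta> n" for n
proof
  show "carrier (C n) \<noteq> {}" using C_zero_closed by blast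
  show "f \<oplus>\<^bsub>C n\<^esub> g \<in> carrier (C n)" if "f \<in> carrier (C n)" "g \<in> carrier (C n)" for f g
    using that by (rule C_add_closed)
  show "\<exists>b\<in>carrier (C n). f = b \<oplus>\<^bsub>C n\<^esub> g" if "f \<in> carrier (C n)" "g \<in> carrier (C n)" for f g
    using that by (rule C_diff)
  show "c \<odot>\<^bsub>C n\<^esub> f \<in> carrier (C n)" if "f \<in> carrier (C n)" for f c
    using that by (rule C_smult_closed)
  show "\<theta> n (f \<oplus>\<^bsub>C n\<^esub> g) k = \<theta> n f k + \<theta> n g k"
    if "f \<in> carrier (C n)" "g \<in> carrier (C n)" for f g k
    by (cases k) (simp add: \<theta>_apply add_C add_M_apply)
  show "\<theta> n (c \<odot>\<^bsub>C n\<^esub> f) k = c * \<theta> n f k" if "f \<in> carrier (C n)" for f c k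
    using that hom_generator(1)[OF cocycle_hom]
    by (cases k) (simp add: \<theta>_apply smult_C scalar_M_apply)
  show "B n = {f \<in> carrier (C n). \<forall>k. \<theta> n f k = 0}"
  proof (intro equalityI subsetI)
    fix f assume f: "f \<in> B n"
    then have "\<theta> n f k = 0" for k
      by (cases k) (simp add: \<theta>_apply coboundary_generator zero_M_apply)
    then show "f \<in> {f \<in> carrier (C n). \<forall>k. \<theta> n f k = 0}" using f coboundary_cocycle by blast
  next
    fix f assume "f \<in> {f \<in> carrier (C n). \<forall>k. \<theta> n f k = 0}"
    then have f: "f \<in> carrier (C n)" "\<And>k. \<theta> n f k = 0" by auto
    let ?z = "\<lambda>x\<in>carrier (P n). \<zero>\<^bsub>M\<^esub>"
    have "\<theta> n ?z k = 0" for k by (cases k) (simp add: \<theta>_apply zero_M_apply)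
    then have "\<theta> n f = \<theta> n ?z" using f(2) by (simp add: fun_eq_iff)
    then have "f (p a n) = \<zero>\<^bsub>M\<^esub>" if "a \<le> N" for a
      using \<theta>_eq_generators[OF cocycle_hom[OF f(1)] cocycle_hom[OF C_zero_closed] _ that] that by simp
    then show "f \<in> B n" by (rule generators_detect_coboundary[OF f(1)])
  qed
qed

text \<open>The sum over \<open>a\<close> of \<open>v a n\<close> acting on \<open>m a\<close>. It
  is a cocycle because \<open>v\<close> turns \<open>d\<close> into multiplication by
  \<open>D\<close>, which acts by zero on \<open>M\<close>.\<close>

lemma cocycle_with_values:
  assumes m: "\<And>a. a \<le> N \<Longrightarrow> n \<le> a \<Longrightarrow> m a \<in> carrier M \<and> E a n \<odot>\<^bsub>M\<^esub> m a = m a"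
  shows "\<exists>f\<in>carrier (C n). \<forall>a\<in>{n..N}. f (p a n) = m a"
proof -
  interpret Pn: left_module A "P n" by (rule P_module)
  let ?f = "\<lambda>x\<in>carrier (P n). \<Oplus>\<^bsub>M\<^esub>a\<in>{n..N}. (\<lambda>x\<in>carrier (P n). v a n x \<odot>\<^bsub>M\<^esub> m a) x"
  have hom: "?f \<in> mod_hom A (P n) M"
    using m by (intro mod_hom_pointwise_finsum[OF P_module M_module] v_mult_hom[OF _ M_module]) auto
  have "(\<Oplus>\<^bsub>M\<^esub>a\<in>{n..N}. (\<lambda>x\<in>carrier (P n). v a n x \<odot>\<^bsub>M\<^esub> m a) (d n x)) = \<zero>\<^bsub>M\<^esub>"
    if x: "x \<in> carrier (P (Suc n))" for x
  proof -
    have "(\<Oplus>\<^bsub>M\<^esub>a\<in>{n..N}. (\<lambda>x\<in>carrier (P n). v a n x \<odot>\<^bsub>M\<^esub> m a) (d n x)) = (\<Oplus>\<^bsub>M\<^esub>a\<in>{n..N}. \<zero>\<^bsub>M\<^esub>)"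
      using x m
      by (intro M.M.finsum_cong')
        (auto simp: d_closed v_d M.smult_assoc v_closed D_smult_M M.smult_zero_right)
    also have "\<dots> = \<zero>\<^bsub>M\<^esub>" by (rule M.M.finsum_zero)
    finally show ?thesis .
  qed
  then have f1: "?f \<in> carrier (C n)" using hom by (simp add: carrier_C d_closed)
  have f2: "?f (p a' n) = m a'" if a': "n \<le> a'" "a' \<le> N" for a'
  proof -
    have "?f (p a' n) = (\<Oplus>\<^bsub>M\<^esub>a\<in>{n..N}. if a = a' then m a else \<zero>\<^bsub>M\<^esub>)"
      using a' m by (simp, intro M.M.finsum_cong') (auto simp: v_p_smult_M)
    also have "\<dots> = (\<Oplus>\<^bsub>M\<^esub>a\<in>{n..N}. if a' = a then m a else \<zero>\<^bsub>M\<^esub>)"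
      using m by (intro M.M.finsum_cong') auto
    also have "\<dots> = m a'"
      using a' m by (intro M.M.finsum_singleton) auto
    finally show ?thesis .
  qed
  show ?thesis by (rule bexI[OF _ f1]) (use f2 in \<open>auto simp del: restrict_apply\<close>)
qed

text \<open>From degree \<open>i\<close> on, the minimal resolution of \<open>M(a)\<close> is that
  of \<open>M(a - i)\<close>. On it, \<open>\<phi>\<close> and the explicit lift through
  \<open>p\<close> and \<open>U\<close> cover the same map, so they differ by a homotopy. The error
  term is this homotopy evaluated on a generator: \<open>b\<close> is zero or a differential
  \<open>D\<close>, which squares to zero and kills \<open>M\<close>.\<close>

lemma chain_lift_generator:
  assumes a: "i \<le> a" "a \<le> N" and \<phi>: "\<phi> \<in> chain_lifts A P d \<epsilon> i f"
    and f: "f (p a i) = scalar A M \<alpha> (top_vector (a - i)) \<oplus>\<^bsub>M\<^esub>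
      scalar A M \<beta> (U (a - i) 0 \<odot>\<^bsub>M\<^esub> top_vector (a - i - 1))"
  shows "\<exists>h\<in>carrier (P (Suc k)). \<exists>h'\<in>carrier (P k). \<exists>b\<in>carrier A.
    D (a - i) k \<otimes> b = \<zero> \<and> (\<forall>m\<in>carrier M. b \<odot>\<^bsub>M\<^esub> m = \<zero>\<^bsub>M\<^esub>) \<and>
    \<phi> k (p a (i + k)) = scalar A (P k) \<alpha> (p (a - i) k) \<oplus>\<^bsub>P k\<^esub>
      scalar A (P k) \<beta> (U (a - i) k \<odot>\<^bsub>P k\<^esub> p (a - i - 1) k) \<oplus>\<^bsub>P k\<^esub> (d k h \<oplus>\<^bsub>P k\<^esub> b \<odot>\<^bsub>P k\<^esub> h')"
proof -
  \<comment> \<open>For \<open>c = 0\<close> the truncated \<open>c'\<close> does no harm, because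
    \<open>U c k\<close> is then zero.\<close>
  define c c' where "c = a - i" and "c' = c - 1"
  have c: "c \<le> N" "c' \<le> N" using a by (auto simp: c_def c'_def)
  note f' = f[folded c_def, folded c'_def]
  define z where "z = (\<lambda>k. scalar A (P k) \<alpha> (p c k) \<oplus>\<^bsub>P k\<^esub>
      scalar A (P k) \<beta> (U c k \<odot>\<^bsub>P k\<^esub> p (c') k))"
  have z_closed: "z k \<in> carrier (P k)" for k
  proof -
    interpret Pk: left_module A "P k" by (rule P_module)
    show ?thesis using c by (simp add: z_def scalar_in P_module smult_P_closed)
  qed
  have \<phi>_hom: "\<phi> k \<in> mod_hom A (P (i + k)) (P k)" for k using \<phi> by (simp add: chain_lifts_def)
  have \<phi>_closed: "\<phi> k (p a (i + k)) \<in> carrier (P k)" for k using mod_homD(1)[OF \<phi>_hom] a by simp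
  have d_\<phi>: "d k (\<phi> (Suc k) (p a (i + Suc k))) = D c k \<odot>\<^bsub>P k\<^esub> \<phi> k (p a (i + k))" for k
  proof -
    have "d k (\<phi> (Suc k) (p a (i + Suc k))) = \<phi> k (d (i + k) (p a (Suc (i + k))))"
      using \<phi> p_closed[OF a(2), of "Suc (i + k)"] by (simp add: chain_lifts_def)
    also have "\<dots> = D a (i + k) \<odot>\<^bsub>P k\<^esub> \<phi> k (p a (i + k))"
      using a by (simp add: d_p mod_homD(3)[OF \<phi>_hom])
    also have "D a (i + k) = D c k" using a by (auto simp: D_def c_def)
    finally show ?thesis .
  qed
  have d_z: "d k (z (Suc k)) = D c k \<odot>\<^bsub>P k\<^esub> z k" for k
  proof -
    interpret Pk: left_module A "P k" by (rule P_module)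
    have "d k (U c (Suc k) \<odot>\<^bsub>P (Suc k)\<^esub> p (c') (Suc k)) = (U c (Suc k) \<otimes> D (c') k) \<odot>\<^bsub>P k\<^esub> p (c') k"
      using c by (simp add: smult_d d_p smult_P_assoc)
    also have "U c (Suc k) \<otimes> D (c') k = D c k \<otimes> U c k"
      using c D_Suc[of c' k] D_U[of c k] by (cases c) (simp_all add: U_def c'_def)
    finally have U: "d k (U c (Suc k) \<odot>\<^bsub>P (Suc k)\<^esub> p (c') (Suc k)) =
        D c k \<odot>\<^bsub>P k\<^esub> (U c k \<odot>\<^bsub>P k\<^esub> p (c') k)"
      using c by (simp add: smult_P_assoc)
    have "d k (z (Suc k)) = scalar A (P k) \<alpha> (d k (p c (Suc k))) \<oplus>\<^bsub>P k\<^esub>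
        scalar A (P k) \<beta> (d k (U c (Suc k) \<odot>\<^bsub>P (Suc k)\<^esub> p (c') (Suc k)))"
      using c by (simp add: z_def mod_homD(2)[OF d_hom] mod_hom_scalar[OF d_hom] scalar_in P_module smult_P_closed)
    also have "\<dots> = D c k \<odot>\<^bsub>P k\<^esub> z k"
      using c by (simp add: z_def U d_p Pk.smult_r_distr smult_scalar P_module scalar_in smult_P_closed)
    finally show ?thesis .
  qed
  have "\<exists>h\<in>carrier (P (Suc k)). \<exists>h'\<in>carrier (P k). \<exists>b\<in>carrier A.
    D c k \<otimes> b = \<zero> \<and> (\<forall>m\<in>carrier M. b \<odot>\<^bsub>M\<^esub> m = \<zero>\<^bsub>M\<^esub>) \<and>
    \<phi> k (p a (i + k)) = z k \<oplus>\<^bsub>P k\<^esub> (d k h \<oplus>\<^bsub>P k\<^esub> b \<odot>\<^bsub>P k\<^esub> h')"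
  proof (induction k)
    case 0
    interpret P0: left_module A "P 0" by (rule P_module)
    let ?x = "\<phi> 0 (p a i) \<ominus>\<^bsub>P 0\<^esub> z 0"
    have x0: "\<phi> 0 (p a i) \<in> carrier (P 0)" using \<phi>_closed[of 0] by simp
    have "\<epsilon> (z 0) = f (p a i)"
      using c by (simp add: f' z_def mod_homD(2,3)[OF \<epsilon>_hom] mod_hom_scalar[OF \<epsilon>_hom] scalar_in
          P_module smult_P_closed \<epsilon>_p)
    moreover have "\<epsilon> (\<phi> 0 (p a i)) = f (p a i)" using \<phi> a by (simp add: chain_lifts_def)
    moreover have "\<epsilon> ?x = \<epsilon> (\<phi> 0 (p a i)) \<ominus>\<^bsub>M\<^esub> \<epsilon> (z 0)"
      by (rule mod_hom_diff[OF P_module M_module \<epsilon>_hom x0 z_closed])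
    ultimately have "\<epsilon> ?x = \<zero>\<^bsub>M\<^esub>"
      using \<epsilon>_closed[OF x0] by (simp add: a_minus_def M.M.r_neg)
    then obtain h where h: "h \<in> carrier (P (Suc 0))" "d 0 h = ?x"
      using exact_0[of ?x] x0 z_closed[of 0] by auto
    have "\<phi> 0 (p a i) = z 0 \<oplus>\<^bsub>P 0\<^esub> ?x"
      by (rule P0.add_diff_cancel[OF x0 z_closed, symmetric])
    then have "\<phi> 0 (p a (i + 0)) = z 0 \<oplus>\<^bsub>P 0\<^esub> (d 0 h \<oplus>\<^bsub>P 0\<^esub> \<zero> \<odot>\<^bsub>P 0\<^esub> \<zero>\<^bsub>P 0\<^esub>)"
      using h x0 z_closed[of 0] by (simp add: smult_P_zero)
    then show ?case
      using h by (intro bexI[of _ h] bexI[of _ "\<zero>\<^bsub>P 0\<^esub>"] bexI[of _ \<zero>])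
        (auto simp: M.smult_zero_left)
  next
    case (Suc k)
    then obtain h h' b where IH: "h \<in> carrier (P (Suc k))" "h' \<in> carrier (P k)" "b \<in> carrier A"
      "D c k \<otimes> b = \<zero>" "\<phi> k (p a (i + k)) = z k \<oplus>\<^bsub>P k\<^esub> (d k h \<oplus>\<^bsub>P k\<^esub> b \<odot>\<^bsub>P k\<^esub> h')"
      by auto
    interpret P0: left_module A "P k" by (rule P_module)
    interpret P1: left_module A "P (Suc k)" by (rule P_module)
    let ?y = "\<phi> (Suc k) (p a (i + Suc k))"
    let ?g = "D c k \<odot>\<^bsub>P (Suc k)\<^esub> h"
    \<comment> \<open>\<open>?g\<close> is the previous homotopy applied to the differential of the
      generator. Subtracting it leaves a cycle, hence a boundary.\<close>
    let ?x = "(?y \<ominus>\<^bsub>P (Suc k)\<^esub> z (Suc k)) \<ominus>\<^bsub>P (Suc k)\<^esub> ?g"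
    have cl: "?y \<in> carrier (P (Suc k))" "z (Suc k) \<in> carrier (P (Suc k))" "?g \<in> carrier (P (Suc k))"
      "D c k \<odot>\<^bsub>P k\<^esub> z k \<in> carrier (P k)" "d k ?g \<in> carrier (P k)"
      using \<phi>_closed[of "Suc k"] z_closed IH d_closed by (simp_all add: smult_P_closed)
    have "D c k \<odot>\<^bsub>P k\<^esub> \<phi> k (p a (i + k)) = D c k \<odot>\<^bsub>P k\<^esub> z k \<oplus>\<^bsub>P k\<^esub> d k ?g"
      using IH z_closed[of k] d_closed[OF IH(1)]
      by (simp add: P0.smult_r_distr P0.smult_closed smult_d P0.smult_zero_left flip: P0.smult_assoc)
    then have dy: "d k ?y = d k (z (Suc k)) \<oplus>\<^bsub>P k\<^esub> d k ?g" by (simp only: d_\<phi> d_z)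
    have "d k ?x = (d k ?y \<ominus>\<^bsub>P k\<^esub> d k (z (Suc k))) \<ominus>\<^bsub>P k\<^esub> d k ?g"
      using cl by (simp add: mod_hom_diff[OF P_module P_module d_hom])
    also have "\<dots> = \<zero>\<^bsub>P k\<^esub>"
      using cl d_closed[OF cl(2)] unfolding dy
      by (simp add: a_minus_def P0.M.a_ac P0.M.r_neg P0.M.r_neg2)
    finally have "d k ?x = \<zero>\<^bsub>P k\<^esub>" .
    then obtain h2 where h2: "h2 \<in> carrier (P (Suc (Suc k)))" "d (Suc k) h2 = ?x"
      using exact_Suc[of ?x k] cl by auto
    have "?y = z (Suc k) \<oplus>\<^bsub>P (Suc k)\<^esub> (?x \<oplus>\<^bsub>P (Suc k)\<^esub> ?g)"
      using cl by (simp add: P1.diff_add_cancel P1.add_diff_cancel)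
    then show ?case
      \<comment> \<open>The previous \<open>h\<close> takes the place of \<open>h'\<close>, with
        \<open>D c k\<close> in the role of \<open>b\<close>.\<close>
      using h2 IH by (intro bexI[of _ h2] bexI[of _ h] bexI[of _ "D c k"])
        (auto simp: D_D D_smult_M)
  qed
  then show ?thesis unfolding z_def c'_def c_def .
qed

text \<open>The basis vector at \<open>w (a - i)\<close> in \<open>M(a - i - 1)\<close> is the image
  of the top vector under \<open>r\<close>. Writing it with \<open>U\<close> puts the value into the
  form that lifts to a chain map.\<close>

lemma generator_value:
  assumes f: "f \<in> carrier (C i)" and a: "i \<le> a" "a \<le> N"
  shows "f (p a i) = scalar A M (\<theta> i f (a, a - i, 0)) (top_vector (a - i)) \<oplus>\<^bsub>M\<^esub>
    scalar A M (\<theta> i f (a, a - i - 1, 1)) (U (a - i) 0 \<odot>\<^bsub>M\<^esub> top_vector (a - i - 1))"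
proof -
  define c c' where "c = a - i" and "c' = c - 1"
  have c: "c \<le> N" "c' \<le> N" using a by (auto simp: c_def c'_def)
  note top = top_vector_closed[OF c(1)] top_vector_closed[OF c(2)]
  have Ut: "U c 0 \<odot>\<^bsub>M\<^esub> top_vector c' \<in> carrier M" using top by (simp add: M.smult_closed)
  have U_apply: "(U c 0 \<odot>\<^bsub>M\<^esub> top_vector c') k \<alpha> = (if Suc k = c \<and> \<alpha> = w c then 1 else 0)"
    if "k \<le> N" for k \<alpha>
    using that c top by (cases c) (auto simp: U_def c'_def r_smult_M top_vector_apply M.smult_zero_left zero_M_apply)
  have fc: "f (p a i) \<in> carrier M" "E a i \<odot>\<^bsub>M\<^esub> f (p a i) = f (p a i)"
    using hom_generator[OF cocycle_hom[OF f] a(2)] by auto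
  have zero: "f (p a i) k \<alpha> = 0" if "k \<le> N" "\<alpha> \<noteq> w c" for k \<alpha>
    using E_smult_M[OF a(2) fc a(1) that(1)] that(2) by (simp add: c_def)
  have "f (p a i) = scalar A M (\<theta> i f (a, c, 0)) (top_vector c) \<oplus>\<^bsub>M\<^esub>
    scalar A M (\<theta> i f (a, c', 1)) (U c 0 \<odot>\<^bsub>M\<^esub> top_vector c')" (is "_ = ?R")
  proof (rule M_eqI[OF fc(1)])
    show "?R \<in> carrier M" using top Ut by (simp add: scalar_in M_module)
    have R: "?R k \<alpha> = \<theta> i f (a, c, 0) * (if k = c \<and> \<alpha> = w c then 1 else 0) +
        \<theta> i f (a, c', 1) * (if Suc k = c \<and> \<alpha> = w c then 1 else 0)" if "k \<le> N" for k \<alpha>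
      using that top Ut by (simp add: add_M_apply scalar_M_apply top_vector_apply U_apply)
    show "f (p a i) k (w k) = ?R k (w k)" if k: "k \<le> N" for k
      unfolding R[OF k] using k a c zero[OF k, of "w k"] by (auto simp: \<theta>_apply c_def)
    show "f (p a i) k (w (Suc k)) = ?R k (w (Suc k))" if k: "k < N" for k
    proof (cases "Suc k = c")
      case True
      then have "i + c' + 1 = a" "c' = k" using a by (auto simp: c_def c'_def)
      then show ?thesis using R[of k] k True a by (simp add: \<theta>_apply)
    next
      case False
      then have "w (Suc k) \<noteq> w c" using k c by simp
      then show ?thesis using R[of k] k zero[of k "w (Suc k)"] by simp
    qed
  qed
  then show ?thesis by (simp only: c_def c'_def)
qed

text \<open>The degree \<open>i\<close> of the first factor fixes the intermediate vertex:
  \<open>a - i\<close>, or \<open>a - i - 1\<close> if that factor contributes \<open>F\<close>. A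
  product of two factors \<open>F\<close> is zero, so there is no third term.\<close>

definition graded_mult :: "nat \<Rightarrow> nat \<Rightarrow> coeffs \<Rightarrow> coeffs \<Rightarrow> coeffs" where
  "graded_mult i j X Y = (\<lambda>(a, b, s). if a \<le> N \<and> s \<le> 1 \<and> i + j + b + s = a
    then X (a, a - i, 0) * Y (a - i, b, s) +
      (if s = 1 then X (a, a - i - 1, 1) * Y (a - i - 1, b, 0) else 0) else 0)"

lemma product_cocycle:
  assumes g: "g \<in> carrier (C j)" and \<phi>: "\<phi> \<in> chain_lifts A P d \<epsilon> i f"
  shows "compose (carrier (P (i + j))) g (\<phi> j) \<in> carrier (C (i + j))"
proof -
  have \<phi>_hom: "\<phi> k \<in> mod_hom A (P (i + k)) (P k)" for k using \<phi> by (simp add: chain_lifts_def)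
  have "g (\<phi> j (d (i + j) x)) = \<zero>\<^bsub>M\<^esub>" if x: "x \<in> carrier (P (Suc (i + j)))" for x
  proof -
    have "\<phi> j (d (i + j) x) = d j (\<phi> (Suc j) x)" using \<phi> x by (simp add: chain_lifts_def)
    moreover have "\<phi> (Suc j) x \<in> carrier (P (Suc j))" using mod_homD(1)[OF \<phi>_hom[of "Suc j"]] x by simp
    ultimately show ?thesis using g by (simp add: carrier_C)
  qed
  moreover have "compose (carrier (P (i + j))) g (\<phi> j) \<in> mod_hom A (P (i + j)) M"
    by (rule mod_hom_compose[OF \<phi>_hom cocycle_hom[OF g] P_module])
  ultimately show ?thesis by (simp add: carrier_C compose_eq d_closed)
qed

text \<open>The whole error of the lift disappears: \<open>g\<close> kills boundaries, and
  \<open>b\<close> acts by zero on \<open>M\<close>.\<close>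

lemma product_generator:
  assumes f: "f \<in> carrier (C i)" and g: "g \<in> carrier (C j)" and \<phi>: "\<phi> \<in> chain_lifts A P d \<epsilon> i f"
    and a: "i + j \<le> a" "a \<le> N"
  shows "g (\<phi> j (p a (i + j))) = scalar A M (\<theta> i f (a, a - i, 0)) (g (p (a - i) j)) \<oplus>\<^bsub>M\<^esub>
    scalar A M (\<theta> i f (a, a - i - 1, 1)) (U (a - i) j \<odot>\<^bsub>M\<^esub> g (p (a - i - 1) j))"
proof -
  define c c' where "c = a - i" and "c' = c - 1"
  have c: "c \<le> N" "c' \<le> N" using a by (auto simp: c_def c'_def)
  have ia: "i \<le> a" using a by simp
  note G = cocycle_hom[OF g]
  let ?\<alpha> = "\<theta> i f (a, c, 0)" and ?\<beta> = "\<theta> i f (a, c', 1)"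
  obtain h h' b where h: "h \<in> carrier (P (Suc j))" "h' \<in> carrier (P j)" "b \<in> carrier A"
    "\<forall>m\<in>carrier M. b \<odot>\<^bsub>M\<^esub> m = \<zero>\<^bsub>M\<^esub>"
    "\<phi> j (p a (i + j)) = scalar A (P j) ?\<alpha> (p c j) \<oplus>\<^bsub>P j\<^esub>
      scalar A (P j) ?\<beta> (U c j \<odot>\<^bsub>P j\<^esub> p c' j) \<oplus>\<^bsub>P j\<^esub> (d j h \<oplus>\<^bsub>P j\<^esub> b \<odot>\<^bsub>P j\<^esub> h')"
    using chain_lift_generator[OF ia a(2) \<phi> generator_value[OF f ia a(2)], of j,
        folded c_def, folded c'_def]
    by (elim bexE conjE) (rule that)
  interpret Pj: left_module A "P j" by (rule P_module)
  have cl: "scalar A (P j) ?\<alpha> (p c j) \<in> carrier (P j)"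
    "U c j \<odot>\<^bsub>P j\<^esub> p c' j \<in> carrier (P j)" "d j h \<in> carrier (P j)" "b \<odot>\<^bsub>P j\<^esub> h' \<in> carrier (P j)"
    using c h by (simp_all add: scalar_in P_module smult_P_closed d_closed)
  have cl': "scalar A (P j) ?\<beta> (U c j \<odot>\<^bsub>P j\<^esub> p c' j) \<in> carrier (P j)"
    using cl by (simp add: scalar_in P_module)
  have gM: "g (p c j) \<in> carrier M" "U c j \<odot>\<^bsub>M\<^esub> g (p c' j) \<in> carrier M" "g h' \<in> carrier M"
    using c h mod_homD(1)[OF G] by (simp_all add: M.smult_closed)
  have "g (\<phi> j (p a (i + j))) = scalar A M ?\<alpha> (g (p c j)) \<oplus>\<^bsub>M\<^esub>
      scalar A M ?\<beta> (U c j \<odot>\<^bsub>M\<^esub> g (p c' j)) \<oplus>\<^bsub>M\<^esub> (g (d j h) \<oplus>\<^bsub>M\<^esub> b \<odot>\<^bsub>M\<^esub> g h')"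
    unfolding h(5) using c cl cl' h
    by (simp add: mod_homD(2,3)[OF G] mod_hom_scalar[OF G])
  also have "\<dots> = scalar A M ?\<alpha> (g (p c j)) \<oplus>\<^bsub>M\<^esub> scalar A M ?\<beta> (U c j \<odot>\<^bsub>M\<^esub> g (p c' j))"
    using g h gM by (simp add: carrier_C scalar_in M_module)
  finally show ?thesis by (simp only: c_def c'_def)
qed

text \<open>\<open>U\<close> reads only the top coordinate of a summand and writes it to the other
  basis vector. A value already on the second vector is lost, which is the relation
  \<open>F F = 0\<close>.\<close>

lemma \<theta>_product:
  assumes f: "f \<in> carrier (C i)" and g: "g \<in> carrier (C j)" and \<phi>: "\<phi> \<in> chain_lifts A P d \<epsilon> i f"
  shows "\<theta> (i + j) (compose (carrier (P (i + j))) g (\<phi> j)) = graded_mult i j (\<theta> i f) (\<theta> j g)"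
proof
  fix k :: "nat \<times> nat \<times> nat"
  obtain a b s where k: "k = (a, b, s)" by (cases k)
  show "\<theta> (i + j) (compose (carrier (P (i + j))) g (\<phi> j)) k = graded_mult i j (\<theta> i f) (\<theta> j g) k"
  proof (cases "a \<le> N \<and> s \<le> 1 \<and> i + j + b + s = a")
    case False
    then show ?thesis by (simp only: k \<theta>_apply graded_mult_def prod.case False if_False)
  next
    case True
    then have a: "i + j \<le> a" "a \<le> N" and s: "s = 0 \<or> s = 1" by linarith+
    define c c' where "c = a - i" and "c' = c - 1"
    have c: "c \<le> N" "c' \<le> N" "j + b + s = c" using True by (auto simp: c_def c'_def)
    have gM: "g (p c j) \<in> carrier M" "g (p c' j) \<in> carrier M"
      using c hom_generator(1)[OF cocycle_hom[OF g]] by simp_all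
    have UM: "U c j \<odot>\<^bsub>M\<^esub> g (p c' j) \<in> carrier M" using gM by (simp add: M.smult_closed)
    have b: "b \<le> N" using True by simp
    have "\<theta> (i + j) (compose (carrier (P (i + j))) g (\<phi> j)) k = g (\<phi> j (p a (i + j))) b (w (b + s))"
      using True by (simp add: k \<theta>_apply compose_eq)
    also have "\<dots> = \<theta> i f (a, c, 0) * g (p c j) b (w (b + s)) +
        \<theta> i f (a, c', 1) * (U c j \<odot>\<^bsub>M\<^esub> g (p c' j)) b (w (b + s))"
      unfolding product_generator[OF f g \<phi> a, folded c_def, folded c'_def]
      using gM UM b by (simp add: add_M_apply scalar_M_apply scalar_in M_module)
    also have "g (p c j) b (w (b + s)) = \<theta> j g (c, b, s)"
      using c True by (simp add: \<theta>_apply)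
    also have "\<theta> i f (a, c', 1) * (U c j \<odot>\<^bsub>M\<^esub> g (p c' j)) b (w (b + s)) =
        (if s = 1 then \<theta> i f (a, c', 1) * \<theta> j g (c', b, 0) else 0)"
    proof (cases "s = 1")
      case True
      then have "j < c" "c - Suc j = b" "b < N" "j + b = c'" using c by (auto simp: c'_def)
      then show ?thesis using True b c gM by (simp add: U_def r_smult_M \<theta>_apply)
    next
      case False
      then have "s = 0" using s by simp
      then have "(U c j \<odot>\<^bsub>M\<^esub> g (p c' j)) b (w (b + s)) = 0"
        using b c gM by (cases "j < c") (auto simp: U_def r_smult_M M.smult_zero_left zero_M_apply)
      then show ?thesis using False by simp
    qed
    finally show ?thesis using True by (simp add: k graded_mult_def c_def c'_def)
  qed
qed

lemma ext_space_eq: "ext_space A P d M n = quot (C n) (B n)"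
  by (simp add: ext_space_def)

lemma ext_class_eq: "ext_class A P d M n f = B n +>\<^bsub>C n\<^esub> f"
  by (simp add: ext_class_def)

text \<open>All choices give the same class because the coordinates of the product depend only on
  those of the factors. Every representative has a chain lift, so each union runs over a nonempty
  family and equals that class.\<close>

lemma yoneda:
  assumes X: "X \<in> carrier (quot (C i) (B i))" and Y: "Y \<in> carrier (quot (C j) (B j))"
  shows yoneda_closed: "yoneda A M P d \<epsilon> i j X Y \<in> carrier (quot (C (i + j)) (B (i + j)))"
    and coord_yoneda: "Ext.coord (i + j) (yoneda A M P d \<epsilon> i j X Y) =
      graded_mult i j (Ext.coord i X) (Ext.coord j Y)"
proof -
  obtain f0 where f0: "f0 \<in> carrier (C i)" "X = B i +>\<^bsub>C i\<^esub> f0" using X by (auto simp: Ext.carrier_quot)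
  obtain g0 where g0: "g0 \<in> carrier (C j)" "Y = B j +>\<^bsub>C j\<^esub> g0" using Y by (auto simp: Ext.carrier_quot)
  have mem: "f \<in> X \<Longrightarrow> f \<in> carrier (C i) \<and> \<theta> i f = \<theta> i f0"
    "g \<in> Y \<Longrightarrow> g \<in> carrier (C j) \<and> \<theta> j g = \<theta> j g0" for f g
    using f0 g0 by (auto simp: Ext.coset_eq)
  obtain \<phi>0 where \<phi>0: "\<phi>0 \<in> chain_lifts A P d \<epsilon> i f0"
    using chain_lift_exists[of f0 i] f0(1) by (auto simp: carrier_C)
  let ?h = "compose (carrier (P (i + j))) g0 (\<phi>0 j)"
  have h: "?h \<in> carrier (C (i + j))" by (rule product_cocycle[OF g0(1) \<phi>0])
  have same: "ext_class A P d M (i + j) (compose (carrier (P (i + j))) g (\<phi> j)) =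
      B (i + j) +>\<^bsub>C (i + j)\<^esub> ?h"
    if "f \<in> X" "g \<in> Y" "\<phi> \<in> chain_lifts A P d \<epsilon> i f" for f g \<phi>
    unfolding ext_class_eq
  proof (rule Ext.coset_cong[OF _ h])
    show "compose (carrier (P (i + j))) g (\<phi> j) \<in> carrier (C (i + j))"
      using that mem by (intro product_cocycle) auto
    show "\<theta> (i + j) (compose (carrier (P (i + j))) g (\<phi> j)) = \<theta> (i + j) ?h"
      using that mem by (simp add: \<theta>_product[of f i g j \<phi>] \<theta>_product[OF f0(1) g0(1) \<phi>0])
  qed
  have "f0 \<in> X" "g0 \<in> Y" using f0 g0 Ext.coset_self by auto
  have lifts: "chain_lifts A P d \<epsilon> i f \<noteq> {}" if "f \<in> X" for f
    using chain_lift_exists[of f i] mem(1)[OF that] by (auto simp: carrier_C)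
  have eq: "yoneda A M P d \<epsilon> i j X Y = B (i + j) +>\<^bsub>C (i + j)\<^esub> ?h"
    unfolding yoneda_def
  proof (rule UN_constant_eq[OF \<open>f0 \<in> X\<close>], rule ballI,
      rule UN_constant_eq[OF \<open>g0 \<in> Y\<close>], rule ballI)
    fix f g assume fg: "f \<in> X" "g \<in> Y"
    then obtain \<phi> where "\<phi> \<in> chain_lifts A P d \<epsilon> i f" using lifts by blast
    then show "(\<Union>\<phi>\<in>chain_lifts A P d \<epsilon> i f.
        ext_class A P d M (i + j) (compose (carrier (P (i + j))) g (\<phi> j))) = B (i + j) +>\<^bsub>C (i + j)\<^esub> ?h"
      by (rule UN_constant_eq) (rule ballI, rule same[OF fg])
  qed
  show "yoneda A M P d \<epsilon> i j X Y \<in> carrier (quot (C (i + j)) (B (i + j)))"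
    unfolding eq by (rule Ext.coset_in_quot[OF h])
  show "Ext.coord (i + j) (yoneda A M P d \<epsilon> i j X Y) =
      graded_mult i j (Ext.coord i X) (Ext.coord j Y)"
  proof -
    have "Ext.coord i X = \<theta> i f0" "Ext.coord j Y = \<theta> j g0"
      using f0 g0 by (simp_all add: Ext.coord_coset)
    then show ?thesis
      unfolding eq by (simp only: Ext.coord_coset[OF h] \<theta>_product[OF f0(1) g0(1) \<phi>0])
  qed
qed

lemma coord_support:
  assumes "X \<in> carrier (quot (C n) (B n))" "\<not> (a \<le> N \<and> s \<le> 1 \<and> n + b + s = a)"
  shows "Ext.coord n X (a, b, s) = 0"
proof -
  obtain f where f: "f \<in> carrier (C n)" "X = B n +>\<^bsub>C n\<^esub> f" using assms by (auto simp: Ext.carrier_quot)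
  then show ?thesis using assms(2) by (auto simp: Ext.coord_coset \<theta>_apply)
qed

section \<open>The total Ext algebra in coordinates\<close>

abbreviation "\<E> \<equiv> ext_algebra A M P d \<epsilon>"

lemma ext_vanishes:
  assumes "X \<in> carrier (quot (C n) (B n))" "N < n"
  shows "X = \<zero>\<^bsub>quot (C n) (B n)\<^esub>"
proof (rule Ext.coord_inj[OF assms(1) Ext.zero_quot(1)])
  have "Ext.coord n X k = 0" for k
    using coord_support[OF assms(1)] assms(2) by (cases k) auto
  then show "Ext.coord n X = Ext.coord n \<zero>\<^bsub>quot (C n) (B n)\<^esub>" by (simp add: Ext.zero_quot(2) fun_eq_iff)
qed

text \<open>Ext vanishes above degree \<open>N\<close>, which bounds the support of every
  family.\<close>

lemma carrier_\<E>: "x \<in> carrier \<E> \<longleftrightarrow> (\<forall>n. x n \<in> carrier (quot (C n) (B n)))"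
proof
  assume x: "\<forall>n. x n \<in> carrier (quot (C n) (B n))"
  have "{n. x n \<noteq> \<zero>\<^bsub>quot (C n) (B n)\<^esub>} \<subseteq> {..N}"
  proof
    fix n assume n: "n \<in> {n. x n \<noteq> \<zero>\<^bsub>quot (C n) (B n)\<^esub>}"
    then show "n \<in> {..N}" using ext_vanishes[of "x n" n] x by (cases "n \<le> N") auto
  qed
  then have "finite {n. x n \<noteq> \<zero>\<^bsub>quot (C n) (B n)\<^esub>}" by (rule finite_subset) simp
  then show "x \<in> carrier \<E>" using x by (simp add: ext_algebra_def ext_space_eq)
qed (simp add: ext_algebra_def ext_space_eq)

text \<open>A key determines its degree, so the coordinates of all degrees fit into one function. If
  the subtraction is truncated, the key has no coordinate in degree 0 and the value is zero.\<close>

definition \<Theta> :: "(nat \<Rightarrow> ('b \<Rightarrow> nat \<Rightarrow> weight \<Rightarrow> complex) set) \<Rightarrow> coeffs" where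
  "\<Theta> x = (\<lambda>(a, b, s). Ext.coord (a - b - s) (x (a - b - s)) (a, b, s))"

lemma \<Theta>_apply: "n + b + s = a \<Longrightarrow> \<Theta> x (a, b, s) = Ext.coord n (x n) (a, b, s)"
  by (auto simp: \<Theta>_def)

lemma \<Theta>_closed:
  assumes "x \<in> carrier \<E>" shows "\<Theta> x \<in> coefficient_space N"
  unfolding coefficient_space_def
proof (intro CollectI allI impI)
  fix a b s assume nz: "\<Theta> x (a, b, s) \<noteq> 0"
  let ?n = "a - b - s"
  have "x ?n \<in> carrier (quot (C ?n) (B ?n))" using assms by (simp only: carrier_\<E>)
  note supp = coord_support[OF this, of a s b]
  have "Ext.coord ?n (x ?n) (a, b, s) \<noteq> 0" using nz unfolding \<Theta>_def prod.case .
  with supp have "a \<le> N \<and> s \<le> 1 \<and> ?n + b + s = a" by argo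
  then show "b + s \<le> a \<and> a \<le> N \<and> s \<le> 1" by arith
qed

lemma \<Theta>_inj: "inj_on \<Theta> (carrier \<E>)"
proof (rule inj_onI)
  fix x y assume xy: "x \<in> carrier \<E>" "y \<in> carrier \<E>" "\<Theta> x = \<Theta> y"
  show "x = y"
  proof
    fix n
    have c: "x n \<in> carrier (quot (C n) (B n))" "y n \<in> carrier (quot (C n) (B n))"
      using xy by (auto simp: carrier_\<E>)
    have "Ext.coord n (x n) (a, b, s) = Ext.coord n (y n) (a, b, s)" for a b s
    proof (cases "n + b + s = a")
      case True
      then show ?thesis using xy(3) \<Theta>_apply[OF True, of x] \<Theta>_apply[OF True, of y] by simp
    next
      case False
      then show ?thesis using coord_support[OF c(1)] coord_support[OF c(2)] by simp
    qed
    then show "x n = y n" by (intro Ext.coord_inj[OF c]) (auto simp: fun_eq_iff)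
  qed
qed

lemma \<Theta>_surj: "\<Theta> ` carrier \<E> = coefficient_space N"
proof (intro equalityI subsetI)
  fix \<rho> assume \<rho>: "\<rho> \<in> coefficient_space N"
  \<comment> \<open>The prescribed value on \<open>p a n\<close>: multiples of the two basis vectors
    at \<open>w (a - n)\<close>, one in \<open>M(a - n)\<close> and one in
    \<open>M(a - n - 1)\<close>.\<close>
  define m where "m = (\<lambda>n a. \<lambda>i\<in>{0..N}. \<lambda>\<alpha>. if \<alpha> = w (a - n)
    then if i = a - n then \<rho> (a, i, 0) else if Suc i = a - n then \<rho> (a, i, 1) else 0 else 0)"
  have m_apply: "m n a i \<alpha> = (if \<alpha> = w (a - n)
    then if i = a - n then \<rho> (a, i, 0) else if Suc i = a - n then \<rho> (a, i, 1) else 0 else 0)"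
    if "i \<le> N" for n a i \<alpha>
    using that by (simp add: m_def)
  have mM: "m n a \<in> carrier M" if "a \<le> N" for n a
    unfolding carrier_M
  proof (intro conjI allI impI)
    show "m n a \<in> extensional {0..N}" by (simp add: m_def)
    fix i \<alpha> assume i: "i \<le> N" "\<not> (\<alpha> \<in> block N (Suc 0) \<and> orients \<alpha> (w i))"
    then show "m n a i \<alpha> = 0"
      using that by (auto simp: m_apply block_eq orients_wedge_at)
  qed
  have "\<exists>f\<in>carrier (C n). \<forall>a\<in>{n..N}. f (p a n) = m n a" for n
  proof (rule cocycle_with_values)
    fix a assume a: "a \<le> N" "n \<le> a"
    have "E a n \<odot>\<^bsub>M\<^esub> m n a = m n a"
    proof (rule M_ext)
      show "E a n \<odot>\<^bsub>M\<^esub> m n a \<in> carrier M" "m n a \<in> carrier M"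
        using a mM by (simp_all add: M.smult_closed)
      fix i \<alpha> assume "i \<le> N"
      then show "(E a n \<odot>\<^bsub>M\<^esub> m n a) i \<alpha> = m n a i \<alpha>"
        using a mM by (simp add: E_def e_smult_M m_apply)
    qed
    then show "m n a \<in> carrier M \<and> E a n \<odot>\<^bsub>M\<^esub> m n a = m n a" using mM a by simp
  qed
  then obtain f where f: "\<And>n. f n \<in> carrier (C n)" "\<And>n a. n \<le> a \<Longrightarrow> a \<le> N \<Longrightarrow> f n (p a n) = m n a"
    by (metis atLeastAtMost_iff)
  define x where "x = (\<lambda>n. B n +>\<^bsub>C n\<^esub> f n)"
  have x: "x \<in> carrier \<E>" by (simp add: carrier_\<E> x_def Ext.coset_in_quot f(1))
  have "\<Theta> x (a, b, s) = \<rho> (a, b, s)" for a b s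
  proof (cases "b + s \<le> a \<and> a \<le> N \<and> s \<le> 1")
    case True
    define n where "n = a - b - s"
    have n: "n + b + s = a" "n \<le> a" "a - n = b + s" using True by (auto simp: n_def)
    have "\<Theta> x (a, b, s) = f n (p a n) b (w (b + s))"
      using n True by (simp add: \<Theta>_apply[OF n(1)] x_def Ext.coord_coset f(1) \<theta>_apply)
    also have "\<dots> = \<rho> (a, b, s)"
      using n True f(2)[OF n(2)] by (cases s) (auto simp: m_apply)
    finally show ?thesis .
  next
    case False
    then show ?thesis using coefficient_spaceD[OF \<rho>] coefficient_spaceD[OF \<Theta>_closed[OF x]] by simp
  qed
  then have "\<rho> = \<Theta> x" by (auto simp: fun_eq_iff)
  then show "\<rho> \<in> \<Theta> ` carrier \<E>" using x by blast
qed (use \<Theta>_closed in blast)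

lemma \<E>_add:
  assumes "x \<in> carrier \<E>" "y \<in> carrier \<E>"
  shows "x \<oplus>\<^bsub>\<E>\<^esub> y \<in> carrier \<E>" "\<Theta> (x \<oplus>\<^bsub>\<E>\<^esub> y) = (\<lambda>k. \<Theta> x k + \<Theta> y k)"
proof -
  have xy: "(x \<oplus>\<^bsub>\<E>\<^esub> y) n = x n \<oplus>\<^bsub>quot (C n) (B n)\<^esub> y n" for n
    by (simp add: ext_algebra_def ext_space_eq)
  show "x \<oplus>\<^bsub>\<E>\<^esub> y \<in> carrier \<E>" using assms by (simp add: carrier_\<E> xy Ext.add_quot)
  show "\<Theta> (x \<oplus>\<^bsub>\<E>\<^esub> y) = (\<lambda>k. \<Theta> x k + \<Theta> y k)"
    using assms by (auto simp: fun_eq_iff \<Theta>_def xy Ext.add_quot carrier_\<E>)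
qed

lemma \<E>_smult:
  assumes "x \<in> carrier \<E>"
  shows "c \<odot>\<^bsub>\<E>\<^esub> x \<in> carrier \<E>" "\<Theta> (c \<odot>\<^bsub>\<E>\<^esub> x) = (\<lambda>k. c * \<Theta> x k)"
proof -
  have cx: "(c \<odot>\<^bsub>\<E>\<^esub> x) n = c \<odot>\<^bsub>quot (C n) (B n)\<^esub> x n" for n
    by (simp add: ext_algebra_def ext_space_eq)
  show "c \<odot>\<^bsub>\<E>\<^esub> x \<in> carrier \<E>" using assms by (simp add: carrier_\<E> cx Ext.smult_quot)
  show "\<Theta> (c \<odot>\<^bsub>\<E>\<^esub> x) = (\<lambda>k. c * \<Theta> x k)"
    using assms by (auto simp: fun_eq_iff \<Theta>_def cx Ext.smult_quot carrier_\<E>)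
qed

lemma sum_reverse_interval:
  fixes F :: "nat \<Rightarrow> complex"
  assumes "n \<le> a"
  shows "(\<Sum>i\<le>n. F (a - i)) = (\<Sum>c\<in>{a - n..a}. F c)"
  using assms
  by (intro sum.reindex_bij_witness[of _ "\<lambda>c. a - c" "\<lambda>i. a - i"]) auto

text \<open>Summing over the degree of the first factor amounts to summing over the intermediate
  vertex. The vertices not reached contribute zero by the support of the coefficients.\<close>

lemma \<E>_mult:
  assumes "x \<in> carrier \<E>" "y \<in> carrier \<E>"
  shows "x \<otimes>\<^bsub>\<E>\<^esub> y \<in> carrier \<E>" "\<Theta> (x \<otimes>\<^bsub>\<E>\<^esub> y) = coeff_mult N (\<Theta> x) (\<Theta> y)"
proof -
  have mult: "(x \<otimes>\<^bsub>\<E>\<^esub> y) n =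
      (\<Oplus>\<^bsub>quot (C n) (B n)\<^esub>i\<in>{..n}. yoneda A M P d \<epsilon> i (n - i) (x i) (y (n - i)))" for n
    by (simp add: ext_algebra_def ext_space_eq)
  have xc: "x n \<in> carrier (quot (C n) (B n))" "y n \<in> carrier (quot (C n) (B n))" for n
    using assms by (auto simp: carrier_\<E>)
  have Y: "yoneda A M P d \<epsilon> i (n - i) (x i) (y (n - i)) \<in> carrier (quot (C n) (B n))"
    "Ext.coord n (yoneda A M P d \<epsilon> i (n - i) (x i) (y (n - i))) =
      graded_mult i (n - i) (Ext.coord i (x i)) (Ext.coord (n - i) (y (n - i)))" if "i \<le> n" for i n
    using that yoneda_closed[OF xc(1)[of i] xc(2)[of "n - i"]] coord_yoneda[OF xc(1)[of i] xc(2)[of "n - i"]]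
    by simp_all
  have Yf: "(\<lambda>i. yoneda A M P d \<epsilon> i (n - i) (x i) (y (n - i))) \<in> {..n} \<rightarrow> carrier (quot (C n) (B n))" for n
    using Y(1) by simp
  show closed: "x \<otimes>\<^bsub>\<E>\<^esub> y \<in> carrier \<E>"
    unfolding carrier_\<E> mult using Ext.finsum_quot(1)[OF _ Yf] by simp
  note X_supp = coefficient_spaceD[OF \<Theta>_closed[OF assms(1)]]
  note Y_supp = coefficient_spaceD[OF \<Theta>_closed[OF assms(2)]]
  note cm = coeff_mult_closed[OF \<Theta>_closed[OF assms(1)] \<Theta>_closed[OF assms(2)]]
  have "\<Theta> (x \<otimes>\<^bsub>\<E>\<^esub> y) (a, b, s) = coeff_mult N (\<Theta> x) (\<Theta> y) (a, b, s)" for a b s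
  proof (cases "b + s \<le> a \<and> a \<le> N \<and> s \<le> 1")
    case False
    then show ?thesis using coefficient_spaceD[OF cm] coefficient_spaceD[OF \<Theta>_closed[OF closed]] by simp
  next
    case True
    define n where "n = a - b - s"
    have n: "n + b + s = a" "n \<le> a" using True by (auto simp: n_def)
    have "\<Theta> (x \<otimes>\<^bsub>\<E>\<^esub> y) (a, b, s) = (\<Sum>i\<le>n. graded_mult i (n - i) (Ext.coord i (x i)) (Ext.coord (n - i) (y (n - i))) (a, b, s))"
      unfolding \<Theta>_apply[OF n(1)] mult Ext.finsum_quot(2)[OF finite_atMost Yf]
      by (intro sum.cong) (auto simp: Y(2))
    \<comment> \<open>\<open>a - i - 1\<close> becomes \<open>a - 1 - i\<close>, so that the second
      sum can be reversed over an interval ending at \<open>a - 1\<close>.\<close>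
    also have "\<dots> = (\<Sum>i\<le>n. \<Theta> x (a, a - i, 0) * \<Theta> y (a - i, b, s) +
        (if s = 1 then \<Theta> x (a, a - 1 - i, 1) * \<Theta> y (a - 1 - i, b, 0) else 0))"
    proof (rule sum.cong[OF refl])
      fix i assume "i \<in> {..n}"
      then have i: "i \<le> n" by simp
      have 1: "Ext.coord i (x i) (a, a - i, 0) = \<Theta> x (a, a - i, 0)"
        "Ext.coord (n - i) (y (n - i)) (a - i, b, s) = \<Theta> y (a - i, b, s)"
        using i n by (auto intro!: \<Theta>_apply[symmetric])
      have 2: "Ext.coord i (x i) (a, a - 1 - i, 1) = \<Theta> x (a, a - 1 - i, 1)"
        "Ext.coord (n - i) (y (n - i)) (a - 1 - i, b, 0) = \<Theta> y (a - 1 - i, b, 0)" if "s = 1"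
        using i n that by (auto intro!: \<Theta>_apply[symmetric])
      show "graded_mult i (n - i) (Ext.coord i (x i)) (Ext.coord (n - i) (y (n - i))) (a, b, s) =
          \<Theta> x (a, a - i, 0) * \<Theta> y (a - i, b, s) +
          (if s = 1 then \<Theta> x (a, a - 1 - i, 1) * \<Theta> y (a - 1 - i, b, 0) else 0)"
        using i n True 1 2 by (auto simp: graded_mult_def diff_right_commute[of a 1])
    qed
    also have "\<dots> = (\<Sum>i\<le>n. \<Theta> x (a, a - i, 0) * \<Theta> y (a - i, b, s)) +
        (if s = 1 then \<Sum>i\<le>n. \<Theta> x (a, a - 1 - i, 1) * \<Theta> y (a - 1 - i, b, 0) else 0)"
      by (auto simp: sum.distrib)
    also have "(\<Sum>i\<le>n. \<Theta> x (a, a - i, 0) * \<Theta> y (a - i, b, s)) = (\<Sum>c\<le>N. \<Theta> x (a, c, 0) * \<Theta> y (c, b, s))"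
      unfolding sum_reverse_interval[OF n(2), of "\<lambda>c. \<Theta> x (a, c, 0) * \<Theta> y (c, b, s)"]
      using n True X_supp Y_supp by (intro sum.mono_neutral_left) auto
    also have "(if s = 1 then \<Sum>i\<le>n. \<Theta> x (a, a - 1 - i, 1) * \<Theta> y (a - 1 - i, b, 0) else 0) =
        (if s = 1 then \<Sum>c\<le>N. \<Theta> x (a, c, 1) * \<Theta> y (c, b, 0) else 0)"
    proof (cases "s = 1")
      case s: True
      then have na: "n \<le> a - 1" using n by simp
      have "(\<Sum>i\<le>n. \<Theta> x (a, a - 1 - i, 1) * \<Theta> y (a - 1 - i, b, 0)) = (\<Sum>c\<le>N. \<Theta> x (a, c, 1) * \<Theta> y (c, b, 0))"
        unfolding sum_reverse_interval[OF na, of "\<lambda>c. \<Theta> x (a, c, 1) * \<Theta> y (c, b, 0)"]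
        using n s True X_supp Y_supp by (intro sum.mono_neutral_left) auto
      then show ?thesis by simp
    qed simp
    finally show ?thesis by (simp add: coeff_mult_def)
  qed
  then show "\<Theta> (x \<otimes>\<^bsub>\<E>\<^esub> y) = coeff_mult N (\<Theta> x) (\<Theta> y)" by (auto simp: fun_eq_iff)
qed

text \<open>The generator \<open>p a 0\<close> lies over the top vector, so the coordinates are the
  coefficients of the value of \<open>h\<close> there; degree 0 means
  \<open>b + s = a\<close>.\<close>

lemma ext_of_hom:
  assumes h: "h \<in> mod_hom A M M"
  shows "ext_of_hom A M P d \<epsilon> h \<in> carrier \<E>"
    and "\<Theta> (ext_of_hom A M P d \<epsilon> h) (a, b, s) =
      (if a \<le> N \<and> s \<le> 1 \<and> b + s = a then h (top_vector a) b (w a) else 0)"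
proof -
  let ?f = "compose (carrier (P 0)) h \<epsilon>"
  have f: "?f \<in> carrier (C 0)"
    using mod_hom_compose[OF \<epsilon>_hom h P_module] mod_hom_zero[OF M_module M_module h]
    by (simp add: carrier_C compose_eq d_closed \<epsilon>_d)
  have val: "ext_of_hom A M P d \<epsilon> h n = (if n = 0 then B 0 +>\<^bsub>C 0\<^esub> ?f else \<zero>\<^bsub>quot (C n) (B n)\<^esub>)" for n
    by (simp add: ext_of_hom_def ext_class_eq ext_space_eq)
  show closed: "ext_of_hom A M P d \<epsilon> h \<in> carrier \<E>"
    by (auto simp: carrier_\<E> val Ext.zero_quot Ext.coset_in_quot[OF f])
  show "\<Theta> (ext_of_hom A M P d \<epsilon> h) (a, b, s) =
      (if a \<le> N \<and> s \<le> 1 \<and> b + s = a then h (top_vector a) b (w a) else 0)"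
  proof (cases "b + s \<le> a")
    case False
    then show ?thesis using coefficient_spaceD[OF \<Theta>_closed[OF closed]] by auto
  next
    case True
    then have "a - b - s + b + s = a" by simp
    then show ?thesis
      using True
      by (auto simp: \<Theta>_def val Ext.zero_quot Ext.coord_coset[OF f] \<theta>_apply compose_eq \<epsilon>_p)
  qed
qed

lemma \<Theta>_one:
  "\<one>\<^bsub>\<E>\<^esub> \<in> carrier \<E>" "\<Theta> \<one>\<^bsub>\<E>\<^esub> (a, b, s) = (if a = b \<and> s = 0 \<and> a \<le> N then 1 else 0)"
proof -
  have id: "(\<lambda>x\<in>carrier M. x) \<in> mod_hom A M M"
    by (intro mod_homI) (simp_all add: M.smult_closed)
  have one: "\<one>\<^bsub>\<E>\<^esub> = ext_of_hom A M P d \<epsilon> (\<lambda>x\<in>carrier M. x)" by (simp add: ext_algebra_def)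
  show "\<one>\<^bsub>\<E>\<^esub> \<in> carrier \<E>" unfolding one by (rule ext_of_hom(1)[OF id])
  show "\<Theta> \<one>\<^bsub>\<E>\<^esub> (a, b, s) = (if a = b \<and> s = 0 \<and> a \<le> N then 1 else 0)"
    unfolding one ext_of_hom(2)[OF id] by (auto simp: top_vector_closed top_vector_apply)
qed

lemma \<Theta>_projection:
  assumes "j \<le> N"
  shows "\<Theta> (ext_of_hom A M P d \<epsilon> (\<pi> j)) (a, b, s) = (if a = j \<and> b = j \<and> s = 0 then 1 else 0)"
  unfolding ext_of_hom(2)[OF \<pi>_hom] using assms
  by (auto simp: top_vector_closed \<pi>_apply top_vector_apply)

end

section \<open>The path algebra of the quiver\<close>

text \<open>Every arrow lowers the vertex by one, so a list of arrows is a path as soon as its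
  sources count down from \<open>u\<close>. The condition \<open>1 \<le> u\<close> stops this at the
  vertex \<open>0\<close>, where subtraction would be truncated.\<close>

fun descending :: "nat \<Rightarrow> arrow list \<Rightarrow> bool" where
  "descending u [] \<longleftrightarrow> True"
| "descending u (x # xs) \<longleftrightarrow> arrow_source x = u \<and> 1 \<le> u \<and> descending (u - 1) xs"

lemma descending_append:
  "descending u (xs @ ys) \<longleftrightarrow> descending u xs \<and> descending (u - length xs) ys"
  by (induction xs arbitrary: u) (auto simp: diff_diff_left)

lemma descending_length: "descending u xs \<Longrightarrow> length xs \<le> u"
  by (induction xs arbitrary: u) fastforce+

lemma ext_quiver_simps [simp]:
  "verts (ext_quiver N) = {0..N}" "tail (ext_quiver N) = arrow_source"
  "head (ext_quiver N) x = arrow_source x - 1"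
  "x \<in> arcs (ext_quiver N) \<longleftrightarrow> 1 \<le> arrow_source x \<and> arrow_source x \<le> N"
  by (cases x; auto simp: ext_quiver_def)+

lemma cas_ext_quiver:
  "u \<le> N \<Longrightarrow> set xs \<subseteq> arcs (ext_quiver N) \<and> pre_digraph.cas (ext_quiver N) u xs v \<longleftrightarrow>
    descending u xs \<and> v = u - length xs"
proof (induction xs arbitrary: u)
  case Nil
  then show ?case by (auto simp: pre_digraph.cas.simps)
next
  case (Cons x xs)
  have "set (x # xs) \<subseteq> arcs (ext_quiver N) \<and> pre_digraph.cas (ext_quiver N) u (x # xs) v \<longleftrightarrow>
    1 \<le> arrow_source x \<and> arrow_source x \<le> N \<and> arrow_source x = u \<and>
    (set xs \<subseteq> arcs (ext_quiver N) \<and> pre_digraph.cas (ext_quiver N) (arrow_source x - 1) xs v)"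
    unfolding list.set insert_subset pre_digraph.cas.simps ext_quiver_simps by blast
  also have "\<dots> \<longleftrightarrow> descending u (x # xs) \<and> v = u - length (x # xs)"
    using Cons.IH[of "u - 1"] Cons.prems by (cases "arrow_source x = u") auto
  finally show ?case .
qed

lemma paths_ext_quiver: "(u, xs) \<in> paths (ext_quiver N) \<longleftrightarrow> u \<le> N \<and> descending u xs"
  using cas_ext_quiver[of u N xs] by (auto simp: paths_def pre_digraph.awalk_def)

lemma awlast_ext_quiver:
  "descending u xs \<Longrightarrow> pre_digraph.awlast (ext_quiver N) u xs = u - length xs"
proof (induction xs arbitrary: u)
  case Nil
  then show ?case by (simp add: pre_digraph.awalk_verts.simps)
next
  case (Cons x xs)
  have "pre_digraph.awalk_verts (ext_quiver N) (u - 1) xs \<noteq> []"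
    by (rule pre_digraph.awalk_verts_non_Nil)
  then show ?case using Cons by (simp add: pre_digraph.awalk_verts.simps)
qed

lemma finite_paths_ext_quiver: "finite (paths (ext_quiver N))"
proof (rule finite_subset)
  let ?L = "{xs. set xs \<subseteq> arcs (ext_quiver N) \<and> length xs \<le> N}"
  show "paths (ext_quiver N) \<subseteq> {0..N} \<times> ?L"
  proof
    fix q assume "q \<in> paths (ext_quiver N)"
    then obtain u xs where q: "q = (u, xs)" "u \<le> N" "descending u xs"
      by (cases q) (auto simp: paths_ext_quiver)
    then have "set xs \<subseteq> arcs (ext_quiver N)" using cas_ext_quiver[of u N xs "u - length xs"] by blast
    then show "q \<in> {0..N} \<times> ?L" using q descending_length[of u xs] by auto
  qed
  have "finite (arcs (ext_quiver N))" by (simp add: ext_quiver_def)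
  then show "finite ({0..N} \<times> ?L)" by (intro finite_cartesian_product finite_lists_length_le) auto
qed

definition is_F :: "arrow \<Rightarrow> bool" where
  "is_F x \<longleftrightarrow> x = F_arrow (arrow_source x)"

lemma is_F_simps [simp]: "is_F (F_arrow j)" "\<not> is_F (Id_arrow j)"
  by (simp_all add: is_F_def)

definition F_count :: "arrow list \<Rightarrow> nat" where
  "F_count xs = length (filter is_F xs)"

lemma F_count_simps [simp]:
  "F_count [] = 0" "F_count (x # xs) = (if is_F x then 1 else 0) + F_count xs"
  "F_count (xs @ ys) = F_count xs + F_count ys"
  by (auto simp: F_count_def)

text \<open>Start, end and number of arrows \<open>F\<close>: what the commutation relation
  preserves. The number of arrows \<open>Id\<close> is the degree of the corresponding Ext
  class.\<close>

definition key :: "nat \<times> arrow list \<Rightarrow> nat \<times> nat \<times> nat" where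
  "key q = (fst q, fst q - length (snd q), F_count (snd q))"

lemma key_simp [simp]: "key (u, xs) = (u, u - length xs, F_count xs)"
  by (simp add: key_def)

section \<open>The path algebra as a ring under convolution\<close>

locale quiver_path_algebra =
  fixes N :: nat
begin

abbreviation "Q \<equiv> ext_quiver N"
abbreviation "R \<equiv> path_algebra Q"

lemma carrier_R: "x \<in> carrier R \<longleftrightarrow> (\<forall>q. q \<notin> paths Q \<longrightarrow> x q = 0)"
proof -
  have "finite {q. x q \<noteq> 0}" if "\<forall>q. q \<notin> paths Q \<longrightarrow> x q = 0"
    by (rule finite_subset[OF _ finite_paths_ext_quiver[of N]]) (use that in blast)
  then show ?thesis by (auto simp: path_algebra_def)
qed

lemma R_out: "x \<in> carrier R \<Longrightarrow> q \<notin> paths Q \<Longrightarrow> x q = 0"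
  unfolding carrier_R by blast

lemma zero_R: "\<zero>\<^bsub>R\<^esub> = (\<lambda>q. 0)"
  by (simp add: path_algebra_def)

lemma add_R: "x \<oplus>\<^bsub>R\<^esub> y = (\<lambda>q. x q + y q)"
  by (simp add: path_algebra_def)

lemma smult_R: "c \<odot>\<^bsub>R\<^esub> x = (\<lambda>q. c * x q)"
  by (simp add: path_algebra_def)

lemma one_R: "\<one>\<^bsub>R\<^esub> = (\<lambda>(u, xs). if u \<le> N \<and> xs = [] then 1 else 0)"
  by (auto simp: path_algebra_def fun_eq_iff)

text \<open>The end vertex of a prefix of length \<open>k\<close> is replaced by
  \<open>u - k\<close>. This agrees with \<open>awlast\<close> on paths and makes sense for all
  lists, so associativity holds for arbitrary functions.\<close>

definition convolution ::
  "(nat \<times> arrow list \<Rightarrow> complex) \<Rightarrow> (nat \<times> arrow list \<Rightarrow> complex) \<Rightarrow> nat \<times> arrow list \<Rightarrow> complex" where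
  "convolution x y = (\<lambda>(u, xs). \<Sum>k\<le>length xs. x (u, take k xs) * y (u - k, drop k xs))"

lemma mult_R:
  assumes "x \<in> carrier R"
  shows "x \<otimes>\<^bsub>R\<^esub> y = convolution x y"
proof
  fix q :: "nat \<times> arrow list"
  obtain u xs where q: "q = (u, xs)" by (cases q)
  have "x (u, take k xs) * y (pre_digraph.awlast Q u (take k xs), drop k xs) =
      x (u, take k xs) * y (u - k, drop k xs)" if "k \<le> length xs" for k
  proof (cases "(u, take k xs) \<in> paths Q")
    case True
    then show ?thesis using that by (simp add: paths_ext_quiver awlast_ext_quiver)
  next
    case False
    then show ?thesis using R_out[OF assms False] by simp
  qed
  then have "(\<Sum>k\<le>length xs. x (u, take k xs) * y (pre_digraph.awlast Q u (take k xs), drop k xs)) =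
      (\<Sum>k\<le>length xs. x (u, take k xs) * y (u - k, drop k xs))"
    by (intro sum.cong refl) (simp only: atMost_iff)
  then show "(x \<otimes>\<^bsub>R\<^esub> y) q = convolution x y q"
    by (simp add: q path_algebra_def convolution_def)
qed

lemma mult_R_closed:
  assumes "x \<in> carrier R" "y \<in> carrier R"
  shows "x \<otimes>\<^bsub>R\<^esub> y \<in> carrier R"
  unfolding carrier_R
proof (intro allI impI)
  fix q assume nq: "q \<notin> paths Q"
  obtain u xs where q: "q = (u, xs)" by (cases q)
  have "x (u, take k xs) * y (u - k, drop k xs) = 0" if k: "k \<le> length xs" for k
  proof (rule ccontr)
    assume "x (u, take k xs) * y (u - k, drop k xs) \<noteq> 0"
    then have "(u, take k xs) \<in> paths Q" "(u - k, drop k xs) \<in> paths Q"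
      using R_out[OF assms(1)] R_out[OF assms(2)] by fastforce+
    then have "u \<le> N \<and> descending u (take k xs @ drop k xs)"
      using k unfolding descending_append by (simp add: paths_ext_quiver)
    then show False using nq by (simp add: q paths_ext_quiver)
  qed
  then have "(\<Sum>k\<le>length xs. x (u, take k xs) * y (u - k, drop k xs)) = 0"
    by (intro sum.neutral ballI) (simp only: atMost_iff)
  then show "(x \<otimes>\<^bsub>R\<^esub> y) q = 0"
    using assms(1) by (simp add: mult_R q convolution_def)
qed

lemma convolution_assoc: "convolution (convolution x y) z = convolution x (convolution y z)"
proof
  fix q :: "nat \<times> arrow list"
  obtain u xs where q: "q = (u, xs)" by (cases q)
  let ?n = "length xs"
  let ?f = "\<lambda>j k. x (u, take j xs) * (y (u - j, take k (drop j xs)) * z (u - j - k, drop k (drop j xs)))"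
  have inner: "(\<Sum>j\<le>length (take k xs). x (u, take j (take k xs)) * y (u - j, drop j (take k xs))) *
      z (u - k, drop k xs) = (\<Sum>j\<le>k. ?f j (k - j))" if "k \<le> ?n" for k
    unfolding sum_distrib_right using that
    by (intro sum.cong) (auto simp: min_def drop_take mult.assoc)
  have "convolution (convolution x y) z q = (\<Sum>k\<le>?n. \<Sum>j\<le>k. ?f j (k - j))"
    unfolding q convolution_def prod.case by (intro sum.cong refl inner) simp
  also have "\<dots> = (\<Sum>(k, j)\<in>(SIGMA k:{..?n}. {..k}). ?f j (k - j))"
    by (rule sum.Sigma) auto
  \<comment> \<open>Cutting at \<open>k\<close> and then the prefix at \<open>j\<close> is the same
    as cutting at \<open>j\<close> and then after \<open>k - j\<close> more arrows.\<close>
  also have "\<dots> = (\<Sum>(j, k)\<in>(SIGMA j:{..?n}. {..?n - j}). ?f j k)"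
    by (rule sum.reindex_bij_witness[of _ "\<lambda>(j, k). (j + k, j)" "\<lambda>(k, j). (j, k - j)"]) auto
  also have "\<dots> = (\<Sum>j\<le>?n. \<Sum>k\<le>?n - j. ?f j k)"
    by (rule sum.Sigma[symmetric]) auto
  also have "\<dots> = convolution x (convolution y z) q"
    by (simp add: q convolution_def sum_distrib_left)
  finally show "convolution (convolution x y) z q = convolution x (convolution y z) q" .
qed

lemma one_R_closed: "\<one>\<^bsub>R\<^esub> \<in> carrier R"
  unfolding carrier_R by (auto simp: one_R paths_ext_quiver)

lemma convolution_one_left:
  assumes "x \<in> carrier R" shows "convolution \<one>\<^bsub>R\<^esub> x = x"
proof
  fix q :: "nat \<times> arrow list"
  obtain u xs where q: "q = (u, xs)" by (cases q)
  have "convolution \<one>\<^bsub>R\<^esub> x q = (\<Sum>k\<le>length xs. if k = 0 then (if u \<le> N then x q else 0) else 0)"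
    unfolding q convolution_def one_R prod.case
  proof (intro sum.cong refl)
    fix k assume "k \<in> {..length xs}"
    then show "(if u \<le> N \<and> take k xs = [] then 1 else 0) * x (u - k, drop k xs) =
        (if k = 0 then if u \<le> N then x (u, xs) else 0 else 0)"
      by (cases "k = 0") auto
  qed
  also have "\<dots> = x q" using R_out[OF assms, of q] by (simp add: q paths_ext_quiver)
  finally show "convolution \<one>\<^bsub>R\<^esub> x q = x q" .
qed

lemma convolution_one_right:
  assumes "x \<in> carrier R" shows "convolution x \<one>\<^bsub>R\<^esub> = x"
proof
  fix q :: "nat \<times> arrow list"
  obtain u xs where q: "q = (u, xs)" by (cases q)
  have "convolution x \<one>\<^bsub>R\<^esub> q = (\<Sum>k\<le>length xs. if k = length xs then (if u - length xs \<le> N then x q else 0) else 0)"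
    unfolding q convolution_def one_R prod.case
    by (intro sum.cong refl) auto
  also have "\<dots> = x q"
    using R_out[OF assms, of q] by (cases "u \<le> N") (auto simp: q paths_ext_quiver)
  finally show "convolution x \<one>\<^bsub>R\<^esub> q = x q" .
qed

lemma ring_R: "ring R"
proof (rule ringI)
  show "abelian_group R"
  proof (rule abelian_groupI)
    fix x assume "x \<in> carrier R"
    then show "\<exists>y\<in>carrier R. y \<oplus>\<^bsub>R\<^esub> x = \<zero>\<^bsub>R\<^esub>"
      unfolding carrier_R by (intro bexI[of _ "\<lambda>q. - x q"]) (auto simp: add_R zero_R carrier_R)
  qed (auto simp: carrier_R add_R zero_R add_ac)
  show "Group.monoid R"
  proof (rule monoidI)
    show "x \<otimes>\<^bsub>R\<^esub> y \<otimes>\<^bsub>R\<^esub> z = x \<otimes>\<^bsub>R\<^esub> (y \<otimes>\<^bsub>R\<^esub> z)" if "x \<in> carrier R" "y \<in> carrier R" for x y z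
      by (simp only: mult_R[OF mult_R_closed[OF that], unfolded mult_R[OF that(1)]] mult_R[OF that(1)]
          mult_R[OF that(2)] convolution_assoc)
    show "x \<otimes>\<^bsub>R\<^esub> y \<in> carrier R" if "x \<in> carrier R" "y \<in> carrier R" for x y
      using that by (rule mult_R_closed)
  qed (simp_all add: one_R_closed mult_R convolution_one_left convolution_one_right)
  show "(x \<oplus>\<^bsub>R\<^esub> y) \<otimes>\<^bsub>R\<^esub> z = x \<otimes>\<^bsub>R\<^esub> z \<oplus>\<^bsub>R\<^esub> y \<otimes>\<^bsub>R\<^esub> z"
    "z \<otimes>\<^bsub>R\<^esub> (x \<oplus>\<^bsub>R\<^esub> y) = z \<otimes>\<^bsub>R\<^esub> x \<oplus>\<^bsub>R\<^esub> z \<otimes>\<^bsub>R\<^esub> y"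
    if "x \<in> carrier R" "y \<in> carrier R" "z \<in> carrier R" for x y z
  proof -
    have "x \<oplus>\<^bsub>R\<^esub> y \<in> carrier R" using that by (auto simp: carrier_R add_R)
    then show "(x \<oplus>\<^bsub>R\<^esub> y) \<otimes>\<^bsub>R\<^esub> z = x \<otimes>\<^bsub>R\<^esub> z \<oplus>\<^bsub>R\<^esub> y \<otimes>\<^bsub>R\<^esub> z"
      "z \<otimes>\<^bsub>R\<^esub> (x \<oplus>\<^bsub>R\<^esub> y) = z \<otimes>\<^bsub>R\<^esub> x \<oplus>\<^bsub>R\<^esub> z \<otimes>\<^bsub>R\<^esub> y"
      using that
      by (auto simp: mult_R add_R convolution_def fun_eq_iff algebra_simps sum.distrib)
  qed
qed

sublocale R: ring R by (rule ring_R)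

section \<open>Counting paths by their keys\<close>

definition count_paths :: "(nat \<times> arrow list \<Rightarrow> complex) \<Rightarrow> coeffs" where
  "count_paths x k = (\<Sum>q\<in>{q \<in> paths Q. key q = k}. x q)"

lemma finite_key: "finite {q \<in> paths Q. key q = k}"
  using finite_paths_ext_quiver by simp

text \<open>Cutting the paths with key \<open>(a, b, s)\<close> at all positions gives exactly the
  composable pairs whose numbers of \<open>F\<close> add up to \<open>s\<close>.\<close>

lemma count_paths_mult:
  assumes x: "x \<in> carrier R" and y: "y \<in> carrier R"
  shows "count_paths (x \<otimes>\<^bsub>R\<^esub> y) (a, b, s) =
    (\<Sum>c\<le>N. \<Sum>t\<le>s. count_paths x (a, c, t) * count_paths y (c, b, s - t))"
proof -
  let ?K = "\<lambda>k. {q \<in> paths Q. key q = k}"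
  let ?S = "SIGMA q:?K (a, b, s). {..length (snd q)}"
  let ?T = "SIGMA ct:{..N} \<times> {..s}. ?K (a, fst ct, snd ct) \<times> ?K (fst ct, b, s - snd ct)"
  have "count_paths (x \<otimes>\<^bsub>R\<^esub> y) (a, b, s) =
      (\<Sum>q\<in>?K (a, b, s). \<Sum>k\<le>length (snd q). x (fst q, take k (snd q)) * y (fst q - k, drop k (snd q)))"
    unfolding count_paths_def mult_R[OF x] convolution_def
    by (rule sum.cong[OF refl]) (simp add: split_def)
  also have "\<dots> = (\<Sum>(q, k)\<in>?S. x (fst q, take k (snd q)) * y (fst q - k, drop k (snd q)))"
    by (rule sum.Sigma) (auto simp: finite_paths_ext_quiver)
  also have "\<dots> = (\<Sum>(ct, q1, q2)\<in>?T. x q1 * y q2)"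
  proof (rule sum.reindex_bij_witness[of _
      "\<lambda>(ct, q1, q2). ((fst q1, snd q1 @ snd q2), length (snd q1))"
      "\<lambda>(q, k). ((fst q - k, F_count (take k (snd q))),
        (fst q, take k (snd q)), (fst q - k, drop k (snd q)))"])
    fix z assume "z \<in> ?S"
    then obtain xs k where z: "z = ((a, xs), k)" "(a, xs) \<in> paths Q" "a - length xs = b"
      "F_count xs = s" "k \<le> length xs"
      by (cases z) auto
    have d: "a \<le> N" "descending a (take k xs)" "descending (a - k) (drop k xs)"
      using z(2,5) descending_append[of a "take k xs" "drop k xs"] by (auto simp: paths_ext_quiver)
    have F: "F_count (take k xs) + F_count (drop k xs) = s"
      using z(4) F_count_simps(3)[of "take k xs" "drop k xs"] by simp
    let ?g = "(\<lambda>(q, k). ((fst q - k, F_count (take k (snd q))),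
        (fst q, take k (snd q)), (fst q - k, drop k (snd q)))) z"
    show "(\<lambda>(ct, q1, q2). ((fst q1, snd q1 @ snd q2), length (snd q1))) ?g = z"
      using z by simp
    show "?g \<in> ?T"
      using z d F by (auto simp: paths_ext_quiver)
    show "(case ?g of (ct, q1, q2) \<Rightarrow> x q1 * y q2) =
        (case z of (q, k) \<Rightarrow> x (fst q, take k (snd q)) * y (fst q - k, drop k (snd q)))"
      using z by simp
  next
    fix z assume "z \<in> ?T"
    then obtain c t xs ys where z: "z = ((c, t), (a, xs), (c, ys))" "t \<le> s" "c \<le> N"
      "(a, xs) \<in> paths Q" "(c, ys) \<in> paths Q" "a - length xs = c" "F_count xs = t"
      "c - length ys = b" "F_count ys = s - t"
      by (cases z) auto
    let ?g = "(\<lambda>(ct, q1, q2). ((fst q1, snd q1 @ snd q2), length (snd q1))) z"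
    show "(\<lambda>(q, k). ((fst q - k, F_count (take k (snd q))),
        (fst q, take k (snd q)), (fst q - k, drop k (snd q)))) ?g = z"
      using z by simp
    show "?g \<in> ?S"
      using z by (auto simp: paths_ext_quiver descending_append)
  qed
  also have "\<dots> = (\<Sum>ct\<in>{..N} \<times> {..s}. \<Sum>(q1, q2)\<in>?K (a, fst ct, snd ct) \<times> ?K (fst ct, b, s - snd ct). x q1 * y q2)"
    by (subst sum.Sigma) (auto simp: finite_paths_ext_quiver)
  also have "\<dots> = (\<Sum>ct\<in>{..N} \<times> {..s}. count_paths x (a, fst ct, snd ct) * count_paths y (fst ct, b, s - snd ct))"
    by (simp add: count_paths_def sum_product sum.cartesian_product)
  also have "\<dots> = (\<Sum>c\<le>N. \<Sum>t\<le>s. count_paths x (a, c, t) * count_paths y (c, b, s - t))"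
    by (simp add: sum.cartesian_product split_def)
  finally show ?thesis .
qed

text \<open>Discarding \<open>s \<ge> 2\<close> is the passage to the dual numbers.\<close>

definition T :: "(nat \<times> arrow list \<Rightarrow> complex) \<Rightarrow> coeffs" where
  "T x = (\<lambda>(a, b, s). if s \<le> 1 then count_paths x (a, b, s) else 0)"

lemma T_add: "T (x \<oplus>\<^bsub>R\<^esub> y) k = T x k + T y k"
  by (cases k) (simp add: T_def count_paths_def add_R sum.distrib)

lemma T_smult: "T (c \<odot>\<^bsub>R\<^esub> x) k = c * T x k"
  by (cases k) (simp add: T_def count_paths_def smult_R sum_distrib_left)

lemma T_mult:
  assumes "x \<in> carrier R" "y \<in> carrier R"
  shows "T (x \<otimes>\<^bsub>R\<^esub> y) = coeff_mult N (T x) (T y)"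
proof -
  have "T (x \<otimes>\<^bsub>R\<^esub> y) (a, b, s) = coeff_mult N (T x) (T y) (a, b, s)" for a b s
  proof (cases "s \<le> 1")
    case False
    then show ?thesis by (simp add: T_def coeff_mult_def)
  next
    case True
    then consider "s = 0" | "s = 1" by linarith
    then show ?thesis
      using count_paths_mult[OF assms, of a b s] by cases (auto simp: T_def coeff_mult_def sum.distrib)
  qed
  then show ?thesis by (auto simp: fun_eq_iff)
qed

lemma single_R_closed: "q \<in> paths Q \<Longrightarrow> single q \<in> carrier R"
  by (auto simp: carrier_R single_apply)

lemma T_single:
  assumes "q \<in> paths Q"
  shows "T (single q) (a, b, s) = (if key q = (a, b, s) \<and> s \<le> 1 then 1 else 0)"
proof -
  have "count_paths (single q) (a, b, s) = (\<Sum>q'\<in>{q' \<in> paths Q. key q' = (a, b, s)}. if q' = q then 1 else 0)"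
    unfolding count_paths_def by (intro sum.cong) (auto simp: single_apply)
  then show ?thesis using assms finite_key by (auto simp: T_def)
qed

lemma T_closed: "T x \<in> coefficient_space N"
  unfolding coefficient_space_def
proof (intro CollectI allI impI)
  fix a b s assume nz: "T x (a, b, s) \<noteq> 0"
  then have s: "s \<le> 1" and c: "count_paths x (a, b, s) \<noteq> 0" by (auto simp: T_def split: if_splits)
  have "{q \<in> paths Q. key q = (a, b, s)} \<noteq> {}"
  proof
    assume e: "{q \<in> paths Q. key q = (a, b, s)} = {}"
    have "count_paths x (a, b, s) = 0" unfolding count_paths_def e by simp
    then show False using c by simp
  qed
  then obtain xs where "(a, xs) \<in> paths Q" "b = a - length xs" "F_count xs = s" by auto
  then have "a \<le> N" "length xs \<le> a" "s \<le> length xs"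
    using descending_length by (auto simp: paths_ext_quiver F_count_def)
  then show "b + s \<le> a \<and> a \<le> N \<and> s \<le> 1" using s \<open>b = a - length xs\<close> by auto
qed

lemma single_mult_R:
  assumes "(u, xs) \<in> paths Q" "(u - length xs, ys) \<in> paths Q"
  shows "single (u, xs) \<otimes>\<^bsub>R\<^esub> single (u - length xs, ys) = single (u, xs @ ys)"
proof
  fix q :: "nat \<times> arrow list"
  obtain v zs where q: "q = (v, zs)" by (cases q)
  have "(single (u, xs) \<otimes>\<^bsub>R\<^esub> single (u - length xs, ys)) q =
      (\<Sum>k\<le>length zs. if k = length xs then (if v = u \<and> zs = xs @ ys then 1 else 0) else 0)"
    unfolding mult_R[OF single_R_closed[OF assms(1)]] q convolution_def prod.case
  proof (intro sum.cong refl)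
    fix k assume "k \<in> {..length zs}"
    then have len: "length (take k zs) = k" by simp
    have "take k zs = xs \<and> drop k zs = ys \<longleftrightarrow> k = length xs \<and> zs = xs @ ys"
      using len append_take_drop_id[of k zs] by auto
    then show "single (u, xs) (v, take k zs) * single (u - length xs, ys) (v - k, drop k zs) =
        (if k = length xs then if v = u \<and> zs = xs @ ys then 1 else 0 else 0)"
      using len by (cases "k = length xs") (auto simp: single_apply)
  qed
  also have "\<dots> = single (u, xs @ ys) q" by (auto simp: q single_apply)
  finally show "(single (u, xs) \<otimes>\<^bsub>R\<^esub> single (u - length xs, ys)) q = single (u, xs @ ys) q" .
qed

section \<open>The ideal of relations as the kernel of the counting map\<close>

abbreviation "I \<equiv> ext_ideal N"

lemma relations_paths:
  assumes "j \<in> {2..N}"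
  shows "(j, [F_arrow j, F_arrow (j - 1)]) \<in> paths Q"
    "(j, [F_arrow j, Id_arrow (j - 1)]) \<in> paths Q" "(j, [Id_arrow j, F_arrow (j - 1)]) \<in> paths Q"
  using assms by (auto simp: paths_ext_quiver)

lemma relations_closed: "ext_relations N \<subseteq> carrier R"
proof
  fix x assume "x \<in> ext_relations N"
  then show "x \<in> carrier R"
    unfolding ext_relations_def
  proof (elim UnE CollectE exE conjE)
    fix j assume j: "x = single (j, [F_arrow j, F_arrow (j - 1)])" "j \<in> {2..N}"
    then show ?thesis using relations_paths single_R_closed by simp
  next
    fix j assume j: "x = (\<lambda>q. single (j, [F_arrow j, Id_arrow (j - 1)]) q - single (j, [Id_arrow j, F_arrow (j - 1)]) q)"
      "j \<in> {2..N}"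
    show ?thesis
      unfolding carrier_R j(1)
      using single_R_closed[OF relations_paths(2)[OF j(2)], unfolded carrier_R]
        single_R_closed[OF relations_paths(3)[OF j(2)], unfolded carrier_R] by simp
  qed
qed

lemma ideal_I: "ideal I R"
  unfolding ext_ideal_def by (rule R.genideal_ideal[OF relations_closed])

text \<open>The kernel is an ideal because \<open>T\<close> is multiplicative. The inclusion of
  \<open>I\<close> then has to be checked on the relations only.\<close>

lemma ideal_kernel: "ideal {x \<in> carrier R. \<forall>k. T x k = 0} R" (is "ideal ?K R")
proof (rule idealI[OF ring_R])
  have add: "x \<oplus>\<^bsub>R\<^esub> y \<in> ?K" if "x \<in> ?K" "y \<in> ?K" for x y
    using that by (simp add: T_add)
  show "subgroup ?K (add_monoid R)"
  proof (rule R.add.subgroupI)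
    have "T \<zero>\<^bsub>R\<^esub> k = 0" for k using T_smult[of 0 "\<zero>\<^bsub>R\<^esub>" k] by (simp add: smult_R zero_R)
    then show "?K \<noteq> {}" using R.zero_closed by blast
    show "\<ominus>\<^bsub>R\<^esub> x \<in> ?K" if x: "x \<in> ?K" for x
    proof -
      have "\<ominus>\<^bsub>R\<^esub> x = (- 1) \<odot>\<^bsub>R\<^esub> x"
        by (rule R.minus_equality) (use x in \<open>auto simp: smult_R add_R zero_R carrier_R\<close>)
      moreover have "(- 1) \<odot>\<^bsub>R\<^esub> x \<in> carrier R" using x by (simp add: carrier_R smult_R)
      ultimately show ?thesis using x T_smult[of "- 1" x] by simp
    qed
  qed (use add in auto)
  show "x \<otimes>\<^bsub>R\<^esub> y \<in> ?K" "y \<otimes>\<^bsub>R\<^esub> x \<in> ?K" if "y \<in> ?K" "x \<in> carrier R" for x y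
  proof -
    have "T y = (\<lambda>k. 0)" using that by auto
    then have "coeff_mult N (T x) (T y) k = 0" "coeff_mult N (T y) (T x) k = 0" for k
      by (cases k; simp add: coeff_mult_def)+
    then show "x \<otimes>\<^bsub>R\<^esub> y \<in> ?K" "y \<otimes>\<^bsub>R\<^esub> x \<in> ?K" using that by (simp_all add: T_mult)
  qed
qed

text \<open>\<open>F F\<close> has \<open>s = 2\<close>, which \<open>T\<close> discards, and
  \<open>F Id\<close> has the same key as \<open>Id F\<close>.\<close>

lemma T_relations:
  assumes "x \<in> ext_relations N"
  shows "T x k = 0"
proof -
  obtain a b s where k: "k = (a, b, s)" by (cases k)
  show ?thesis
    using assms unfolding ext_relations_def
  proof (elim UnE CollectE exE conjE)
    fix j assume "x = single (j, [F_arrow j, F_arrow (j - 1)])" "j \<in> {2..N}"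
    then show ?thesis using T_single[OF relations_paths(1), of j a b s] k by auto
  next
    fix j assume j: "x = (\<lambda>q. single (j, [F_arrow j, Id_arrow (j - 1)]) q - single (j, [Id_arrow j, F_arrow (j - 1)]) q)"
      "j \<in> {2..N}"
    have x: "x = single (j, [F_arrow j, Id_arrow (j - 1)]) \<oplus>\<^bsub>R\<^esub> (- 1) \<odot>\<^bsub>R\<^esub> single (j, [Id_arrow j, F_arrow (j - 1)])"
      by (simp add: j(1) add_R smult_R)
    show ?thesis
      unfolding x T_add T_smult k T_single[OF relations_paths(2)[OF j(2)]] T_single[OF relations_paths(3)[OF j(2)]]
      by simp
  qed
qed

lemma I_subset_kernel: "I \<subseteq> {x \<in> carrier R. \<forall>k. T x k = 0}"
  unfolding ext_ideal_def
  by (rule R.genideal_minimal[OF ideal_kernel]) (use relations_closed T_relations in auto)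

interpretation I: ideal I R by (rule ideal_I)

text \<open>\<open>Idl\<close> gives a ring ideal; scalars reach it through multiplication by
  \<open>c\<close> times the unit.\<close>

lemma I_smult:
  assumes "x \<in> I" shows "(\<lambda>t. c * x t) \<in> I"
proof -
  have x: "x \<in> carrier R" using assms by (rule I.a_Hcarr)
  have c: "c \<odot>\<^bsub>R\<^esub> \<one>\<^bsub>R\<^esub> \<in> carrier R" using one_R_closed by (simp add: carrier_R smult_R)
  have "(c \<odot>\<^bsub>R\<^esub> \<one>\<^bsub>R\<^esub>) \<otimes>\<^bsub>R\<^esub> x = (\<lambda>t. c * x t)"
    using convolution_one_left[OF x]
    unfolding mult_R[OF c] by (simp add: convolution_def smult_R fun_eq_iff mult.assoc flip: sum_distrib_left)
  then show ?thesis using I.I_l_closed[OF assms c] by simp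
qed

lemma I_add: "x \<in> I \<Longrightarrow> y \<in> I \<Longrightarrow> (\<lambda>t. x t + y t) \<in> I"
  using I.a_closed[of x y] by (simp add: add_R)

text \<open>Here and below, congruence modulo \<open>I\<close> is written as membership of the
  pointwise difference.\<close>

lemma I_diff_trans:
  assumes "(\<lambda>t. x t - y t) \<in> I" "(\<lambda>t. y t - z t) \<in> I"
  shows "(\<lambda>t. x t - z t) \<in> I"
  using I_add[OF assms] by simp

lemma I_diff_zero:
  assumes "(\<lambda>t. x t - y t) \<in> I" "y \<in> I"
  shows "x \<in> I"
  using I_add[OF assms] by simp

lemma I_diff_mult:
  assumes "(\<lambda>t. x t - y t) \<in> I" "x \<in> carrier R" "y \<in> carrier R" "z \<in> carrier R"
  shows "(\<lambda>t. (x \<otimes>\<^bsub>R\<^esub> z) t - (y \<otimes>\<^bsub>R\<^esub> z) t) \<in> I" "(\<lambda>t. (z \<otimes>\<^bsub>R\<^esub> x) t - (z \<otimes>\<^bsub>R\<^esub> y) t) \<in> I"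
proof -
  have "(\<lambda>t. x t - y t) \<otimes>\<^bsub>R\<^esub> z = (\<lambda>t. (x \<otimes>\<^bsub>R\<^esub> z) t - (y \<otimes>\<^bsub>R\<^esub> z) t)"
    using I.a_Hcarr[OF assms(1)] assms(2,3)
    by (auto simp: mult_R convolution_def fun_eq_iff left_diff_distrib sum_subtractf)
  then show "(\<lambda>t. (x \<otimes>\<^bsub>R\<^esub> z) t - (y \<otimes>\<^bsub>R\<^esub> z) t) \<in> I" using I.I_r_closed[OF assms(1,4)] by simp
  have "z \<otimes>\<^bsub>R\<^esub> (\<lambda>t. x t - y t) = (\<lambda>t. (z \<otimes>\<^bsub>R\<^esub> x) t - (z \<otimes>\<^bsub>R\<^esub> y) t)"
    using assms(4)
    by (auto simp: mult_R convolution_def fun_eq_iff right_diff_distrib sum_subtractf)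
  then show "(\<lambda>t. (z \<otimes>\<^bsub>R\<^esub> x) t - (z \<otimes>\<^bsub>R\<^esub> y) t) \<in> I" using I.I_l_closed[OF assms(1,4)] by simp
qed

lemma relation_in_I: "x \<in> ext_relations N \<Longrightarrow> x \<in> I"
  unfolding ext_ideal_def using R.genideal_self[OF relations_closed] by blast

text \<open>The relation \<open>F Id = Id F\<close> moves an arrow \<open>F\<close> to the front.\<close>

lemma move_F_front:
  assumes "u \<le> N" "descending u xs" "F_count xs \<ge> 1"
  shows "\<exists>ys. descending u (F_arrow u # ys) \<and> length xs = Suc (length ys) \<and>
    F_count xs = Suc (F_count ys) \<and> (\<lambda>t. single (u, xs) t - single (u, F_arrow u # ys) t) \<in> I"
  using assms
proof (induction xs arbitrary: u)
  case (Cons x xs)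
  show ?case
  proof (cases "is_F x")
    case True
    then have "x = F_arrow u" using Cons.prems by (simp add: is_F_def)
    moreover have "(\<lambda>t. 0) \<in> I" using I.additive_subgroup_axioms zero_R
      by (metis additive_subgroup.zero_closed)
    ultimately show ?thesis using Cons.prems by (intro exI[of _ xs]) simp
  next
    case False
    then have x: "x = Id_arrow u" "1 \<le> u" using Cons.prems by (cases x; simp)+
    have "u - 1 \<le> N" "descending (u - 1) xs" "1 \<le> F_count xs"
      using Cons.prems False by auto
    from Cons.IH[OF this] obtain ys where ys: "descending (u - 1) (F_arrow (u - 1) # ys)" "length xs = Suc (length ys)"
      "F_count xs = Suc (F_count ys)"
      "(\<lambda>t. single (u - 1, xs) t - single (u - 1, F_arrow (u - 1) # ys) t) \<in> I"
      by blast
    \<comment> \<open>After \<open>Id_arrow u\<close> the path still uses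
      \<open>F_arrow (u - 1)\<close>, so \<open>u - 1 \<ge> 1\<close> and the relation at
      \<open>u\<close> is available.\<close>
    have u: "u \<in> {2..N}" using ys(1) Cons.prems by auto
    have p: "(u, [Id_arrow u]) \<in> paths Q" "(u - 1, xs) \<in> paths Q" "(u - 1, F_arrow (u - 1) # ys) \<in> paths Q"
      "(u - 2, ys) \<in> paths Q"
      using x ys(1) Cons.prems u by (auto simp: paths_ext_quiver numeral_2_eq_2)
    have 1: "(\<lambda>t. single (u, Id_arrow u # xs) t - single (u, Id_arrow u # F_arrow (u - 1) # ys) t) \<in> I"
      using I_diff_mult(2)[OF ys(4) single_R_closed[OF p(2)] single_R_closed[OF p(3)] single_R_closed[OF p(1)]]
        single_mult_R[OF p(1), of xs] single_mult_R[OF p(1), of "F_arrow (u - 1) # ys"] p(2,3)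
      by simp
    have "(\<lambda>q. single (u, [F_arrow u, Id_arrow (u - 1)]) q - single (u, [Id_arrow u, F_arrow (u - 1)]) q) \<in> ext_relations N"
      using u unfolding ext_relations_def by blast
    then have rel: "(\<lambda>q. single (u, [F_arrow u, Id_arrow (u - 1)]) q - single (u, [Id_arrow u, F_arrow (u - 1)]) q) \<in> I"
      by (rule relation_in_I)
    have "(\<lambda>t. single (u, [F_arrow u, Id_arrow (u - 1)] @ ys) t - single (u, [Id_arrow u, F_arrow (u - 1)] @ ys) t) \<in> I"
      using I_diff_mult(1)[OF rel single_R_closed[OF relations_paths(2)[OF u]]
          single_R_closed[OF relations_paths(3)[OF u]] single_R_closed[OF p(4)]]
        single_mult_R[OF relations_paths(2)[OF u], of ys] single_mult_R[OF relations_paths(3)[OF u], of ys] p(4)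
      by (simp add: numeral_2_eq_2)
    \<comment> \<open>The relation is used from right to left, hence the change of sign.\<close>
    from I_smult[OF this, of "- 1"]
    have "(\<lambda>t. single (u, Id_arrow u # F_arrow (u - 1) # ys) t - single (u, F_arrow u # Id_arrow (u - 1) # ys) t) \<in> I"
      by simp
    from I_diff_trans[OF 1 this] show ?thesis
      using x ys u by (intro exI[of _ "Id_arrow (u - 1) # ys"]) auto
  qed
qed simp

fun identities :: "nat \<Rightarrow> nat \<Rightarrow> arrow list" where
  "identities u 0 = []"
| "identities u (Suc n) = Id_arrow u # identities (u - 1) n"

lemma length_identities [simp]: "length (identities u n) = n"
  by (induction u n rule: identities.induct) auto

lemma F_count_identities [simp]: "F_count (identities u n) = 0"
  by (induction u n rule: identities.induct) auto

lemma descending_identities: "n \<le> u \<Longrightarrow> descending u (identities u n)"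
  by (induction u n rule: identities.induct) auto

lemma eq_identities: "descending u xs \<Longrightarrow> F_count xs = 0 \<Longrightarrow> xs = identities u (length xs)"
proof (induction xs arbitrary: u)
  case (Cons x xs)
  then show ?case by (cases x) (auto split: if_splits)
qed simp

text \<open>One path per key with \<open>s \<le> 1\<close>: an arrow \<open>F\<close>, if there is
  one, comes at the start.\<close>

definition normal_path :: "nat \<times> nat \<times> nat \<Rightarrow> nat \<times> arrow list" where
  "normal_path = (\<lambda>(a, b, s). (a, if s = 0 then identities a (a - b)
    else F_arrow a # identities (a - 1) (a - 1 - b)))"

lemma normal_path:
  assumes "b + s \<le> a" "a \<le> N" "s \<le> 1"
  shows "normal_path (a, b, s) \<in> paths Q" "key (normal_path (a, b, s)) = (a, b, s)"
  using assms by (auto simp: normal_path_def paths_ext_quiver descending_identities)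

definition normal_form :: "nat \<times> arrow list \<Rightarrow> nat \<times> arrow list \<Rightarrow> complex" where
  "normal_form q = (if F_count (snd q) \<le> 1 then single (normal_path (key q)) else (\<lambda>t. 0))"

text \<open>Without \<open>F\<close> the path is already normal, a single \<open>F\<close> moves to
  the front, and of several the first two can be made adjacent at the front, where
  \<open>F F = 0\<close> applies.\<close>

lemma reduces_to_normal_form:
  assumes "q \<in> paths Q"
  shows "(\<lambda>t. single q t - normal_form q t) \<in> I"
proof -
  obtain u xs where q: "q = (u, xs)" "u \<le> N" "descending u xs"
    using assms by (cases q) (auto simp: paths_ext_quiver)
  have zero: "(\<lambda>t. 0) \<in> I" using I.additive_subgroup_axioms zero_R
    by (metis additive_subgroup.zero_closed)
  show ?thesis
  proof (cases "F_count xs")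
    case 0
    then have "normal_form q = single q"
      using q eq_identities[OF q(3)] descending_length[OF q(3)] by (simp add: normal_form_def normal_path_def)
    then show ?thesis using zero by simp
  next
    case (Suc n)
    then obtain ys where ys: "descending u (F_arrow u # ys)" "length xs = Suc (length ys)"
      "F_count ys = n" "(\<lambda>t. single (u, xs) t - single (u, F_arrow u # ys) t) \<in> I"
      using move_F_front[OF q(2,3)] by auto
    have u1: "1 \<le> u" "descending (u - 1) ys" using ys by auto
    show ?thesis
    proof (cases n)
      case 0
      then have "ys = identities (u - 1) (length ys)" using ys u1 eq_identities by blast
      moreover have "u - 1 - (u - length xs) = length ys"
        using descending_length[OF q(3)] ys(2) by simp
      ultimately have "normal_form q = single (u, F_arrow u # ys)"
        using Suc 0 q by (simp add: normal_form_def normal_path_def)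
      then show ?thesis using ys(4) q by simp
    next
      case (Suc m)
      then have "u - 1 \<le> N" "1 \<le> F_count ys" using q ys(3) by auto
      then obtain zs where zs: "descending (u - 1) (F_arrow (u - 1) # zs)"
        "(\<lambda>t. single (u - 1, ys) t - single (u - 1, F_arrow (u - 1) # zs) t) \<in> I"
        using move_F_front[of "u - 1" ys] u1(2) by blast
      have u: "u \<in> {2..N}" using zs(1) q u1 by auto
      have p: "(u, [F_arrow u]) \<in> paths Q" "(u - 1, ys) \<in> paths Q" "(u - 1, F_arrow (u - 1) # zs) \<in> paths Q"
        "(u - 2, zs) \<in> paths Q"
        using u1 zs(1) q u by (auto simp: paths_ext_quiver numeral_2_eq_2)
      have 1: "(\<lambda>t. single (u, F_arrow u # ys) t - single (u, F_arrow u # F_arrow (u - 1) # zs) t) \<in> I"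
        using I_diff_mult(2)[OF zs(2) single_R_closed[OF p(2)] single_R_closed[OF p(3)] single_R_closed[OF p(1)]]
          single_mult_R[OF p(1), of ys] single_mult_R[OF p(1), of "F_arrow (u - 1) # zs"] p(2,3)
        by simp
      have "single (u, [F_arrow u, F_arrow (u - 1)]) \<in> ext_relations N"
        using u unfolding ext_relations_def by blast
      then have rel: "single (u, [F_arrow u, F_arrow (u - 1)]) \<in> I" by (rule relation_in_I)
      have "single (u, [F_arrow u, F_arrow (u - 1)] @ zs) \<in> I"
        using I.I_r_closed[OF rel single_R_closed[OF p(4)]] single_mult_R[OF relations_paths(1)[OF u], of zs] p(4)
        by (simp add: numeral_2_eq_2)
      then have "single (u, F_arrow u # ys) \<in> I" using I_diff_zero[OF 1] by simp
      then have "single (u, xs) \<in> I" by (rule I_diff_zero[OF ys(4)])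
      moreover have "normal_form q = (\<lambda>t. 0)"
        using Suc \<open>F_count xs = Suc n\<close> q by (simp add: normal_form_def)
      ultimately show ?thesis using q by simp
    qed
  qed
qed

lemma I_sum:
  assumes "finite S" "\<And>q. q \<in> S \<Longrightarrow> f q \<in> I"
  shows "(\<lambda>t. \<Sum>q\<in>S. f q t) \<in> I"
  using assms
proof (induction S rule: finite_induct)
  case empty
  show ?case using I.additive_subgroup_axioms zero_R by (simp, metis additive_subgroup.zero_closed)
next
  case (insert q S)
  then show ?case using I_add by simp
qed

lemma key_coefficient:
  assumes "q \<in> paths Q" "F_count (snd q) \<le> 1"
  shows "normal_path (key q) \<in> paths Q \<and> key (normal_path (key q)) = key q"
proof -
  obtain u xs where q: "q = (u, xs)" "u \<le> N" "descending u xs"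
    using assms by (cases q) (auto simp: paths_ext_quiver)
  have "F_count xs \<le> length xs" by (simp add: F_count_def)
  then have "u - length xs + F_count xs \<le> u" using descending_length[OF q(3)] by simp
  then show ?thesis using q assms(2) normal_path[of "u - length xs" "F_count xs" u] by simp
qed

text \<open>Replacing every path by its normal form gives a combination of normal paths whose
  coefficients are the values of \<open>T\<close>. If these vanish, the element is the sum of the
  differences between its paths and their normal forms.\<close>

lemma kernel_subset_I:
  assumes x: "x \<in> carrier R" and T: "\<And>k. T x k = 0"
  shows "x \<in> I"
proof -
  have fin: "finite (paths Q)" by (rule finite_paths_ext_quiver)
  have "(\<lambda>t. \<Sum>q\<in>paths Q. x q * (single q t - normal_form q t)) \<in> I"
    by (intro I_sum fin I_smult reduces_to_normal_form)
  moreover have "(\<Sum>q\<in>paths Q. x q * (single q t - normal_form q t)) = x t" for t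
  proof -
    have "(\<Sum>q\<in>paths Q. x q * single q t) = (\<Sum>q\<in>paths Q. if q = t then x t else 0)"
      by (intro sum.cong) (auto simp: single_apply)
    also have "\<dots> = x t" using fin R_out[OF x, of t] by simp
    finally have 1: "(\<Sum>q\<in>paths Q. x q * single q t) = x t" .
    \<comment> \<open>Says that \<open>t\<close> is itself a normal path. Exactly then do the normal
      forms contribute to the coefficient at \<open>t\<close>, one for each path with the key of
      \<open>t\<close>.\<close>
    let ?ok = "t = normal_path (key t) \<and> F_count (snd t) \<le> 1"
    have "x q * normal_form q t = (if ?ok \<and> key q = key t then x q else 0)" if q: "q \<in> paths Q" for q
    proof (cases "F_count (snd q) \<le> 1")
      case True
      have "t = normal_path (key q) \<longleftrightarrow> ?ok \<and> key q = key t"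
        using key_coefficient[OF q True] True by (auto simp: key_def)
      then show ?thesis using True by (auto simp: normal_form_def single_apply)
    next
      case False
      then show ?thesis by (auto simp: normal_form_def key_def)
    qed
    then have "(\<Sum>q\<in>paths Q. x q * normal_form q t) = (\<Sum>q\<in>paths Q. if ?ok \<and> key q = key t then x q else 0)"
      by (intro sum.cong) auto
    also have "\<dots> = 0"
    proof (cases ?ok)
      case True
      then have "(\<Sum>q\<in>paths Q. if ?ok \<and> key q = key t then x q else 0) = count_paths x (key t)"
        unfolding count_paths_def using fin by (simp add: sum.inter_filter)
      also have "\<dots> = T x (key t)" using True by (simp add: T_def key_def)
      finally show ?thesis using T by simp
    next
      case False
      then show ?thesis by (intro sum.neutral) auto
    qed
    finally show ?thesis using 1 by (simp add: right_diff_distrib sum_subtractf)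
  qed
  ultimately show ?thesis by simp
qed

sublocale quotient: coordinatized_quotient R I T
proof
  show "carrier R \<noteq> {}" using R.zero_closed by blast
  show "\<exists>b\<in>carrier R. x = b \<oplus>\<^bsub>R\<^esub> y" if "x \<in> carrier R" "y \<in> carrier R" for x y
    using that by (intro bexI[of _ "\<lambda>t. x t - y t"]) (auto simp: add_R carrier_R)
  show "I = {x \<in> carrier R. \<forall>k. T x k = 0}"
    using I_subset_kernel kernel_subset_I by blast
qed (auto simp: T_add T_smult R.add.m_closed, auto simp: carrier_R smult_R)

lemma quotient_mult:
  assumes "x \<in> carrier R" "y \<in> carrier R"
  shows "(I +>\<^bsub>R\<^esub> x) \<otimes>\<^bsub>quot R I\<^esub> (I +>\<^bsub>R\<^esub> y) = I +>\<^bsub>R\<^esub> (x \<otimes>\<^bsub>R\<^esub> y)"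
  using I.rcoset_mult_add[OF assms] by (simp add: quot_def FactRing_def)

lemma quotient_one: "\<one>\<^bsub>quot R I\<^esub> = I +>\<^bsub>R\<^esub> \<one>\<^bsub>R\<^esub>"
  by (simp add: quot_def FactRing_def)

lemma T_one: "T \<one>\<^bsub>R\<^esub> (a, b, s) = (if a = b \<and> s = 0 \<and> a \<le> N then 1 else 0)"
proof -
  have "count_paths \<one>\<^bsub>R\<^esub> (a, b, s) = (\<Sum>q\<in>{q \<in> paths Q. key q = (a, b, s)}. if q = (a, []) then 1 else 0)"
    unfolding count_paths_def
    by (rule sum.cong[OF refl]) (auto simp: one_R paths_ext_quiver split: if_splits)
  also have "\<dots> = (if a = b \<and> s = 0 \<and> a \<le> N then 1 else 0)"
    using finite_key by (auto simp: paths_ext_quiver)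
  finally show ?thesis by (auto simp: T_def)
qed

lemma T_surj: "T ` carrier R = coefficient_space N"
proof (intro equalityI subsetI)
  fix \<rho> assume \<rho>: "\<rho> \<in> coefficient_space N"
  \<comment> \<open>Each prescribed coefficient is placed on the normal path of its key.\<close>
  define x where "x = (\<lambda>q. if q \<in> paths Q \<and> q = normal_path (key q) then \<rho> (key q) else 0)"
  have x: "x \<in> carrier R" by (simp add: carrier_R x_def)
  have "T x (a, b, s) = \<rho> (a, b, s)" for a b s
  proof (cases "b + s \<le> a \<and> a \<le> N \<and> s \<le> 1")
    case True
    have "count_paths x (a, b, s) =
        (\<Sum>q\<in>{q \<in> paths Q. key q = (a, b, s)}. if q = normal_path (a, b, s) then \<rho> (a, b, s) else 0)"
      unfolding count_paths_def by (intro sum.cong) (auto simp: x_def)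
    then show ?thesis using True normal_path[of b s a] finite_key by (simp add: T_def)
  next
    case False
    then show ?thesis using coefficient_spaceD[OF \<rho>] coefficient_spaceD[OF T_closed] by simp
  qed
  then have "\<rho> = T x" by (auto simp: fun_eq_iff)
  then show "\<rho> \<in> T ` carrier R" using x by blast
qed (use T_closed in blast)

end

theorem theorem5p9:
  fixes N :: nat
    and P :: "nat \<Rightarrow> (diagram \<Rightarrow> complex, 'b) module"
    and d :: "nat \<Rightarrow> 'b \<Rightarrow> 'b"
    and \<epsilon> :: "'b \<Rightarrow> (nat \<Rightarrow> weight \<Rightarrow> complex)"
  assumes "N \<ge> 1"
    and "projective_resolution (khovanov_algebra N 1) (cell_sum N) P d \<epsilon>"
  shows "\<exists>\<Phi> \<in> algebra_iso (quiver_algebra N) (ext_algebra (khovanov_algebra N 1) (cell_sum N) P d \<epsilon>).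
           \<forall>j\<in>{0..N}. \<Phi> (vertex_idempotent N j) =
             ext_of_hom (khovanov_algebra N 1) (cell_sum N) P d \<epsilon> (summand_proj {0..N} (cell_at N) j)"
proof -
  define A where "A = khovanov_algebra N (Suc 0)"
  interpret khovanov_ext N A P d \<epsilon>
    using assms(2) by (intro khovanov_extI) (simp_all add: A_def)
  interpret Q: quiver_path_algebra N .
  let ?V = "quot Q.R Q.I"
  \<comment> \<open>Both algebras have their coordinates in \<open>coefficient_space N\<close>, and
    the map matches equal coordinates. It is multiplicative because both products become
    \<open>coeff_mult N\<close>.\<close>
  define \<Phi> where "\<Phi> = (\<lambda>X. inv_into (carrier \<E>) \<Theta> (Q.quotient.coord X))"
  have V: "quiver_algebra N = ?V" by (simp add: quiver_algebra_def)
  have rep: "\<exists>x\<in>carrier Q.R. X = Q.I +>\<^bsub>Q.R\<^esub> x" if "X \<in> carrier ?V" for X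
    using that by (auto simp: Q.quotient.carrier_quot)
  have coord: "Q.quotient.coord X \<in> coefficient_space N" if "X \<in> carrier ?V" for X
    using rep[OF that] Q.T_closed by (auto simp: Q.quotient.coord_coset)
  have \<Phi>_closed: "\<Phi> X \<in> carrier \<E>" and \<Theta>_\<Phi>: "\<Theta> (\<Phi> X) = Q.quotient.coord X" if "X \<in> carrier ?V" for X
  proof -
    have "Q.quotient.coord X \<in> \<Theta> ` carrier \<E>" using coord[OF that] by (simp add: \<Theta>_surj)
    then show "\<Phi> X \<in> carrier \<E>" "\<Theta> (\<Phi> X) = Q.quotient.coord X"
      unfolding \<Phi>_def by (simp_all add: inv_into_into f_inv_into_f)
  qed
  \<comment> \<open>Since \<open>\<Theta>\<close> is injective, each law for \<open>\<Phi>\<close>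
    reduces to a comparison of coordinates.\<close>
  have \<Phi>_eqI: "\<Phi> X = y" if "X \<in> carrier ?V" "y \<in> carrier \<E>" "\<And>a b s. \<Theta> y (a, b, s) = Q.quotient.coord X (a, b, s)" for X y
  proof -
    have "\<Theta> y = \<Theta> (\<Phi> X)" using that(3) by (auto simp: \<Theta>_\<Phi>[OF that(1)] fun_eq_iff)
    then show ?thesis using inj_onD[OF \<Theta>_inj] \<Phi>_closed[OF that(1)] that(2) by metis
  qed
  have "\<Phi> \<in> ring_iso ?V \<E>"
  proof (rule ring_iso_memI)
    show "\<Phi> X \<in> carrier \<E>" if "X \<in> carrier ?V" for X by (rule \<Phi>_closed[OF that])
    show "\<Phi> (X \<otimes>\<^bsub>?V\<^esub> Y) = \<Phi> X \<otimes>\<^bsub>\<E>\<^esub> \<Phi> Y" if XY: "X \<in> carrier ?V" "Y \<in> carrier ?V" for X Y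
    proof -
      obtain x y where x: "x \<in> carrier Q.R" "X = Q.I +>\<^bsub>Q.R\<^esub> x" and y: "y \<in> carrier Q.R" "Y = Q.I +>\<^bsub>Q.R\<^esub> y"
        using rep XY by metis
      have "X \<otimes>\<^bsub>?V\<^esub> Y = Q.I +>\<^bsub>Q.R\<^esub> (x \<otimes>\<^bsub>Q.R\<^esub> y)" using x y by (simp add: Q.quotient_mult)
      then have "X \<otimes>\<^bsub>?V\<^esub> Y \<in> carrier ?V"
        "Q.quotient.coord (X \<otimes>\<^bsub>?V\<^esub> Y) = coeff_mult N (Q.quotient.coord X) (Q.quotient.coord Y)"
        using x y by (simp_all add: Q.quotient.coset_in_quot Q.quotient.coord_coset Q.mult_R_closed Q.T_mult)
      then show ?thesis
        using XY \<Phi>_closed by (intro \<Phi>_eqI) (simp_all add: \<E>_mult \<Theta>_\<Phi>)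
    qed
    show "\<Phi> (X \<oplus>\<^bsub>?V\<^esub> Y) = \<Phi> X \<oplus>\<^bsub>\<E>\<^esub> \<Phi> Y" if XY: "X \<in> carrier ?V" "Y \<in> carrier ?V" for X Y
      using XY \<Phi>_closed by (intro \<Phi>_eqI) (simp_all add: \<E>_add \<Theta>_\<Phi> Q.quotient.add_quot)
    show "\<Phi> \<one>\<^bsub>?V\<^esub> = \<one>\<^bsub>\<E>\<^esub>"
      using \<Theta>_one Q.one_R_closed
      by (intro \<Phi>_eqI)
        (simp_all add: Q.quotient_one Q.quotient.coset_in_quot Q.quotient.coord_coset Q.T_one)
    show "bij_betw \<Phi> (carrier ?V) (carrier \<E>)"
    proof (rule bij_betw_imageI)
      show "inj_on \<Phi> (carrier ?V)"
        by (rule inj_onI) (metis \<Theta>_\<Phi> Q.quotient.coord_inj)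
      show "\<Phi> ` carrier ?V = carrier \<E>"
      proof (intro equalityI subsetI)
        fix y assume y: "y \<in> carrier \<E>"
        then obtain x where x: "x \<in> carrier Q.R" "\<Theta> y = Q.T x"
          using \<Theta>_closed[OF y] by (auto simp flip: Q.T_surj)
        have "\<Phi> (Q.I +>\<^bsub>Q.R\<^esub> x) = y"
          using x y by (intro \<Phi>_eqI) (simp_all add: Q.quotient.coset_in_quot Q.quotient.coord_coset)
        then show "y \<in> \<Phi> ` carrier ?V" using Q.quotient.coset_in_quot[OF x(1)] by blast
      qed (use \<Phi>_closed in blast)
    qed
  qed
  moreover have "\<Phi> (c \<odot>\<^bsub>?V\<^esub> X) = c \<odot>\<^bsub>\<E>\<^esub> \<Phi> X" if "X \<in> carrier ?V" for c X
    using that \<Phi>_closed by (intro \<Phi>_eqI) (simp_all add: \<E>_smult \<Theta>_\<Phi> Q.quotient.smult_quot)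
  ultimately have iso: "\<Phi> \<in> algebra_iso ?V \<E>" by (simp add: algebra_iso_def)
  have "\<Phi> (vertex_idempotent N j) = ext_of_hom A M P d \<epsilon> (\<pi> j)" if j: "j \<in> {0..N}" for j
  proof -
    have q: "(j, []) \<in> paths Q.Q" using j by (simp add: paths_ext_quiver)
    show ?thesis
      unfolding vertex_idempotent_def
    proof (rule \<Phi>_eqI)
      \<comment> \<open>Both sides are the matrix unit at \<open>(j, j, 0)\<close>.\<close>
      show "\<Theta> (ext_of_hom A M P d \<epsilon> (\<pi> j)) (a, b, s) = Q.quotient.coord (Q.I +>\<^bsub>Q.R\<^esub> single (j, [])) (a, b, s)" for a b s
        using j by (auto simp: \<Theta>_projection Q.quotient.coord_coset Q.single_R_closed[OF q] Q.T_single[OF q])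
    qed (simp_all add: Q.quotient.coset_in_quot Q.single_R_closed[OF q] ext_of_hom(1)[OF \<pi>_hom])
  qed
  then show ?thesis
    using iso unfolding V A_def One_nat_def by blast
qed

end
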